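(* Let $g$ be a real analytic generic mixed type metric on a connected real analytic 2-manifold $\Sigma$. For every semidefinite point $p\in S(g)$ there exist a neighborhood $U$ of $p$ and a real analytic mixed type surface $f:U\to\mathbf{L}^3$ such that $g$ coincides on $U$ with the first fundamental form $ds^2$ of $f$.
   Context: A metric on a smooth 2-manifold $\Sigma$ is a smooth symmetric $(0,2)$-tensor $g$ (possibly degenerate). A point is definite, indefinite or semidefinite if $g$ there is definite, indefinite non-degenerate, or degenerate; $S(g)$ is the set of semidefinite points. $g$ is a mixed type metric if definite, indefinite and semidefinite points all exist. With $g=E\,du^2+2F\,du\,dv+G\,dv^2$ and $\lambda=EG-F^2$, a semidefinite point $p$ is admissible if $d\lambda(p)\ne0$. A mixed type metric is admissible if it is not negative definite at any point and all its semidefinite points are admissible. Then near $p\in S(g)$ the set $S(g)$ is the image of a regular curve through $p$ (characteristic curve). A null vector at $p\in S(g)$ is a non-zero $w\in T_p\Sigma$ with $g(w,\cdot)=0$; null vectors together with $0$ form a line. $p$ is type I if the characteristic curve is not tangent to the null direction at $p$, type II if it is. A regular curve $c$ with $c(0)=p$ is non-null at $p$ if $c'(0)$ is not a null vector. For a type I point $p$ take coordinates $(u,v)$ centered at $p$ with $\partial_v$ null at $p$; the intrinsic lightlike singular curvature is $\tilde\kappa_L(p)=\frac1{E\sqrt[3]{G_v}}\big(F_u-\frac12E_v-\frac{G_u^2}{2G_v}\big)\big|_{(0,0)}$ (independent of the coordinates). A type I point is generic if $\tilde\kappa_L(p)\neq0$. For $c$ non-null at a type II point $p=c(0)$, one has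 $c(t)\notin S(g)$ and $g(c',c')>0$ for small $t\ne0$, and $\kappa_g(t)=g(\nabla_{c'}c',n_g)/g(c',c')$, where $\nabla$ is the Levi-Civita connection of $g$ off $S(g)$ and $n_g$ is the unit normal along $c$ ($g(n_g,c')=0$, $g(n_g,n_g)=\pm1$). A type II point $p$ is generic if some curve $c$ non-null at $p=c(0)$ has $\kappa_g(t)$ unbounded at $t=0$. A generic mixed type metric is an admissible mixed type metric all of whose semidefinite points are generic. $\mathbf{L}^3$ is $\mathbb R^3$ with $\langle x,y\rangle=x_1y_1+x_2y_2-x_3y_3$. A surface is an embedding $f$ of a connected 2-manifold into $\mathbf{L}^3$, with first fundamental form $f^*\langle\cdot,\cdot\rangle$; it is a mixed type surface if this form is positive definite at some points, indefinite at some, degenerate at some. *)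

theory Defs
  imports "HOL-Analysis.Analysis"
begin

section \<open>Real analytic 2-manifolds\<close>

text \<open>For an open set \<open>S\<close>: around every point of \<open>S\<close> the function is the sum of an (unconditionally,
  hence absolutely) convergent power series in the two coordinates.\<close>

definition real_analytic_on ::
    "(real \<times> real \<Rightarrow> 'b::real_normed_vector) \<Rightarrow> (real \<times> real) set \<Rightarrow> bool" where
  "real_analytic_on f S \<longleftrightarrow>
     (\<forall>x\<in>S. \<exists>a::nat \<Rightarrow> nat \<Rightarrow> 'b. \<exists>r>0. \<forall>y\<in>ball x r.
        ((\<lambda>(i, j). ((fst y - fst x) ^ i * (snd y - snd x) ^ j) *\<^sub>R a i j) has_sum f y) UNIV)"

text \<open>A chart is a pair of a domain and a coordinate map; the values of the map outside of the domain
  are irrelevant.\<close>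

type_synonym 'a chart = "'a set \<times> ('a \<Rightarrow> real \<times> real)"

definition coords :: "'a chart \<Rightarrow> (real \<times> real) set" where
  "coords c = snd c ` fst c"

definition chart_inv :: "'a chart \<Rightarrow> real \<times> real \<Rightarrow> 'a" where
  "chart_inv c = inv_into (fst c) (snd c)"

definition is_chart :: "'a topology \<Rightarrow> 'a chart \<Rightarrow> bool" where
  "is_chart X c \<longleftrightarrow> openin X (fst c) \<and> open (coords c) \<and>
     embedding_map (subtopology X (fst c)) euclidean (snd c)"

definition transition :: "'a chart \<Rightarrow> 'a chart \<Rightarrow> real \<times> real \<Rightarrow> real \<times> real" where
  "transition c d = snd d \<circ> chart_inv c"

definition compatible :: "'a chart \<Rightarrow> 'a chart \<Rightarrow> bool" where
  "compatible c d \<longleftrightarrow>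
     real_analytic_on (transition c d) (snd c ` (fst c \<inter> fst d)) \<and>
     real_analytic_on (transition d c) (snd d ` (fst c \<inter> fst d))"

text \<open>The analytic structure \<open>A\<close> is a maximal atlas, so its members are exactly the (real analytic)
  local coordinate systems of the manifold.\<close>

definition real_analytic_2manifold :: "'a topology \<Rightarrow> 'a chart set \<Rightarrow> bool" where
  "real_analytic_2manifold X A \<longleftrightarrow>
     Hausdorff_space X \<and> second_countable X \<and>
     (\<forall>c\<in>A. is_chart X c) \<and> topspace X = (\<Union>c\<in>A. fst c) \<and>
     (\<forall>c\<in>A. \<forall>d\<in>A. compatible c d) \<and>
     (\<forall>c. is_chart X c \<and> (\<forall>d\<in>A. compatible c d) \<longrightarrow> c \<in> A)"

definition in_some_chart :: "'a chart set \<Rightarrow> 'a \<Rightarrow> ('a chart \<Rightarrow> bool) \<Rightarrow> bool" where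
  "in_some_chart A p Q \<longleftrightarrow> (\<exists>c\<in>A. p \<in> fst c \<and> Q c)"


section \<open>Bilinear forms\<close>

type_synonym form2 = "real \<times> real \<Rightarrow> real \<times> real \<Rightarrow> real"

definition positive_definite :: "form2 \<Rightarrow> bool" where
  "positive_definite b \<longleftrightarrow> (\<forall>w. w \<noteq> 0 \<longrightarrow> b w w > 0)"

definition negative_definite :: "form2 \<Rightarrow> bool" where
  "negative_definite b \<longleftrightarrow> (\<forall>w. w \<noteq> 0 \<longrightarrow> b w w < 0)"

definition definite :: "form2 \<Rightarrow> bool" where
  "definite b \<longleftrightarrow> positive_definite b \<or> negative_definite b"

definition null_vector :: "form2 \<Rightarrow> real \<times> real \<Rightarrow> bool" where
  "null_vector b w \<longleftrightarrow> w \<noteq> 0 \<and> (\<forall>z. b w z = 0)"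

definition degenerate :: "form2 \<Rightarrow> bool" where
  "degenerate b \<longleftrightarrow> (\<exists>w. null_vector b w)"

definition indefinite :: "form2 \<Rightarrow> bool" where
  "indefinite b \<longleftrightarrow> \<not> degenerate b \<and> (\<exists>w. b w w > 0) \<and> (\<exists>w. b w w < 0)"


section \<open>Metrics in a coordinate domain\<close>

text \<open>The argument of a \<open>local_metric\<close> is the point of the coordinate plane; vectors are given by
  their components with respect to the coordinate frame, \<open>(1, 0)\<close> being \<open>\<partial>\<^sub>u\<close> and \<open>(0, 1)\<close> being \<open>\<partial>\<^sub>v\<close>.\<close>

type_synonym local_metric = "real \<times> real \<Rightarrow> form2"

definition comp_E :: "local_metric \<Rightarrow> real \<times> real \<Rightarrow> real" where
  "comp_E h x = h x (1, 0) (1, 0)"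

definition comp_F :: "local_metric \<Rightarrow> real \<times> real \<Rightarrow> real" where
  "comp_F h x = h x (1, 0) (0, 1)"

definition comp_G :: "local_metric \<Rightarrow> real \<times> real \<Rightarrow> real" where
  "comp_G h x = h x (0, 1) (0, 1)"

definition discr :: "local_metric \<Rightarrow> real \<times> real \<Rightarrow> real" where
  "discr h x = comp_E h x * comp_G h x - (comp_F h x)\<^sup>2"

definition d_u :: "(real \<times> real \<Rightarrow> real) \<Rightarrow> real \<times> real \<Rightarrow> real" where
  "d_u f x = deriv (\<lambda>s. f (s, snd x)) (fst x)"

definition d_v :: "(real \<times> real \<Rightarrow> real) \<Rightarrow> real \<times> real \<Rightarrow> real" where
  "d_v f x = deriv (\<lambda>s. f (fst x, s)) (snd x)"

definition semidefinite_set :: "(real \<times> real) set \<Rightarrow> local_metric \<Rightarrow> (real \<times> real) set" where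
  "semidefinite_set D h = {x \<in> D. degenerate (h x)}"

definition admissible_at :: "local_metric \<Rightarrow> real \<times> real \<Rightarrow> bool" where
  "admissible_at h x \<longleftrightarrow> frechet_derivative (discr h) (at x) \<noteq> (\<lambda>w. 0)"

definition velocity :: "(real \<Rightarrow> 'b::real_normed_vector) \<Rightarrow> real \<Rightarrow> 'b" where
  "velocity c t = vector_derivative c (at t)"

text \<open>Smooth curves with non-vanishing velocity, \<open>I\<close> being an open set of parameters.\<close>

definition regular_curve_on :: "real set \<Rightarrow> (real \<Rightarrow> real \<times> real) \<Rightarrow> bool" where
  "regular_curve_on I c \<longleftrightarrow>
     (\<forall>n. \<forall>t\<in>I. (velocity ^^ n) c differentiable (at t)) \<and> (\<forall>t\<in>I. velocity c t \<noteq> 0)"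

definition characteristic_curve ::
    "(real \<times> real) set \<Rightarrow> local_metric \<Rightarrow> real \<times> real \<Rightarrow> (real \<Rightarrow> real \<times> real) \<Rightarrow> bool" where
  "characteristic_curve D h x c \<longleftrightarrow> c 0 = x \<and>
     (\<exists>\<epsilon>>0. \<exists>N. regular_curve_on {-\<epsilon><..<\<epsilon>} c \<and> open N \<and> x \<in> N \<and> N \<subseteq> D \<and>
        semidefinite_set D h \<inter> N = c ` {-\<epsilon><..<\<epsilon>})"

definition type_I :: "(real \<times> real) set \<Rightarrow> local_metric \<Rightarrow> real \<times> real \<Rightarrow> bool" where
  "type_I D h x \<longleftrightarrow>
     degenerate (h x) \<and> (\<exists>c. characteristic_curve D h x c \<and> \<not> null_vector (h x) (velocity c 0))"

definition type_II :: "(real \<times> real) set \<Rightarrow> local_metric \<Rightarrow> real \<times> real \<Rightarrow> bool" where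
  "type_II D h x \<longleftrightarrow>
     degenerate (h x) \<and> (\<exists>c. characteristic_curve D h x c \<and> null_vector (h x) (velocity c 0))"

text \<open>The intrinsic lightlike singular curvature at the origin of a coordinate system.  Note that
  \<open>root 3\<close> is the real cube root also for negative arguments.\<close>

definition kappa_L :: "local_metric \<Rightarrow> real" where
  "kappa_L h =
     (d_u (comp_F h) (0, 0) - d_v (comp_E h) (0, 0) / 2
        - (d_u (comp_G h) (0, 0))\<^sup>2 / (2 * d_v (comp_G h) (0, 0)))
     / (comp_E h (0, 0) * root 3 (d_v (comp_G h) (0, 0)))"

text \<open>The connection coefficients of the Levi-Civita connection at a point where the metric is
  non-degenerate: with respect to coordinates, \<open>\<nabla>\<^sub>w Y = dY(w) + \<Gamma>(w, Y)\<close> is torsion free iff \<open>\<Gamma>\<close> is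
  symmetric, and compatible with the metric iff the last conjunct holds.\<close>

definition levi_civita ::
    "local_metric \<Rightarrow> real \<times> real \<Rightarrow> real \<times> real \<Rightarrow> real \<times> real \<Rightarrow> real \<times> real" where
  "levi_civita h x = (THE \<Gamma>. bilinear \<Gamma> \<and> (\<forall>w y. \<Gamma> w y = \<Gamma> y w) \<and>
     (\<forall>w y z. frechet_derivative (\<lambda>x'. h x' y z) (at x) w = h x (\<Gamma> w y) z + h x y (\<Gamma> w z)))"

definition acceleration :: "local_metric \<Rightarrow> (real \<Rightarrow> real \<times> real) \<Rightarrow> real \<Rightarrow> real \<times> real" where
  "acceleration h c t =
     velocity (velocity c) t + levi_civita h (c t) (velocity c t) (velocity c t)"

definition geodesic_curvature ::
    "local_metric \<Rightarrow> (real \<Rightarrow> real \<times> real) \<Rightarrow> (real \<Rightarrow> real \<times> real) \<Rightarrow> real \<Rightarrow> real" where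
  "geodesic_curvature h c n t =
     h (c t) (acceleration h c t) (n t) / h (c t) (velocity c t) (velocity c t)"

text \<open>The unit normal is determined up to sign at each parameter, so the choice of \<open>n\<close> does not
  affect the absolute value of the geodesic curvature.\<close>

definition unit_normal_near_0 ::
    "local_metric \<Rightarrow> (real \<Rightarrow> real \<times> real) \<Rightarrow> (real \<Rightarrow> real \<times> real) \<Rightarrow> bool" where
  "unit_normal_near_0 h c n \<longleftrightarrow>
     (\<forall>\<^sub>F t in at 0. h (c t) (n t) (velocity c t) = 0 \<and> \<bar>h (c t) (n t) (n t)\<bar> = 1)"

definition has_unbounded_curvature ::
    "(real \<times> real) set \<Rightarrow> local_metric \<Rightarrow> real \<times> real \<Rightarrow> bool" where
  "has_unbounded_curvature D h x \<longleftrightarrow>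
     (\<exists>c n \<epsilon>. \<epsilon> > 0 \<and> regular_curve_on {-\<epsilon><..<\<epsilon>} c \<and> c ` {-\<epsilon><..<\<epsilon>} \<subseteq> D \<and> c 0 = x \<and>
        \<not> null_vector (h x) (velocity c 0) \<and> unit_normal_near_0 h c n \<and>
        \<not> Bfun (geodesic_curvature h c n) (at 0))"


section \<open>Metrics on a manifold\<close>

text \<open>A symmetric (0,2)-tensor field is given by its components in every chart of the maximal atlas,
  subject to the tensorial transformation law.\<close>

type_synonym 'a metric_field = "'a chart \<Rightarrow> local_metric"

definition real_analytic_metric :: "'a chart set \<Rightarrow> 'a metric_field \<Rightarrow> bool" where
  "real_analytic_metric A g \<longleftrightarrow>
     (\<forall>c\<in>A. (\<forall>x\<in>coords c. bilinear (g c x) \<and> (\<forall>w z. g c x w z = g c x z w)) \<and>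
            (\<forall>w z. real_analytic_on (\<lambda>x. g c x w z) (coords c))) \<and>
     (\<forall>c\<in>A. \<forall>d\<in>A. \<forall>p \<in> fst c \<inter> fst d. \<forall>w z.
        g c (snd c p) w z =
        g d (snd d p) (frechet_derivative (transition c d) (at (snd c p)) w)
                      (frechet_derivative (transition c d) (at (snd c p)) z))"

definition form_at :: "'a chart set \<Rightarrow> 'a metric_field \<Rightarrow> 'a \<Rightarrow> (form2 \<Rightarrow> bool) \<Rightarrow> bool" where
  "form_at A g p P \<longleftrightarrow> in_some_chart A p (\<lambda>c. P (g c (snd c p)))"

definition semidefinite_points :: "'a topology \<Rightarrow> 'a chart set \<Rightarrow> 'a metric_field \<Rightarrow> 'a set" where
  "semidefinite_points X A g = {p \<in> topspace X. form_at A g p degenerate}"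

definition mixed_type_metric :: "'a topology \<Rightarrow> 'a chart set \<Rightarrow> 'a metric_field \<Rightarrow> bool" where
  "mixed_type_metric X A g \<longleftrightarrow>
     (\<exists>p\<in>topspace X. form_at A g p definite) \<and>
     (\<exists>p\<in>topspace X. form_at A g p indefinite) \<and>
     semidefinite_points X A g \<noteq> {}"

definition admissible_metric :: "'a topology \<Rightarrow> 'a chart set \<Rightarrow> 'a metric_field \<Rightarrow> bool" where
  "admissible_metric X A g \<longleftrightarrow>
     (\<forall>p\<in>topspace X. \<not> form_at A g p negative_definite) \<and>
     (\<forall>p\<in>semidefinite_points X A g. in_some_chart A p (\<lambda>c. admissible_at (g c) (snd c p)))"

definition type_I_point :: "'a chart set \<Rightarrow> 'a metric_field \<Rightarrow> 'a \<Rightarrow> bool" where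
  "type_I_point A g p \<longleftrightarrow> in_some_chart A p (\<lambda>c. type_I (coords c) (g c) (snd c p))"

definition type_II_point :: "'a chart set \<Rightarrow> 'a metric_field \<Rightarrow> 'a \<Rightarrow> bool" where
  "type_II_point A g p \<longleftrightarrow> in_some_chart A p (\<lambda>c. type_II (coords c) (g c) (snd c p))"

text \<open>The value of \<open>kappa_L\<close> at a type I point does not depend on the coordinates chosen among those
  centered at the point and having \<open>\<partial>\<^sub>v\<close> null there.\<close>

definition generic_type_I_point :: "'a chart set \<Rightarrow> 'a metric_field \<Rightarrow> 'a \<Rightarrow> bool" where
  "generic_type_I_point A g p \<longleftrightarrow> type_I_point A g p \<and>
     in_some_chart A p (\<lambda>c. snd c p = (0, 0) \<and> null_vector (g c (0, 0)) (0, 1) \<and> kappa_L (g c) \<noteq> 0)"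

definition generic_type_II_point :: "'a chart set \<Rightarrow> 'a metric_field \<Rightarrow> 'a \<Rightarrow> bool" where
  "generic_type_II_point A g p \<longleftrightarrow> type_II_point A g p \<and>
     in_some_chart A p (\<lambda>c. has_unbounded_curvature (coords c) (g c) (snd c p))"

definition generic_mixed_type_metric ::
    "'a topology \<Rightarrow> 'a chart set \<Rightarrow> 'a metric_field \<Rightarrow> bool" where
  "generic_mixed_type_metric X A g \<longleftrightarrow>
     mixed_type_metric X A g \<and> admissible_metric X A g \<and>
     (\<forall>p\<in>semidefinite_points X A g. generic_type_I_point A g p \<or> generic_type_II_point A g p)"


section \<open>Surfaces in Lorentz-Minkowski space\<close>

definition lorentz :: "real ^ 3 \<Rightarrow> real ^ 3 \<Rightarrow> real" where
  "lorentz x y = x $ 1 * y $ 1 + x $ 2 * y $ 2 - x $ 3 * y $ 3"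

definition differential_in :: "'a chart \<Rightarrow> ('a \<Rightarrow> real ^ 3) \<Rightarrow> real \<times> real \<Rightarrow> real \<times> real \<Rightarrow> real ^ 3"
  where "differential_in c f x = frechet_derivative (f \<circ> chart_inv c) (at x)"

definition first_fundamental_form :: "('a \<Rightarrow> real ^ 3) \<Rightarrow> 'a metric_field" where
  "first_fundamental_form f c x w z = lorentz (differential_in c f x w) (differential_in c f x z)"

definition real_analytic_surface ::
    "'a topology \<Rightarrow> 'a chart set \<Rightarrow> 'a set \<Rightarrow> ('a \<Rightarrow> real ^ 3) \<Rightarrow> bool" where
  "real_analytic_surface X A U f \<longleftrightarrow>
     openin X U \<and> connectedin X U \<and>
     embedding_map (subtopology X U) euclidean f \<and>
     (\<forall>c\<in>A. real_analytic_on (f \<circ> chart_inv c) (snd c ` (fst c \<inter> U)) \<and>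
        (\<forall>x \<in> snd c ` (fst c \<inter> U). inj (differential_in c f x)))"

definition real_analytic_mixed_type_surface ::
    "'a topology \<Rightarrow> 'a chart set \<Rightarrow> 'a set \<Rightarrow> ('a \<Rightarrow> real ^ 3) \<Rightarrow> bool" where
  "real_analytic_mixed_type_surface X A U f \<longleftrightarrow>
     real_analytic_surface X A U f \<and>
     (\<exists>q\<in>U. form_at A (first_fundamental_form f) q positive_definite) \<and>
     (\<exists>q\<in>U. form_at A (first_fundamental_form f) q indefinite) \<and>
     (\<exists>q\<in>U. form_at A (first_fundamental_form f) q degenerate)"

definition metrics_coincide_on ::
    "'a chart set \<Rightarrow> 'a set \<Rightarrow> 'a metric_field \<Rightarrow> 'a metric_field \<Rightarrow> bool" where
  "metrics_coincide_on A U g h \<longleftrightarrow>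
     (\<forall>c\<in>A. \<forall>q \<in> fst c \<inter> U. \<forall>w z. g c (snd c q) w z = h c (snd c q) w z)"

end

theory Submission
  imports Defs "HOL-Analysis.Analysis"
begin

text \<open>Let \<open>p\<close> be a semidefinite point, \<open>(u, v)\<close> coordinates centred at \<open>p\<close>, and \<open>E, F, G\<close> the components of the
metric.  If \<open>f\<close> realizes the metric, differentiating \<open>f\<^sub>u\<cdot>f\<^sub>u = E\<close>, \<open>f\<^sub>u\<cdot>f\<^sub>v = F\<close>, \<open>f\<^sub>v\<cdot>f\<^sub>v = G\<close> gives

  \<open>f\<^sub>u\<cdot>f\<^sub>v\<^sub>v = F\<^sub>v - G\<^sub>u/2\<close>,   \<open>f\<^sub>v\<cdot>f\<^sub>v\<^sub>v = G\<^sub>v/2\<close>,   \<open>f\<^sub>u\<^sub>u\<cdot>f\<^sub>v\<^sub>v = f\<^sub>u\<^sub>v\<cdot>f\<^sub>u\<^sub>v - E\<^sub>v\<^sub>v/2 + F\<^sub>u\<^sub>v - G\<^sub>u\<^sub>u/2\<close>,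

a linear system for \<open>f\<^sub>v\<^sub>v\<close> (Janet's method).  It determines \<open>f\<^sub>v\<^sub>v\<close> as soon as \<open>f\<^sub>u, f\<^sub>v, f\<^sub>u\<^sub>u\<close> are linearly
independent, whether or not the metric degenerates, so \<open>f\<close> can be found as the solution of an
analytic Cauchy problem with data \<open>f(u,0)\<close>, \<open>f\<^sub>v(u,0)\<close>.  Conversely, if the data satisfy the metric
equations along \<open>v = 0\<close> and moreover \<open>f\<^sub>u\<^sub>u\<cdot>f\<^sub>v = F\<^sub>u - E\<^sub>v/2\<close> there, then the solution realizes the
metric (\<open>formal_isometry\<close>).

Independence.  At \<open>p\<close> the form has rank one; let \<open>n\<close> span its kernel.  In coordinates with
\<open>\<partial>\<^sub>u = w\<close>, \<open>\<partial>\<^sub>v = n\<close>, \<open>E = 1\<close>, \<open>F = G = 0\<close> at \<open>p\<close> suitable data exist if \<open>F\<^sub>u - E\<^sub>v/2 \<noteq> 0\<close> at \<open>p\<close>.  Replacing \<open>w\<close> by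
\<open>w + \<tau>n\<close> changes this number into a polynomial in \<open>\<tau>\<close> whose higher coefficients are the values of
the differential of \<open>g(n, n)\<close> at \<open>w\<close> and (halved) at \<open>n\<close>.  Since the discriminant \<open>\<lambda>\<close> satisfies
\<open>d\<lambda> = c d(g(n, n))\<close> at \<open>p\<close>, admissibility says precisely that these do not both vanish, and a good \<open>\<tau>\<close>
exists (\<open>plane_realization\<close>).  That the metric is nowhere negative definite makes \<open>w\<close> spacelike:
\<open>\<lambda>\<close> takes positive values near \<open>p\<close>, where the form is definite.

Solving the Cauchy problem.  Double power series \<open>\<Sum> a\<^sub>i\<^sub>j u\<^sup>i v\<^sup>j\<close> with norm \<open>\<Sum> |a\<^sub>i\<^sub>j| / binom(i+j, i)\<close> form a
Banach algebra by Vandermonde's identity, and on it differentiation in \<open>u\<close> followed by integration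
in \<open>v\<close> does not increase the norm.  After the substitution \<open>u = rU\<close>, \<open>v = sV\<close> this operator is
multiplied by \<open>s/r\<close>.  The system, rewritten for the unknown \<open>W = f\<^sub>v\<^sub>v\<close>, is a quadratic equation in
which every other derivative of \<open>f\<close> is a term given by the data plus such a small operator applied
to \<open>W\<close>, and Banach's fixed point theorem solves it (\<open>quadratic_fixed_point\<close>, \<open>cauchy_problem\<close>).  Substituting elements of the
algebra into power series shows also that real analytic functions are closed under composition.\<close>

section \<open>Formal double power series\<close>

text \<open>The outer variable of a double series is \<open>v\<close>, the inner one \<open>u\<close>; coefficients are indexed by the
pair of exponents of \<open>u\<close> and \<open>v\<close>, in this order.\<close>

type_synonym ser2 = "real fps fps"

definition pcoeff :: "ser2 \<Rightarrow> nat \<times> nat \<Rightarrow> real" where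
  "pcoeff a p = fps_nth (fps_nth a (snd p)) (fst p)"

text \<open>The index set of the Cauchy product of two double series.\<close>

definition antidiag :: "nat \<times> nat \<Rightarrow> ((nat \<times> nat) \<times> (nat \<times> nat)) set" where
  "antidiag n = {(p, q). p + q = n}"

lemma ser2_eqI: "(\<And>p. pcoeff a p = pcoeff b p) \<Longrightarrow> a = b"
  unfolding pcoeff_def by (metis fps_ext fst_conv snd_conv)

lemma antidiag_eq_image:
  "antidiag n = (\<lambda>(l, k). ((k, l), (fst n - k, snd n - l))) ` ({0..snd n} \<times> {0..fst n})"
proof (intro set_eqI iffI)
  fix x assume "x \<in> antidiag n"
  then obtain a b c d where x: "x = ((a, b), (c, d))" "(a, b) + (c, d) = n"
    by (auto simp: antidiag_def)
  then have "fst n = a + c" "snd n = b + d" by auto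
  then show "x \<in> (\<lambda>(l, k). ((k, l), (fst n - k, snd n - l))) ` ({0..snd n} \<times> {0..fst n})"
    unfolding x by (intro image_eqI[where x = "(b, a)"]) auto
qed (auto simp: antidiag_def prod_eq_iff)

lemma finite_antidiag [simp]: "finite (antidiag n)"
  unfolding antidiag_eq_image by simp

lemma pcoeff_add [simp]: "pcoeff (a + b) p = pcoeff a p + pcoeff b p"
  and pcoeff_diff [simp]: "pcoeff (a - b) p = pcoeff a p - pcoeff b p"
  and pcoeff_uminus [simp]: "pcoeff (- a) p = - pcoeff a p"
  and pcoeff_0 [simp]: "pcoeff 0 p = 0"
  by (auto simp: pcoeff_def)

lemma pcoeff_1: "pcoeff 1 p = (if p = 0 then 1 else 0)"
  by (cases p) (auto simp: pcoeff_def fps_one_nth zero_prod_def)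

lemma pcoeff_mult: "pcoeff (a * b) n = (\<Sum>(p, q)\<in>antidiag n. pcoeff a p * pcoeff b q)"
proof -
  have inj: "inj_on (\<lambda>(l, k). ((k, l), (fst n - k, snd n - l))) ({0..snd n} \<times> {0..fst n})"
    by (auto simp: inj_on_def)
  have "pcoeff (a * b) n =
     (\<Sum>l=0..snd n. \<Sum>k=0..fst n. pcoeff a (k, l) * pcoeff b (fst n - k, snd n - l))"
    by (simp add: pcoeff_def fps_mult_nth fps_sum_nth)
  also have "\<dots> = (\<Sum>(p, q)\<in>antidiag n. pcoeff a p * pcoeff b q)"
    unfolding antidiag_eq_image
    by (subst sum.reindex[OF inj]) (simp add: sum.cartesian_product case_prod_unfold)
  finally show ?thesis .
qed

definition cconst :: "real \<Rightarrow> ser2" where "cconst c = fps_const (fps_const c)"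

lemma pcoeff_cconst: "pcoeff (cconst c) p = (if p = 0 then c else 0)"
  by (cases p) (auto simp: pcoeff_def cconst_def zero_prod_def)

lemma pcoeff_cconst_mult [simp]: "pcoeff (cconst c * a) p = c * pcoeff a p"
  by (simp add: pcoeff_def cconst_def)

lemma cconst_simps: "cconst (x + y) = cconst x + cconst y" "cconst (x * y) = cconst x * cconst y"
  "cconst (- x) = - cconst x" "cconst (x - y) = cconst x - cconst y"
  "cconst 0 = 0" "cconst 1 = 1"
  by (simp_all add: cconst_def flip: fps_const_sub)

text \<open>A sum over all pairs of indices may be grouped by the sum of the pair.\<close>

lemma has_sum_antidiag:
  fixes F :: "(nat \<times> nat) \<times> (nat \<times> nat) \<Rightarrow> real"
  assumes "(F has_sum s) UNIV"
  shows "((\<lambda>n. \<Sum>x\<in>antidiag n. F x) has_sum s) UNIV"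
proof (rule has_sum_Sigma'[where B = antidiag and f = "\<lambda>(n, x). F x"])
  have "bij_betw (\<lambda>x. (fst x + snd x, x)) UNIV (Sigma UNIV antidiag)"
    by (rule bij_betwI[where g = snd]) (auto simp: antidiag_def)
  from has_sum_reindex_bij_betw[OF this, of "\<lambda>(n, x). F x"]
  show "((\<lambda>(n, x). F x) has_sum s) (Sigma UNIV antidiag)" using assms by simp
  show "((\<lambda>y. case (x, y) of (n, x) \<Rightarrow> F x) has_sum sum F (antidiag x)) (antidiag x)" for x
    by (simp add: has_sum_finiteI)
qed

lemma has_sum_product_real:
  fixes f g :: "_ \<Rightarrow> real"
  assumes "(f has_sum s) A" "(g has_sum t) B" "(\<lambda>x. norm (f x)) summable_on A" "(\<lambda>x. norm (g x)) summable_on B"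
  shows "((\<lambda>(x, y). f x * g y) has_sum s * t) (A \<times> B)"
proof -
  have "(\<lambda>x. norm (case x of (x, y) \<Rightarrow> f x * g y)) summable_on A \<times> B"
    unfolding Infinite_Sum.abs_summable_on_Sigma_iff
    using assms(3,4) by (simp add: abs_mult summable_on_cmult_right infsum_cmult_right' summable_on_cmult_left)
  then have "(\<lambda>(x, y). f x * g y) summable_on A \<times> B" by (rule abs_summable_summable)
  then obtain u where u: "((\<lambda>(x, y). f x * g y) has_sum u) (A \<times> B)"
    unfolding summable_on_def by blast
  have "((\<lambda>x. f x * t) has_sum u) A"
    by (rule has_sum_Sigma'[OF u]) (use assms(2) in \<open>auto intro: has_sum_cmult_right\<close>)
  moreover have "((\<lambda>x. f x * t) has_sum s * t) A" by (rule has_sum_cmult_left[OF assms(1)])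
  ultimately show ?thesis using u has_sum_unique by blast
qed

section \<open>A Banach algebra of power series\<close>

text \<open>The weight is dictated by two requirements: products must be submultiplicative, and the operator
taking \<open>u\<^sup>i v\<^sup>j\<close> to \<open>i/(j+1) u\<^sup>i\<^sup>-\<^sup>1 v\<^sup>j\<^sup>+\<^sup>1\<close> must be bounded.  Weights depending on the total degree alone can
meet the first but not the second.\<close>

definition wgt :: "nat \<times> nat \<Rightarrow> real" where
  "wgt p = 1 / real ((fst p + snd p) choose fst p)"

lemma wgt_pos: "wgt p > 0" and wgt_le_1: "wgt p \<le> 1"
  unfolding wgt_def by (auto simp: Suc_leI)

lemma wgt_nonneg [simp]: "wgt p \<ge> 0" using wgt_pos[of p] by simp

text \<open>One summand of Vandermonde's convolution is at most the whole sum.\<close>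

lemma wgt_submult: "wgt (p + q) \<le> wgt p * wgt q"
proof -
  obtain i j k l where pq: "p = (i, j)" "q = (k, l)" by fastforce
  have "((i + j) choose i) * ((k + l) choose k)
      \<le> (\<Sum>m\<le>i + k. ((i + j) choose m) * ((k + l) choose (i + k - m)))"
    using member_le_sum[of i "{..i + k}" "\<lambda>m. ((i + j) choose m) * ((k + l) choose (i + k - m))"]
    by simp
  also have "\<dots> = ((i + k) + (j + l)) choose (i + k)"
    by (subst vandermonde) (simp add: add_ac)
  finally have "real (((i + j) choose i) * ((k + l) choose k))
      \<le> real (((i + k) + (j + l)) choose (i + k))"
    by (simp only: of_nat_le_iff)
  moreover have "0 < real (((i + j) choose i) * ((k + l) choose k))" by simp
  ultimately show ?thesis
    unfolding wgt_def pq by (simp add: frac_le)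
qed

text \<open>Elements of finite norm therefore converge on the square \<open>|u|, |v| \<le> 1/2\<close>.\<close>

lemma wgt_geometric: "(1 / 2) ^ (fst p + snd p) \<le> wgt p"
proof -
  have "real ((fst p + snd p) choose fst p) \<le> 2 ^ (fst p + snd p)"
    using binomial_le_pow2[of "fst p + snd p" "fst p"] by (metis of_nat_le_iff of_nat_numeral of_nat_power)
  then show ?thesis
    unfolding wgt_def power_one_over by (intro divide_left_mono) auto
qed

definition bnorm :: "ser2 \<Rightarrow> real" where "bnorm a = (\<Sum>\<^sub>\<infinity>p. \<bar>pcoeff a p\<bar> * wgt p)"

definition bounded_ser :: "ser2 \<Rightarrow> bool" where
  "bounded_ser a \<longleftrightarrow> (\<lambda>p. \<bar>pcoeff a p\<bar> * wgt p) summable_on UNIV"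

lemma bounded_ser_le:
  assumes "\<And>p. \<bar>pcoeff a p\<bar> * wgt p \<le> f p" "f summable_on UNIV"
  shows "bounded_ser a" "bnorm a \<le> infsum f UNIV"
proof -
  show "bounded_ser a" unfolding bounded_ser_def
    by (rule summable_on_comparison_test[OF assms(2)]) (use assms in simp_all)
  then show "bnorm a \<le> infsum f UNIV"
    unfolding bnorm_def bounded_ser_def by (intro infsum_mono assms) 
qed

lemma bounded_ser_0: "bounded_ser 0" by (simp add: bounded_ser_def)

lemma bnorm_cconst: "bounded_ser (cconst c)" "bnorm (cconst c) = \<bar>c\<bar>"
proof -
  have "((\<lambda>p. \<bar>pcoeff (cconst c) p\<bar> * wgt p) has_sum \<bar>c\<bar>) UNIV"
    by (rule has_sum_finite_neutralI[where B = "{0}"]) (auto simp: pcoeff_cconst wgt_def)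
  then show "bounded_ser (cconst c)" "bnorm (cconst c) = \<bar>c\<bar>"
    unfolding bounded_ser_def bnorm_def by (auto simp: has_sum_imp_summable infsumI)
qed

lemma bounded_ser_1: "bounded_ser 1" "bnorm 1 = 1"
  using bnorm_cconst[of 1] by (simp_all add: cconst_simps)

lemma bounded_ser_add:
  assumes "bounded_ser a" "bounded_ser b"
  shows "bounded_ser (a + b)" "bnorm (a + b) \<le> bnorm a + bnorm b"
proof -
  have s: "(\<lambda>p. \<bar>pcoeff a p\<bar> * wgt p + \<bar>pcoeff b p\<bar> * wgt p) summable_on UNIV"
    using assms unfolding bounded_ser_def by (rule summable_on_add)
  have le: "\<bar>pcoeff (a + b) p\<bar> * wgt p \<le> \<bar>pcoeff a p\<bar> * wgt p + \<bar>pcoeff b p\<bar> * wgt p" for p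
    using wgt_pos[of p] by (simp flip: distrib_right add: mult_right_mono abs_triangle_ineq)
  show "bounded_ser (a + b)" "bnorm (a + b) \<le> bnorm a + bnorm b"
    using bounded_ser_le[OF le s] assms infsum_add[of "\<lambda>p. \<bar>pcoeff a p\<bar> * wgt p" UNIV "\<lambda>p. \<bar>pcoeff b p\<bar> * wgt p"]
    unfolding bounded_ser_def bnorm_def by auto
qed

lemma bounded_ser_cmult:
  assumes "bounded_ser a"
  shows "bounded_ser (cconst c * a)" "bnorm (cconst c * a) = \<bar>c\<bar> * bnorm a"
proof -
  have e: "(\<lambda>p. \<bar>pcoeff (cconst c * a) p\<bar> * wgt p) = (\<lambda>p. \<bar>c\<bar> * (\<bar>pcoeff a p\<bar> * wgt p))"
    by (auto simp: abs_mult)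
  show "bounded_ser (cconst c * a)" "bnorm (cconst c * a) = \<bar>c\<bar> * bnorm a"
    using assms unfolding bounded_ser_def bnorm_def e
    by (simp_all add: summable_on_cmult_right infsum_cmult_right')
qed

lemma bounded_ser_uminus:
  assumes "bounded_ser a" shows "bounded_ser (- a)"
  using assms unfolding bounded_ser_def by simp

text \<open>Stated for an arbitrary submultiplicative weight, because it is used both for the norm of the
Banach algebra and for the geometric weights that express absolute convergence.\<close>

lemma weighted_sum_mult:
  fixes w :: "nat \<times> nat \<Rightarrow> real"
  assumes nn: "\<And>p. w p \<ge> 0" and sub: "\<And>p q. w (p + q) \<le> w p * w q"
    and a: "(\<lambda>p. \<bar>pcoeff a p\<bar> * w p) summable_on UNIV"
    and b: "(\<lambda>p. \<bar>pcoeff b p\<bar> * w p) summable_on UNIV"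
  shows "(\<lambda>p. \<bar>pcoeff (a * b) p\<bar> * w p) summable_on UNIV"
    "(\<Sum>\<^sub>\<infinity>p. \<bar>pcoeff (a * b) p\<bar> * w p)
       \<le> (\<Sum>\<^sub>\<infinity>p. \<bar>pcoeff a p\<bar> * w p) * (\<Sum>\<^sub>\<infinity>p. \<bar>pcoeff b p\<bar> * w p)"
proof -
  define f where "f a p = \<bar>pcoeff a p\<bar> * w p" for a p
  have nnf: "f c p \<ge> 0" for c p using nn[of p] by (simp add: f_def)
  have "((\<lambda>(p, q). f a p * f b q) has_sum infsum (f a) UNIV * infsum (f b) UNIV) (UNIV \<times> UNIV)"
    using a b nnf by (intro has_sum_product_real has_sum_infsum) (auto simp: f_def[abs_def] nn)
  then have 1: "((\<lambda>n. \<Sum>x\<in>antidiag n. (\<lambda>(p, q). f a p * f b q) x) has_sum infsum (f a) UNIV * infsum (f b) UNIV) UNIV"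
    by (intro has_sum_antidiag) simp
  have le: "f (a * b) n \<le> (\<Sum>x\<in>antidiag n. (\<lambda>(p, q). f a p * f b q) x)" for n
  proof -
    have "\<bar>pcoeff (a * b) n\<bar> * w n \<le> (\<Sum>(p, q)\<in>antidiag n. \<bar>pcoeff a p * pcoeff b q\<bar>) * w n"
      unfolding pcoeff_mult case_prod_unfold using nn[of n] by (intro mult_right_mono sum_abs) auto
    also have "\<dots> = (\<Sum>(p, q)\<in>antidiag n. \<bar>pcoeff a p * pcoeff b q\<bar> * w n)"
      by (simp add: sum_distrib_right case_prod_unfold)
    also have "\<dots> \<le> (\<Sum>x\<in>antidiag n. (\<lambda>(p, q). f a p * f b q) x)"
    proof (rule sum_mono, clarify)
      fix p q :: "nat \<times> nat" assume "(p, q) \<in> antidiag n"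
      then have "w n \<le> w p * w q" using sub[of p q] by (simp add: antidiag_def)
      then have "\<bar>pcoeff a p * pcoeff b q\<bar> * w n \<le> \<bar>pcoeff a p * pcoeff b q\<bar> * (w p * w q)"
        by (intro mult_left_mono) auto
      then show "\<bar>pcoeff a p * pcoeff b q\<bar> * w n \<le> f a p * f b q"
        by (simp add: f_def abs_mult mult_ac)
    qed
    finally show ?thesis by (simp add: f_def)
  qed
  have s: "f (a * b) summable_on UNIV"
    by (rule summable_on_comparison_test[OF has_sum_imp_summable[OF 1]]) (use le nnf in auto)
  then show "(\<lambda>p. \<bar>pcoeff (a * b) p\<bar> * w p) summable_on UNIV" by (simp add: f_def[abs_def])
  have "infsum (f (a * b)) UNIV \<le> infsum (f a) UNIV * infsum (f b) UNIV"
    using infsum_mono[OF s has_sum_imp_summable[OF 1]] le infsumI[OF 1] by simp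
  then show "(\<Sum>\<^sub>\<infinity>p. \<bar>pcoeff (a * b) p\<bar> * w p)
       \<le> (\<Sum>\<^sub>\<infinity>p. \<bar>pcoeff a p\<bar> * w p) * (\<Sum>\<^sub>\<infinity>p. \<bar>pcoeff b p\<bar> * w p)"
    by (simp add: f_def[abs_def])
qed

lemma bounded_ser_mult:
  assumes "bounded_ser a" "bounded_ser b"
  shows "bounded_ser (a * b)" "bnorm (a * b) \<le> bnorm a * bnorm b"
  using weighted_sum_mult[of wgt a b] wgt_submult assms unfolding bounded_ser_def bnorm_def by auto

lemma pcoeff_le_bnorm:
  assumes "bounded_ser a" shows "\<bar>pcoeff a p\<bar> * wgt p \<le> bnorm a"
  using finite_sum_le_infsum[of "\<lambda>p. \<bar>pcoeff a p\<bar> * wgt p" UNIV "{p}"] assms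
  unfolding bounded_ser_def bnorm_def by simp

lemma bnorm_eq_0: assumes "bounded_ser a" shows "bnorm a = 0 \<longleftrightarrow> a = 0"
proof
  assume "bnorm a = 0"
  then have "\<bar>pcoeff a p\<bar> * wgt p \<le> 0" for p using pcoeff_le_bnorm[OF assms, of p] by simp
  then have "pcoeff a p = 0" for p using wgt_pos[of p]
    by (metis abs_ge_zero abs_le_zero_iff mult_le_0_iff not_less zero_less_abs_iff)
  then show "a = 0" by (intro ser2_eqI) simp
qed (simp add: bnorm_def)

typedef bser = "{a. bounded_ser a}" by (rule exI[of _ 0]) (simp add: bounded_ser_0)

setup_lifting type_definition_bser

instantiation bser :: comm_ring_1
begin
lift_definition zero_bser :: bser is 0 by (simp add: bounded_ser_0)
lift_definition one_bser :: bser is 1 by (simp add: bounded_ser_1)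
lift_definition plus_bser :: "bser \<Rightarrow> bser \<Rightarrow> bser" is "(+)" by (simp add: bounded_ser_add)
lift_definition uminus_bser :: "bser \<Rightarrow> bser" is "uminus" by (simp add: bounded_ser_uminus)
lift_definition minus_bser :: "bser \<Rightarrow> bser \<Rightarrow> bser" is "(-)"
  by (metis bounded_ser_add(1) bounded_ser_uminus mem_Collect_eq uminus_add_conv_diff add.commute)
lift_definition times_bser :: "bser \<Rightarrow> bser \<Rightarrow> bser" is "(*)" by (simp add: bounded_ser_mult)
instance by standard (transfer; simp add: algebra_simps)+
end

instantiation bser :: real_normed_algebra_1
begin
lift_definition norm_bser :: "bser \<Rightarrow> real" is bnorm .
lift_definition scaleR_bser :: "real \<Rightarrow> bser \<Rightarrow> bser" is "\<lambda>c a. cconst c * a"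
  by (simp add: bounded_ser_cmult)
definition dist_bser :: "bser \<Rightarrow> bser \<Rightarrow> real" where "dist_bser a b = norm (a - b)"
definition sgn_bser :: "bser \<Rightarrow> bser" where "sgn_bser a = inverse (norm a) *\<^sub>R a"
definition uniformity_bser :: "(bser \<times> bser) filter" where
  "uniformity_bser = (INF e\<in>{0<..}. principal {(x, y). dist x y < e})"
definition open_bser :: "bser set \<Rightarrow> bool" where
  "open_bser U \<longleftrightarrow> (\<forall>x\<in>U. eventually (\<lambda>(x', y). x' = x \<longrightarrow> y \<in> U) uniformity)"
instance
proof
  fix a b c :: bser and x y :: real
  show "x *\<^sub>R (a + b) = x *\<^sub>R a + x *\<^sub>R b" by transfer (simp add: algebra_simps)
  show "(x + y) *\<^sub>R a = x *\<^sub>R a + y *\<^sub>R a" by transfer (simp add: algebra_simps cconst_simps)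
  show "x *\<^sub>R y *\<^sub>R a = (x * y) *\<^sub>R a" by transfer (simp add: algebra_simps cconst_simps)
  show "1 *\<^sub>R a = a" by transfer (simp add: cconst_simps)
  show "x *\<^sub>R a * b = x *\<^sub>R (a * b)" by transfer (simp add: algebra_simps)
  show "a * x *\<^sub>R b = x *\<^sub>R (a * b)" by transfer (simp add: algebra_simps)
  show "norm a = 0 \<longleftrightarrow> a = 0" by transfer (simp add: bnorm_eq_0)
  show "norm (a + b) \<le> norm a + norm b" by transfer (simp add: bounded_ser_add)
  show "norm (x *\<^sub>R a) = \<bar>x\<bar> * norm a" by transfer (simp add: bounded_ser_cmult)
  show "norm (a * b) \<le> norm a * norm b" by transfer (simp add: bounded_ser_mult)
  show "norm (1 :: bser) = 1" by transfer (simp add: bounded_ser_1)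
qed (auto simp: dist_bser_def sgn_bser_def uniformity_bser_def open_bser_def)
end

lemma pcoeff_Rep_le_norm: "\<bar>pcoeff (Rep_bser a) p\<bar> * wgt p \<le> norm a"
  by transfer (simp add: pcoeff_le_bnorm)

lemma sum_le_norm: "finite F \<Longrightarrow> (\<Sum>p\<in>F. \<bar>pcoeff (Rep_bser a) p\<bar> * wgt p) \<le> norm a"
  by transfer (auto simp: bnorm_def bounded_ser_def intro!: finite_sum_le_infsum mult_nonneg_nonneg wgt_pos[THEN less_imp_le])

text \<open>
Completeness.  The limit is formed coefficient by coefficient; finite partial sums of the norm of
the difference pass to the limit, which bounds the norm itself.
\<close>

instance bser :: banach
proof
  fix X :: "nat \<Rightarrow> bser" assume "Cauchy X"
  define c where "c n p = pcoeff (Rep_bser (X n)) p" for n p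
  have dc: "pcoeff (Rep_bser (X m - X n)) p = c m p - c n p" for m n p
    unfolding c_def by (simp add: minus_bser.rep_eq)
  have "Cauchy (\<lambda>n. c n p)" for p
  proof (rule metric_CauchyI)
    fix e :: real assume "e > 0"
    with wgt_pos[of p] have "e * wgt p > 0" by simp
    from metric_CauchyD[OF \<open>Cauchy X\<close> this] obtain M where
      M: "\<And>m n. m \<ge> M \<Longrightarrow> n \<ge> M \<Longrightarrow> dist (X m) (X n) < e * wgt p" by blast
    have "dist (c m p) (c n p) < e" if "m \<ge> M" "n \<ge> M" for m n
    proof -
      have "\<bar>c m p - c n p\<bar> * wgt p < e * wgt p"
        using M[OF that] pcoeff_Rep_le_norm[of "X m - X n" p] by (simp add: dist_norm dc)
      with wgt_pos[of p] show ?thesis by (simp add: dist_real_def)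
    qed
    then show "\<exists>M. \<forall>m\<ge>M. \<forall>n\<ge>M. dist (c m p) (c n p) < e" by blast
  qed
  then have "\<exists>l. (\<lambda>n. c n p) \<longlonglongrightarrow> l" for p
    using Cauchy_convergent convergent_def by blast
  then obtain l where l: "\<And>p. (\<lambda>n. c n p) \<longlonglongrightarrow> l p" by metis
  define L :: ser2 where "L = Abs_fps (\<lambda>j. Abs_fps (\<lambda>i. l (i, j)))"
  have L: "pcoeff L p = l p" for p by (simp add: L_def pcoeff_def)
  have key: "bounded_ser (Rep_bser (X m) - L) \<and> bnorm (Rep_bser (X m) - L) \<le> e"
    if "\<And>n. n \<ge> m \<Longrightarrow> norm (X m - X n) \<le> e" for m e
  proof -
    have fin: "(\<Sum>p\<in>F. \<bar>c m p - l p\<bar> * wgt p) \<le> e" if "finite F" for F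
    proof (rule tendsto_upperbound)
      show "(\<lambda>n. \<Sum>p\<in>F. \<bar>c m p - c n p\<bar> * wgt p) \<longlonglongrightarrow> (\<Sum>p\<in>F. \<bar>c m p - l p\<bar> * wgt p)"
        by (intro tendsto_intros l)
      show "\<forall>\<^sub>F n in sequentially. (\<Sum>p\<in>F. \<bar>c m p - c n p\<bar> * wgt p) \<le> e"
        using eventually_ge_at_top[of m]
      proof eventually_elim
        case (elim n)
        have "(\<Sum>p\<in>F. \<bar>c m p - c n p\<bar> * wgt p) \<le> norm (X m - X n)"
          using sum_le_norm[OF that, of "X m - X n"] by (simp add: dc)
        with \<open>\<And>n. n \<ge> m \<Longrightarrow> norm (X m - X n) \<le> e\<close>[OF elim] show ?case by simp
      qed
    qed simp
    have e: "\<bar>pcoeff (Rep_bser (X m) - L) p\<bar> * wgt p = \<bar>c m p - l p\<bar> * wgt p" for p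
      by (simp add: L c_def)
    have s: "(\<lambda>p. \<bar>c m p - l p\<bar> * wgt p) summable_on UNIV"
      using wgt_pos fin by (intro nonneg_bdd_above_summable_on) (auto intro!: bdd_aboveI[of _ e] simp: less_imp_le)
    then show ?thesis
      unfolding bounded_ser_def bnorm_def e using fin
      by (auto intro: infsum_le_finite_sums)
  qed
  have evt: "\<exists>M. \<forall>m\<ge>M. bounded_ser (Rep_bser (X m) - L) \<and> bnorm (Rep_bser (X m) - L) \<le> e" if "e > 0" for e
  proof -
    from metric_CauchyD[OF \<open>Cauchy X\<close> that] obtain M where
      M: "\<And>m n. m \<ge> M \<Longrightarrow> n \<ge> M \<Longrightarrow> dist (X m) (X n) < e" by blast
    have "bounded_ser (Rep_bser (X m) - L) \<and> bnorm (Rep_bser (X m) - L) \<le> e" if "m \<ge> M" for m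
      by (rule key) (use M[of m] that in \<open>auto simp: dist_norm intro!: less_imp_le\<close>)
    then show ?thesis by blast
  qed
  have "bounded_ser L"
  proof -
    obtain M where "bounded_ser (Rep_bser (X M) - L)" using evt[of 1] by auto
    from bounded_ser_add(1)[OF bounded_ser_uminus[OF this] Rep_bser[of "X M", simplified]]
    show ?thesis by simp
  qed
  have nrm: "norm (X m - Abs_bser L) = bnorm (Rep_bser (X m) - L)" for m
    by (simp add: norm_bser.rep_eq minus_bser.rep_eq Abs_bser_inverse \<open>bounded_ser L\<close>)
  have "X \<longlonglongrightarrow> Abs_bser L"
  proof (rule metric_LIMSEQ_I)
    fix e :: real assume "e > 0"
    then obtain M where "\<forall>m\<ge>M. bnorm (Rep_bser (X m) - L) \<le> e / 2" using evt[of "e / 2"] by auto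
    with \<open>e > 0\<close> show "\<exists>M. \<forall>m\<ge>M. dist (X m) (Abs_bser L) < e"
      unfolding dist_norm nrm by (intro exI[of _ M]) force
  qed
  then show "convergent X" unfolding convergent_def by blast
qed

section \<open>Convergence and evaluation\<close>

text \<open>Absolute convergence at \<open>(\<rho>, \<rho>)\<close>, hence on the closed square of that radius.\<close>

definition cvg :: "real \<Rightarrow> ser2 \<Rightarrow> bool" where
  "cvg \<rho> a \<longleftrightarrow> (\<lambda>p. \<bar>pcoeff a p\<bar> * \<rho> ^ (fst p + snd p)) summable_on UNIV"

definition ev :: "ser2 \<Rightarrow> real \<Rightarrow> real \<Rightarrow> real" where
  "ev a u v = (\<Sum>\<^sub>\<infinity>p. pcoeff a p * (u ^ fst p * v ^ snd p))"

lemma term_le: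
  fixes \<rho> u v :: real
  assumes "\<bar>u\<bar> \<le> \<rho>" "\<bar>v\<bar> \<le> \<rho>"
  shows "\<bar>u ^ i * v ^ j\<bar> \<le> \<rho> ^ (i + j)"
  unfolding abs_mult power_abs power_add using assms by (intro mult_mono power_mono) auto

lemma cvg_cmp:
  assumes "cvg \<rho> a" and "\<And>p. norm (f p) \<le> C * (\<bar>pcoeff a p\<bar> * \<rho> ^ (fst p + snd p))"
  shows "(\<lambda>p. norm (f p)) summable_on UNIV"
  by (rule summable_on_comparison_test[OF summable_on_cmult_right[where c = C]])
     (use assms in \<open>auto simp: cvg_def\<close>)

lemma ev_abs_summable:
  assumes "cvg \<rho> a" "\<bar>u\<bar> \<le> \<rho>" "\<bar>v\<bar> \<le> \<rho>"
  shows "(\<lambda>p. norm (pcoeff a p * (u ^ fst p * v ^ snd p))) summable_on UNIV"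
  by (rule cvg_cmp[OF assms(1), where C = 1])
     (simp add: abs_mult[of "pcoeff a _"] mult_left_mono term_le[OF assms(2,3)])

lemma ev_has_sum:
  assumes "cvg \<rho> a" "\<bar>u\<bar> \<le> \<rho>" "\<bar>v\<bar> \<le> \<rho>"
  shows "((\<lambda>p. pcoeff a p * (u ^ fst p * v ^ snd p)) has_sum ev a u v) UNIV"
  unfolding ev_def by (rule has_sum_infsum[OF abs_summable_summable[OF ev_abs_summable[OF assms]]])

lemma cvg_mono: "cvg \<rho> a \<Longrightarrow> 0 \<le> r \<Longrightarrow> r \<le> \<rho> \<Longrightarrow> cvg r a"
  using cvg_cmp[of \<rho> a "\<lambda>p. pcoeff a p * r ^ (fst p + snd p)" 1]
  by (simp add: cvg_def[of r] abs_mult mult_left_mono power_mono)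

lemma cvg_mult: "0 \<le> \<rho> \<Longrightarrow> cvg \<rho> a \<Longrightarrow> cvg \<rho> b \<Longrightarrow> cvg \<rho> (a * b)"
  unfolding cvg_def by (rule weighted_sum_mult(1)) (auto simp: power_add mult_ac)

lemma cvg_add: assumes "0 \<le> \<rho>" "cvg \<rho> a" "cvg \<rho> b" shows "cvg \<rho> (a + b)"
  unfolding cvg_def
  by (rule summable_on_comparison_test[OF summable_on_add[OF assms(2,3)[unfolded cvg_def]]])
     (use assms(1) in \<open>auto simp flip: distrib_right intro!: mult_right_mono abs_triangle_ineq\<close>)

lemma cvg_cconst: "cvg \<rho> (cconst c)"
  unfolding cvg_def
  by (rule has_sum_imp_summable, rule has_sum_finite_neutralI[where B = "{0}"]) (auto simp: pcoeff_cconst)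

lemma cvg_uminus: "cvg \<rho> a \<Longrightarrow> cvg \<rho> (- a)" by (simp add: cvg_def)

lemma cvg_diff: "0 \<le> \<rho> \<Longrightarrow> cvg \<rho> a \<Longrightarrow> cvg \<rho> b \<Longrightarrow> cvg \<rho> (a - b)"
  using cvg_add[of \<rho> a "- b"] cvg_uminus by simp

lemma ev_cconst [simp]: "ev (cconst c) u v = c"
proof -
  have "((\<lambda>p. pcoeff (cconst c) p * (u ^ fst p * v ^ snd p)) has_sum c) UNIV"
    by (rule has_sum_finite_neutralI[where B = "{0}"]) (auto simp: pcoeff_cconst)
  then show ?thesis unfolding ev_def by (rule infsumI)
qed

lemma ev_0 [simp]: "ev 0 u v = 0" and ev_1 [simp]: "ev 1 u v = 1"
  using ev_cconst[of 0] ev_cconst[of 1] by (simp_all add: cconst_simps)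

lemma ev_uminus: "ev (- a) u v = - ev a u v"
  by (simp add: ev_def infsum_uminus)

lemma ev_cmult: "ev (cconst c * a) u v = c * ev a u v"
  by (simp add: ev_def mult.assoc infsum_cmult_right')

lemma ev_at_0: "ev a 0 0 = pcoeff a 0"
proof -
  have "((\<lambda>p. pcoeff a p * (0 ^ fst p * 0 ^ snd p)) has_sum pcoeff a 0) UNIV"
    by (rule has_sum_finite_neutralI[where B = "{0}"]) (auto simp: power_0_left zero_prod_def)
  then show ?thesis unfolding ev_def by (rule infsumI)
qed

context
  fixes \<rho> u v :: real assumes uv: "\<bar>u\<bar> \<le> \<rho>" "\<bar>v\<bar> \<le> \<rho>"
begin

lemma ev_add: assumes "cvg \<rho> a" "cvg \<rho> b" shows "ev (a + b) u v = ev a u v + ev b u v"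
  using has_sum_add[OF ev_has_sum[OF assms(1) uv] ev_has_sum[OF assms(2) uv]]
  by (auto simp: ev_def[of "a + b"] algebra_simps intro: infsumI)

lemma ev_diff: assumes "cvg \<rho> a" "cvg \<rho> b" shows "ev (a - b) u v = ev a u v - ev b u v"
  using ev_add[OF assms(1) cvg_uminus[OF assms(2)]] by (simp add: ev_uminus)

lemma ev_mult: assumes "cvg \<rho> a" "cvg \<rho> b" shows "ev (a * b) u v = ev a u v * ev b u v"
proof -
  define m where "m p = u ^ fst p * v ^ snd p" for p :: "nat \<times> nat"
  have m: "m (p + q) = m p * m q" for p q by (simp add: m_def power_add)
  have "((\<lambda>(p, q). (pcoeff a p * m p) * (pcoeff b q * m q)) has_sum ev a u v * ev b u v) (UNIV \<times> UNIV)"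
    unfolding m_def
    using assms uv by (intro has_sum_product_real ev_has_sum ev_abs_summable)
  then have "((\<lambda>n. \<Sum>x\<in>antidiag n. (\<lambda>(p, q). (pcoeff a p * m p) * (pcoeff b q * m q)) x)
      has_sum ev a u v * ev b u v) UNIV"
    by (intro has_sum_antidiag) simp
  moreover have "(\<Sum>x\<in>antidiag n. (\<lambda>(p, q). (pcoeff a p * m p) * (pcoeff b q * m q)) x)
      = pcoeff (a * b) n * m n" for n
    unfolding pcoeff_mult sum_distrib_right
  proof (rule sum.cong[OF refl], clarify)
    fix p q assume "(p, q) \<in> antidiag n"
    then have "m n = m p * m q" using m[of p q] by (simp add: antidiag_def)
    then show "pcoeff a p * m p * (pcoeff b q * m q) = pcoeff a p * pcoeff b q * m n" by simp
  qed
  ultimately show ?thesis by (simp add: ev_def[of "a * b"] m_def infsumI)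
qed

end

section \<open>Rescaling the variables\<close>

definition sc :: "real \<Rightarrow> real \<Rightarrow> ser2 \<Rightarrow> ser2" where
  "sc r s a = Abs_fps (\<lambda>j. Abs_fps (\<lambda>i. r ^ i * s ^ j * pcoeff a (i, j)))"

lemma pcoeff_sc: "pcoeff (sc r s a) p = r ^ fst p * s ^ snd p * pcoeff a p"
  by (simp add: sc_def pcoeff_def)

lemma sc_add: "sc r s (a + b) = sc r s a + sc r s b"
  and sc_diff: "sc r s (a - b) = sc r s a - sc r s b"
  and sc_cconst: "sc r s (cconst c) = cconst c"
  and sc_sc: "sc r s (sc r' s' a) = sc (r * r') (s * s') a"
  and sc_1_1: "sc 1 1 a = a"
  by (rule ser2_eqI; simp add: pcoeff_sc algebra_simps pcoeff_cconst)+

lemma sc_mult: "sc r s (a * b) = sc r s a * sc r s b"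
proof (rule ser2_eqI)
  fix n
  show "pcoeff (sc r s (a * b)) n = pcoeff (sc r s a * sc r s b) n"
    unfolding pcoeff_mult pcoeff_sc sum_distrib_left
    by (rule sum.cong) (auto simp: antidiag_def power_add)
qed

lemma sc_inverse: "r \<noteq> 0 \<Longrightarrow> s \<noteq> 0 \<Longrightarrow> sc r s (sc (1 / r) (1 / s) a) = a"
  and sc_inverse': "r \<noteq> 0 \<Longrightarrow> s \<noteq> 0 \<Longrightarrow> sc (1 / r) (1 / s) (sc r s a) = a"
  by (simp_all add: sc_sc sc_1_1)

lemma ev_sc: "ev (sc r s a) u v = ev a (r * u) (s * v)"
  unfolding ev_def by (rule infsum_cong) (simp add: pcoeff_sc power_mult_distrib)

lemma bounded_ser_sc:
  assumes "cvg \<rho> a" "\<bar>r\<bar> \<le> \<rho>" "\<bar>s\<bar> \<le> \<rho>"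
  shows "bounded_ser (sc r s a)" "bnorm (sc r s a) \<le> (\<Sum>\<^sub>\<infinity>p. \<bar>pcoeff a p\<bar> * \<rho> ^ (fst p + snd p))"
proof -
  have "\<bar>pcoeff (sc r s a) p\<bar> * wgt p \<le> \<bar>pcoeff a p\<bar> * \<rho> ^ (fst p + snd p)" for p
  proof -
    have "\<bar>pcoeff (sc r s a) p\<bar> * wgt p \<le> \<bar>pcoeff (sc r s a) p\<bar> * 1"
      by (intro mult_left_mono wgt_le_1) auto
    also have "\<dots> \<le> \<bar>pcoeff a p\<bar> * \<rho> ^ (fst p + snd p)"
      using mult_left_mono[OF term_le[OF assms(2,3), of "fst p" "snd p"], of "\<bar>pcoeff a p\<bar>"]
      by (simp add: pcoeff_sc abs_mult mult_ac)
    finally show ?thesis .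
  qed
  from bounded_ser_le[OF this] assms(1)
  show "bounded_ser (sc r s a)" "bnorm (sc r s a) \<le> (\<Sum>\<^sub>\<infinity>p. \<bar>pcoeff a p\<bar> * \<rho> ^ (fst p + snd p))"
    by (simp_all add: cvg_def)
qed

text \<open>The way back from the Banach algebra: undoing the substitution \<open>u = rU\<close>, \<open>v = sV\<close> turns an element
of finite norm into a series with positive radius of convergence.\<close>

lemma bounded_imp_cvg:
  assumes "bounded_ser a" "0 < t" "t \<le> r" "t \<le> s"
  shows "cvg (t / 2) (sc (1 / r) (1 / s) a)"
  unfolding cvg_def
proof (rule summable_on_comparison_test[OF assms(1)[unfolded bounded_ser_def]])
  fix p :: "nat \<times> nat"
  obtain i j where p: "p = (i, j)" by (cases p)
  have "(1 / r) ^ i * (1 / s) ^ j * (t / 2) ^ (i + j) = (t / r) ^ i * (t / s) ^ j * (1 / 2) ^ (i + j)"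
    by (simp add: power_divide power_add)
  also have "\<dots> \<le> 1 * 1 * (1 / 2) ^ (i + j)"
    using assms by (intro mult_mono power_le_one) auto
  also have "\<dots> \<le> wgt p" using wgt_geometric[of p] by (simp add: p)
  finally have "(1 / r) ^ i * (1 / s) ^ j * (t / 2) ^ (i + j) \<le> wgt p" .
  from mult_left_mono[OF this abs_ge_zero[of "pcoeff a p"]]
  have "\<bar>pcoeff a p\<bar> * ((1 / r) ^ i * (1 / s) ^ j * (t / 2) ^ (i + j)) \<le> \<bar>pcoeff a p\<bar> * wgt p" .
  moreover have "0 \<le> (1 / r) ^ i * (1 / s) ^ j" using assms by simp
  then have "\<bar>pcoeff (sc (1 / r) (1 / s) a) p\<bar> = \<bar>pcoeff a p\<bar> * ((1 / r) ^ i * (1 / s) ^ j)"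
    unfolding pcoeff_sc p fst_conv snd_conv abs_mult[of "(1 / r) ^ i * (1 / s) ^ j"] by simp
  ultimately show "\<bar>pcoeff (sc (1 / r) (1 / s) a) p\<bar> * (t / 2) ^ (fst p + snd p) \<le> \<bar>pcoeff a p\<bar> * wgt p"
    by (simp only: p fst_conv snd_conv mult.assoc)
next
  show "0 \<le> \<bar>pcoeff (sc (1 / r) (1 / s) a) p\<bar> * (t / 2) ^ (fst p + snd p)" for p
    using assms by simp
qed

section \<open>Formal and actual derivatives\<close>

text \<open>Exchanging the variables reduces statements about \<open>v\<close> to statements about \<open>u\<close>.\<close>

definition swp :: "ser2 \<Rightarrow> ser2" where
  "swp a = Abs_fps (\<lambda>j. Abs_fps (\<lambda>i. pcoeff a (j, i)))"

lemma pcoeff_swp [simp]: "pcoeff (swp a) p = pcoeff a (snd p, fst p)"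
  by (simp add: swp_def pcoeff_def)

definition dV :: "ser2 \<Rightarrow> ser2" where "dV a = fps_deriv a"
definition dU :: "ser2 \<Rightarrow> ser2" where "dU a = Abs_fps (\<lambda>j. fps_deriv (fps_nth a j))"

lemma pcoeff_dU: "pcoeff (dU a) p = real (Suc (fst p)) * pcoeff a (Suc (fst p), snd p)"
  by (simp add: dU_def pcoeff_def)

lemma pcoeff_dV: "pcoeff (dV a) p = real (Suc (snd p)) * pcoeff a (fst p, Suc (snd p))"
proof -
  have "fps_nth (of_nat n * f) m = real n * fps_nth f m" for n m and f :: "real fps"
    by (simp add: fps_of_nat[symmetric])
  from this[of "Suc (snd p)"] show ?thesis by (simp add: dV_def pcoeff_def fps_deriv_nth)
qed

lemma dV_swp: "dV a = swp (dU (swp a))"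
  by (rule ser2_eqI) (simp add: pcoeff_dU pcoeff_dV)

lemma dU_simps: "dU (a + b) = dU a + dU b" "dU (a - b) = dU a - dU b" "dU (cconst c) = 0"
  "dU (cconst c * a) = cconst c * dU a" "dU 0 = 0" "dU 1 = 0" "dU (- a) = - dU a"
  by (rule ser2_eqI; simp add: pcoeff_dU pcoeff_cconst pcoeff_1 ring_distribs zero_prod_def mult.left_commute)+

lemma dV_simps: "dV (a + b) = dV a + dV b" "dV (a - b) = dV a - dV b" "dV (cconst c) = 0"
  "dV (cconst c * a) = cconst c * dV a" "dV 0 = 0" "dV 1 = 0" "dV (- a) = - dV a"
  by (rule ser2_eqI; simp add: pcoeff_dV pcoeff_cconst pcoeff_1 ring_distribs zero_prod_def mult.left_commute)+

lemma dV_mult: "dV (a * b) = dV a * b + a * dV b"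
  by (simp add: dV_def)

lemma dU_mult: "dU (a * b) = dU a * b + a * dU b"
proof (rule fps_ext)
  have *: "fps_deriv (sum f A) = (\<Sum>x\<in>A. fps_deriv (f x))" if "finite A" for f :: "nat \<Rightarrow> real fps" and A
    using that by (induction A rule: finite_induct) auto
  show "fps_nth (dU (a * b)) n = fps_nth (dU a * b + a * dU b) n" for n
    by (simp add: dU_def fps_mult_nth * sum.distrib add.commute)
qed

lemma dU_dV: "dU (dV a) = dV (dU a)"
  by (rule ser2_eqI) (simp add: pcoeff_dU pcoeff_dV)

lemma cvg_swp [simp]: "cvg \<rho> (swp a) \<longleftrightarrow> cvg \<rho> a"
proof -
  have "bij_betw prod.swap (UNIV :: (nat \<times> nat) set) UNIV" by (simp add: bij_swap)
  from summable_on_reindex_bij_betw[OF this, of "\<lambda>p. \<bar>pcoeff a p\<bar> * \<rho> ^ (fst p + snd p)"]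
  show ?thesis by (simp add: cvg_def prod.swap_def add.commute)
qed

lemma ev_swp: "ev (swp a) u v = ev a v u"
proof -
  have "bij_betw prod.swap (UNIV :: (nat \<times> nat) set) UNIV" by (simp add: bij_swap)
  from infsum_reindex_bij_betw[OF this, of "\<lambda>p. pcoeff a p * (v ^ fst p * u ^ snd p)"]
  show ?thesis by (simp add: ev_def prod.swap_def mult_ac)
qed

lemma cvg_dU:
  assumes "cvg \<rho> a" "0 < r" "r < \<rho>"
  shows "cvg r (dU a)"
proof -
  have "(\<lambda>n. real n * (r / \<rho>) ^ n) \<longlonglongrightarrow> 0"
    using assms by (intro powser_times_n_limit_0) auto
  then have "Bseq (\<lambda>n. real n * (r / \<rho>) ^ n)" by (intro convergent_imp_Bseq) (auto simp: convergent_def)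
  then obtain C where C: "C > 0" "\<And>n. real n * (r / \<rho>) ^ n \<le> C"
    unfolding Bseq_def by (metis abs_le_D1 real_norm_def)
  have inj: "inj (\<lambda>p :: nat \<times> nat. (Suc (fst p), snd p))" by (auto simp: inj_on_def)
  have "(\<lambda>p. \<bar>pcoeff a p\<bar> * \<rho> ^ (fst p + snd p)) summable_on range (\<lambda>p. (Suc (fst p), snd p))"
    by (rule summable_on_subset[OF assms(1)[unfolded cvg_def]]) auto
  then have "(\<lambda>p. \<bar>pcoeff a (Suc (fst p), snd p)\<bar> * \<rho> ^ (Suc (fst p) + snd p)) summable_on UNIV"
    unfolding summable_on_reindex[OF inj] o_def fst_conv snd_conv .
  then have s: "(\<lambda>p. C / r * (\<bar>pcoeff a (Suc (fst p), snd p)\<bar> * \<rho> ^ (Suc (fst p) + snd p))) summable_on UNIV"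
    by (rule summable_on_cmult_right)
  show ?thesis unfolding cvg_def
  proof (rule summable_on_comparison_test[OF s])
    fix p :: "nat \<times> nat"
    let ?n = "Suc (fst p) + snd p"
    have "real (Suc (fst p)) * r ^ ?n \<le> real ?n * r ^ ?n"
      using assms by (intro mult_right_mono) auto
    also have "\<dots> \<le> C * \<rho> ^ ?n"
      using C(2)[of ?n] assms by (simp add: power_divide divide_le_eq)
    finally have "real (Suc (fst p)) * r ^ (fst p + snd p) \<le> C / r * \<rho> ^ ?n"
      using assms by (simp add: field_simps)
    from mult_left_mono[OF this, of "\<bar>pcoeff a (Suc (fst p), snd p)\<bar>"]
    show "\<bar>pcoeff (dU a) p\<bar> * r ^ (fst p + snd p) \<le> C / r * (\<bar>pcoeff a (Suc (fst p), snd p)\<bar> * \<rho> ^ ?n)"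
      by (simp add: pcoeff_dU abs_mult mult_ac)
  qed (use assms in auto)
qed

lemma cvg_dV: "cvg \<rho> a \<Longrightarrow> 0 < r \<Longrightarrow> r < \<rho> \<Longrightarrow> cvg r (dV a)"
  unfolding dV_swp by (simp add: cvg_dU[of \<rho>])

lemma ev_power_series:
  assumes "cvg \<rho> a" "\<bar>u\<bar> \<le> \<rho>" "\<bar>v\<bar> \<le> \<rho>"
  shows "(\<lambda>i. (\<Sum>\<^sub>\<infinity>j. pcoeff a (i, j) * v ^ j) * u ^ i) sums ev a u v"
proof -
  have hs: "((\<lambda>(i, j). pcoeff a (i, j) * (u ^ i * v ^ j)) has_sum ev a u v) (UNIV \<times> UNIV)"
    using ev_has_sum[OF assms] by (simp add: case_prod_unfold)
  have smm: "(\<lambda>j. pcoeff a (i, j) * (u ^ i * v ^ j)) summable_on UNIV" for i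
    using summable_on_SigmaD1[of "\<lambda>i j. pcoeff a (i, j) * (u ^ i * v ^ j)" UNIV "\<lambda>_. UNIV" i]
      has_sum_imp_summable[OF hs] by simp
  have "((\<lambda>i. \<Sum>\<^sub>\<infinity>j. pcoeff a (i, j) * (u ^ i * v ^ j)) has_sum ev a u v) UNIV"
    by (rule has_sum_Sigma'[OF hs]) (use smm in \<open>auto intro: has_sum_infsum\<close>)
  then have "(\<lambda>i. \<Sum>\<^sub>\<infinity>j. pcoeff a (i, j) * (u ^ i * v ^ j)) sums ev a u v"
    by (rule has_sum_imp_sums)
  moreover have "(\<Sum>\<^sub>\<infinity>j. pcoeff a (i, j) * (u ^ i * v ^ j)) = (\<Sum>\<^sub>\<infinity>j. pcoeff a (i, j) * v ^ j) * u ^ i" for i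
    by (subst infsum_cmult_left'[symmetric]) (simp add: mult_ac)
  ultimately show ?thesis by simp
qed

lemma radius_between:
  fixes u v \<rho> :: real
  assumes "\<bar>u\<bar> < \<rho>" "\<bar>v\<bar> < \<rho>"
  shows "\<exists>r. \<bar>u\<bar> < r \<and> \<bar>v\<bar> < r \<and> r < \<rho> \<and> 0 < r"
proof (intro exI conjI)
  let ?r = "(max \<bar>u\<bar> \<bar>v\<bar> + \<rho>) / 2"
  show "\<bar>u\<bar> < ?r" "\<bar>v\<bar> < ?r" "?r < \<rho>" "0 < ?r"
    using assms abs_ge_zero[of u] by (auto simp: max_def)
qed

text \<open>For fixed \<open>v\<close> the double series is an ordinary power series in \<open>u\<close>, which may be differentiated
termwise.\<close>

lemma ev_deriv_u:
  assumes "cvg \<rho> a" "\<bar>u\<bar> < \<rho>" "\<bar>v\<bar> < \<rho>"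
  shows "((\<lambda>u. ev a u v) has_real_derivative ev (dU a) u v) (at u)"
proof -
  define c where "c i = (\<Sum>\<^sub>\<infinity>j. pcoeff a (i, j) * v ^ j)" for i
  obtain r where r: "\<bar>u\<bar> < r" "\<bar>v\<bar> < r" "r < \<rho>" "0 < r"
    using radius_between[OF assms(2,3)] by blast
  have eq: "ev a x v = (\<Sum>n. c n * x ^ n)" if "\<bar>x\<bar> \<le> r" for x
    using ev_power_series[OF assms(1), of x v] that r unfolding c_def by (simp add: sums_iff)
  have "summable (\<lambda>n. c n * r ^ n)"
    using ev_power_series[OF assms(1), of r v] r unfolding c_def by (simp add: sums_iff)
  then have d: "((\<lambda>x. \<Sum>n. c n * x ^ n) has_real_derivative (\<Sum>n. diffs c n * u ^ n)) (at u)"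
    by (rule termdiffs_strong) (use r in auto)
  have "diffs c n = (\<Sum>\<^sub>\<infinity>j. pcoeff (dU a) (n, j) * v ^ j)" for n
    by (simp add: diffs_def c_def pcoeff_dU mult.assoc infsum_cmult_right' del: of_nat_Suc)
  then have "(\<Sum>n. diffs c n * u ^ n) = ev (dU a) u v"
    using ev_power_series[OF cvg_dU[OF assms(1)], of r u v] r by (simp add: sums_iff)
  moreover have "((\<lambda>x. ev a x v) has_real_derivative (\<Sum>n. diffs c n * u ^ n)) (at u)"
    by (rule DERIV_cong_ev[THEN iffD1, OF refl _ refl d], rule eventually_nhds_in_open[of "{-r<..<r}", THEN eventually_mono])
       (use r eq in auto)
  ultimately show ?thesis by simp
qed

lemma ev_deriv_v:
  assumes "cvg \<rho> a" "\<bar>u\<bar> < \<rho>" "\<bar>v\<bar> < \<rho>"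
  shows "((\<lambda>v. ev a u v) has_real_derivative ev (dV a) u v) (at v)"
  using ev_deriv_u[of \<rho> "swp a" v u] assms by (simp add: dV_swp ev_swp)

definition evp :: "ser2 \<Rightarrow> real \<times> real \<Rightarrow> real" where "evp a x = ev a (fst x) (snd x)"

definition box0 :: "real \<Rightarrow> (real \<times> real) set" where "box0 \<rho> = {-\<rho><..<\<rho>} \<times> {-\<rho><..<\<rho>}"

lemma open_box0 [simp]: "open (box0 \<rho>)" by (simp add: box0_def open_Times)

lemma in_box0: "x \<in> box0 \<rho> \<longleftrightarrow> \<bar>fst x\<bar> < \<rho> \<and> \<bar>snd x\<bar> < \<rho>" by (cases x) (auto simp: box0_def)

lemma continuous_on_evp:
  assumes "cvg \<rho> a" shows "continuous_on (box0 \<rho>) (evp a)"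
proof -
  define t where "t p x = pcoeff a p * (fst x ^ fst p * snd x ^ snd p)" for p and x :: "real \<times> real"
  have le: "norm (t p x) \<le> \<bar>pcoeff a p\<bar> * \<rho> ^ (fst p + snd p)" if x: "x \<in> box0 \<rho>" for p x
  proof -
    have "\<bar>fst x ^ fst p * snd x ^ snd p\<bar> \<le> \<rho> ^ (fst p + snd p)"
      using x unfolding in_box0 by (intro term_le) simp_all
    from mult_left_mono[OF this abs_ge_zero[of "pcoeff a p"]]
    show ?thesis unfolding t_def real_norm_def abs_mult[of "pcoeff a p"] .
  qed
  have ul: "uniform_limit (box0 \<rho>) (\<lambda>X x. \<Sum>p\<in>X. t p x) (\<lambda>x. \<Sum>\<^sub>\<infinity>p. t p x) (finite_subsets_at_top UNIV)"
    by (rule Weierstrass_m_test_general[OF le assms[unfolded cvg_def]])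
  have ct: "continuous_on (box0 \<rho>) (t p)" for p
    unfolding t_def[abs_def]
    by (intro continuous_on_mult continuous_on_power continuous_on_const continuous_on_fst continuous_on_snd continuous_on_id)
  have "\<forall>\<^sub>F X in finite_subsets_at_top UNIV. continuous_on (box0 \<rho>) (\<lambda>x. \<Sum>p\<in>X. t p x)"
    by (rule always_eventually, rule allI, rule continuous_on_sum, rule ct)
  from uniform_limit_theorem[OF this ul finite_subsets_at_top_neq_bot]
  show ?thesis unfolding evp_def[abs_def] ev_def t_def .
qed

text \<open>The partial derivatives are again sums of power series and so are continuous.\<close>

lemma evp_has_derivative:
  assumes "cvg \<rho> a" "x \<in> box0 \<rho>"
  shows "(evp a has_derivative (\<lambda>h. evp (dU a) x * fst h + evp (dV a) x * snd h)) (at x)"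
proof -
  obtain u v where x: "x = (u, v)" by (cases x)
  have "\<bar>u\<bar> < \<rho>" "\<bar>v\<bar> < \<rho>" using assms(2) by (simp_all add: in_box0 x)
  from radius_between[OF this] obtain r where r: "\<bar>u\<bar> < r" "\<bar>v\<bar> < r" "r < \<rho>" "0 < r" by blast
  have uvr: "u \<in> {-r<..<r}" "v \<in> {-r<..<r}"
    unfolding greaterThanLessThan_iff using r by linarith+
  have "((\<lambda>(u, v). ev a u v) has_derivative
      (\<lambda>(tx, ty). ev (dU a) u v * tx + blinfun_scaleR_right (ev (dV a) u v) ty)) (at (u, v) within {-r<..<r} \<times> {-r<..<r})"
  proof (rule has_derivative_partialsI[where fy = "\<lambda>u v. blinfun_scaleR_right (ev (dV a) u v)"])
    show "((\<lambda>u. ev a u v) has_derivative (\<lambda>tx. ev (dU a) u v * tx)) (at u within {-r<..<r})"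
      using ev_deriv_u[OF assms(1) \<open>\<bar>u\<bar> < \<rho>\<close> \<open>\<bar>v\<bar> < \<rho>\<close>]
      by (simp add: has_field_derivative_def has_derivative_at_withinI)
    show "((\<lambda>y. ev a x y) has_derivative blinfun_apply (blinfun_scaleR_right (ev (dV a) x y))) (at y within {-r<..<r})"
      if "x \<in> {-r<..<r}" "y \<in> {-r<..<r}" for x y
    proof -
      have "\<bar>x\<bar> < \<rho>" "\<bar>y\<bar> < \<rho>" using r that unfolding greaterThanLessThan_iff by linarith+
      moreover have "((*\<^sub>R) c :: real \<Rightarrow> real) = (*) c" for c by auto
      ultimately show ?thesis using ev_deriv_v[OF assms(1), of x y]
        by (simp add: has_field_derivative_def has_derivative_at_withinI)
    qed
    have "continuous_on (box0 r) (evp (dV a))"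
      by (rule continuous_on_evp[OF cvg_dV[OF assms(1) r(4,3)]])
    then have "continuous_on (box0 r) (\<lambda>x. blinfun_scaleR_right (evp (dV a) x))"
      by (rule bounded_linear.continuous_on[OF bounded_linear_blinfun_scaleR_right])
    moreover have "(u, v) \<in> box0 r" using uvr by (simp add: box0_def)
    ultimately have "continuous (at (u, v) within box0 r) (\<lambda>x. blinfun_scaleR_right (evp (dV a) x))"
      unfolding continuous_on_eq_continuous_within by blast
    then show "continuous (at (u, v) within {-r<..<r} \<times> {-r<..<r}) (\<lambda>(x, y). blinfun_scaleR_right (ev (dV a) x y))"
      unfolding box0_def evp_def case_prod_unfold .
    show "v \<in> {-r<..<r}" by (fact uvr)
    show "convex {-r<..<r}" by simp
  qed
  moreover have "at (u, v) within {-r<..<r} \<times> {-r<..<r} = at (u, v)"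
    using uvr by (intro at_within_open open_Times) auto
  ultimately show ?thesis
    unfolding x by (simp add: evp_def[abs_def] case_prod_unfold mult.commute)
qed

section \<open>Integration operators\<close>

definition IV :: "ser2 \<Rightarrow> ser2" where
  "IV a = Abs_fps (\<lambda>j. Abs_fps (\<lambda>i. if j = 0 then 0 else pcoeff a (i, j - 1) / real j))"
definition IU :: "ser2 \<Rightarrow> ser2" where
  "IU a = Abs_fps (\<lambda>j. Abs_fps (\<lambda>i. if i = 0 then 0 else pcoeff a (i - 1, j) / real i))"
text \<open>The restriction to the line \<open>v = 0\<close>, a ring homomorphism commuting with \<open>dU\<close>.\<close>

definition res0 :: "ser2 \<Rightarrow> ser2" where "res0 a = fps_const (fps_nth a 0)"

lemma pcoeff_IV: "pcoeff (IV a) p = (if snd p = 0 then 0 else pcoeff a (fst p, snd p - 1) / real (snd p))"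
  and pcoeff_IU: "pcoeff (IU a) p = (if fst p = 0 then 0 else pcoeff a (fst p - 1, snd p) / real (fst p))"
  and pcoeff_res0: "pcoeff (res0 a) p = (if snd p = 0 then pcoeff a p else 0)"
  by (auto simp: IV_def IU_def res0_def pcoeff_def)

lemma dV_IV [simp]: "dV (IV a) = a" by (rule ser2_eqI) (simp add: pcoeff_dV pcoeff_IV del: of_nat_Suc)
lemma dU_IU [simp]: "dU (IU a) = a" by (rule ser2_eqI) (simp add: pcoeff_dU pcoeff_IU del: of_nat_Suc)
lemma dU_IV: "dU (IV a) = IV (dU a)" by (rule ser2_eqI) (simp add: pcoeff_dU pcoeff_IV)
lemma dV_IU: "dV (IU a) = IU (dV a)" by (rule ser2_eqI) (simp add: pcoeff_dV pcoeff_IU)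

lemma IV_add: "IV (a + b) = IV a + IV b"
  and IV_cmult: "IV (cconst c * a) = cconst c * IV a"
  by (rule ser2_eqI; simp add: pcoeff_IV add_divide_distrib)+

lemma res0_simps: "res0 (a + b) = res0 a + res0 b" "res0 (a - b) = res0 a - res0 b"
  "res0 (a * b) = res0 a * res0 b" "res0 (cconst c) = cconst c" "res0 (- a) = - res0 a"
  "res0 (res0 a) = res0 a" "res0 0 = 0" "res0 1 = 1" "res0 (IV a) = 0"
  by (simp_all add: res0_def cconst_def IV_def flip: fps_const_sub) (simp add: fps_eq_iff)

lemma dU_res0: "dU (res0 a) = res0 (dU a)" by (rule ser2_eqI) (simp add: pcoeff_dU pcoeff_res0)
lemma dV_res0 [simp]: "dV (res0 a) = 0" by (rule ser2_eqI) (simp add: pcoeff_dV pcoeff_res0)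
lemma IU_res0: "IU (res0 a) = res0 (IU a)" by (rule ser2_eqI) (simp add: pcoeff_IU pcoeff_res0)

text \<open>The uniqueness statement by which identities are propagated off the initial line.\<close>

lemma dV_eq_0D: assumes "dV a = 0" "res0 a = 0" shows "a = 0"
proof (rule ser2_eqI)
  fix p
  show "pcoeff a p = pcoeff 0 p"
  proof (cases "snd p")
    case 0
    then show ?thesis using pcoeff_res0[of a p] assms(2) by simp
  next
    case (Suc j)
    then show ?thesis using pcoeff_dV[of a "(fst p, j)"] assms(1) by (cases p) simp
  qed
qed

text \<open>A common estimate for operators that move coefficients around, such as integration: it suffices to
compare weighted coefficients one by one along an injection of indices.\<close>

lemma weighted_shift:
  fixes w :: "nat \<times> nat \<Rightarrow> real"
  assumes a: "(\<lambda>p. \<bar>pcoeff a p\<bar> * w p) summable_on UNIV" and inj: "inj_on \<tau> S"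
    and le: "\<And>q. q \<in> S \<Longrightarrow> \<bar>pcoeff b q\<bar> * w q \<le> C * (\<bar>pcoeff a (\<tau> q)\<bar> * w (\<tau> q))"
    and z: "\<And>q. q \<notin> S \<Longrightarrow> pcoeff b q = 0" and w: "\<And>p. w p \<ge> 0" and C: "C \<ge> 0"
  shows "(\<lambda>p. \<bar>pcoeff b p\<bar> * w p) summable_on UNIV"
    and "(\<Sum>\<^sub>\<infinity>p. \<bar>pcoeff b p\<bar> * w p) \<le> C * (\<Sum>\<^sub>\<infinity>p. \<bar>pcoeff a p\<bar> * w p)"
proof -
  define f where "f c p = \<bar>pcoeff c p\<bar> * w p" for c p
  have a': "f a summable_on UNIV" using a by (simp add: f_def[abs_def])
  have s: "f a summable_on \<tau> ` S" by (rule summable_on_subset[OF a']) simp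
  then have s1: "(\<lambda>q. f a (\<tau> q)) summable_on S" unfolding summable_on_reindex[OF inj] o_def .
  then have s2: "(\<lambda>q. C * f a (\<tau> q)) summable_on S" by (rule summable_on_cmult_right)
  have sb: "f b summable_on S"
    by (rule summable_on_comparison_test[OF s2]) (use le w in \<open>auto simp: f_def\<close>)
  have "f b summable_on S \<longleftrightarrow> f b summable_on UNIV"
    by (rule summable_on_cong_neutral) (auto simp: z f_def)
  with sb show "(\<lambda>p. \<bar>pcoeff b p\<bar> * w p) summable_on UNIV" by (simp add: f_def[abs_def])
  have "infsum (f b) UNIV = infsum (f b) S"
    by (rule infsum_cong_neutral) (auto simp: z f_def)
  also have "\<dots> \<le> infsum (\<lambda>q. C * f a (\<tau> q)) S"
    by (rule infsum_mono[OF sb s2]) (use le in \<open>auto simp: f_def\<close>)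
  also have "\<dots> = C * infsum (f a) (\<tau> ` S)"
    unfolding infsum_reindex[OF inj] o_def by (rule infsum_cmult_right')
  also have "\<dots> \<le> C * infsum (f a) UNIV"
    using C w by (intro mult_left_mono infsum_mono_neutral[OF s a']) (auto simp: f_def)
  finally show "(\<Sum>\<^sub>\<infinity>p. \<bar>pcoeff b p\<bar> * w p) \<le> C * (\<Sum>\<^sub>\<infinity>p. \<bar>pcoeff a p\<bar> * w p)"
    by (simp only: f_def[abs_def])
qed

lemma bounded_shift:
  assumes "bounded_ser a" "inj_on \<tau> S"
    and "\<And>q. q \<in> S \<Longrightarrow> \<bar>pcoeff b q\<bar> * wgt q \<le> \<bar>pcoeff a (\<tau> q)\<bar> * wgt (\<tau> q)"
    and "\<And>q. q \<notin> S \<Longrightarrow> pcoeff b q = 0"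
  shows "bounded_ser b" "bnorm b \<le> bnorm a"
  using weighted_shift[of a wgt \<tau> S b 1] assms unfolding bounded_ser_def bnorm_def by simp_all

lemma pair_Suc:
  fixes q :: "nat \<times> nat"
  shows "snd q \<noteq> 0 \<Longrightarrow> \<exists>i j. q = (i, Suc j)" "fst q \<noteq> 0 \<Longrightarrow> \<exists>i j. q = (Suc i, j)"
  by (metis not0_implies_Suc prod.collapse)+

lemma wgt_decr: "wgt (i, Suc j) / real (Suc j) \<le> wgt (i, j)"
proof -
  have "real ((i + j) choose i) \<le> real ((i + Suc j) choose i) * real (Suc j)"
  proof -
    have "(i + j) choose i \<le> (i + Suc j) choose i" by (cases i) simp_all
    also have "\<dots> \<le> ((i + Suc j) choose i) * Suc j" by simp
    finally show ?thesis by (metis of_nat_le_iff of_nat_mult)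
  qed
  moreover have "0 < (i + j) choose i" "0 < (i + Suc j) choose i" by auto
  ultimately show ?thesis
    unfolding wgt_def by (simp add: frac_le del: of_nat_Suc add_Suc_right)
qed

lemma bounded_IV: "bounded_ser a \<Longrightarrow> bounded_ser (IV a)" "bounded_ser a \<Longrightarrow> bnorm (IV a) \<le> bnorm a"
proof -
  assume a: "bounded_ser a"
  have le: "\<bar>pcoeff (IV a) q\<bar> * wgt q \<le> \<bar>pcoeff a (fst q, snd q - 1)\<bar> * wgt (fst q, snd q - 1)"
    if q: "q \<in> {q. snd q \<noteq> 0}" for q
  proof -
    obtain i j where [simp]: "q = (i, Suc j)" using q pair_Suc by fastforce
    show ?thesis
      using mult_left_mono[OF wgt_decr[of i j], of "\<bar>pcoeff a (i, j)\<bar>"] by (simp add: pcoeff_IV)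
  qed
  have inj: "inj_on (\<lambda>q. (fst q, snd q - 1)) {q :: nat \<times> nat. snd q \<noteq> 0}"
    by (auto simp: inj_on_def)
  show "bounded_ser (IV a)" "bnorm (IV a) \<le> bnorm a"
    by (rule bounded_shift[OF a inj le], assumption, simp add: pcoeff_IV)+
qed

lemma wgt_shift: "real (Suc i) * wgt (i, Suc j) = real (Suc j) * wgt (Suc i, j)"
proof -
  have "Suc i * ((i + Suc j) choose Suc i) = ((i + Suc j) choose i) * Suc j"
    using binomial_absorb_comp[of "i + Suc j" i] Suc_times_binomial_eq[of "i + j" i] binomial_absorption[of i "i + j"]
    by (metis Suc_times_binomial_add add_Suc_right add_Suc mult.commute)
  then have "real (Suc i) * real ((Suc i + j) choose Suc i) = real ((i + Suc j) choose i) * real (Suc j)"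
    by (metis add_Suc add_Suc_right of_nat_mult)
  moreover have "real ((Suc i + j) choose Suc i) > 0" "real ((i + Suc j) choose i) > 0"
    by (simp_all del: add_Suc_right add_Suc binomial_Suc_Suc)
  moreover have "A * (1 / y) = B * (1 / x)" if "A * x = y * B" "x > 0" "y > 0" for A B x y :: real
    using that by (simp add: field_simps)
  ultimately show ?thesis unfolding wgt_def fst_conv snd_conv by blast
qed

text \<open>The heart of the Cauchy-Kovalevskaya argument: with the chosen weights, one derivative in \<open>u\<close> is
compensated exactly by one integration in \<open>v\<close>.\<close>

lemma bounded_dU_IV:
  "bounded_ser a \<Longrightarrow> bounded_ser (dU (IV a))" "bounded_ser a \<Longrightarrow> bnorm (dU (IV a)) \<le> bnorm a"
proof -
  assume a: "bounded_ser a"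
  have le: "\<bar>pcoeff (dU (IV a)) q\<bar> * wgt q \<le> \<bar>pcoeff a (Suc (fst q), snd q - 1)\<bar> * wgt (Suc (fst q), snd q - 1)"
    if q: "q \<in> {q. snd q \<noteq> 0}" for q
  proof -
    obtain i j where [simp]: "q = (i, Suc j)" using q pair_Suc by fastforce
    have "\<bar>pcoeff (dU (IV a)) q\<bar> * wgt q
        = \<bar>pcoeff a (Suc i, j)\<bar> / real (Suc j) * (real (Suc i) * wgt (i, Suc j))"
      by (simp add: pcoeff_IV pcoeff_dU abs_mult del: of_nat_Suc)
    also have "\<dots> = \<bar>pcoeff a (Suc i, j)\<bar> * wgt (Suc i, j)" unfolding wgt_shift by (simp del: of_nat_Suc)
    finally show ?thesis by simp
  qed
  have inj: "inj_on (\<lambda>q. (Suc (fst q), snd q - 1)) {q :: nat \<times> nat. snd q \<noteq> 0}"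
    by (auto simp: inj_on_def)
  show "bounded_ser (dU (IV a))" "bnorm (dU (IV a)) \<le> bnorm a"
    by (rule bounded_shift[OF a inj le], assumption, simp add: pcoeff_IV pcoeff_dU)+
qed

lemma cvg_IV: assumes "cvg \<rho> a" "0 \<le> \<rho>" shows "cvg \<rho> (IV a)"
  unfolding cvg_def
proof (rule weighted_shift(1)[OF assms(1)[unfolded cvg_def]])
  show "inj_on (\<lambda>q. (fst q, snd q - 1)) {q :: nat \<times> nat. snd q \<noteq> 0}" by (auto simp: inj_on_def)
  fix q :: "nat \<times> nat" assume q: "q \<in> {q. snd q \<noteq> 0}"
  then obtain i j where [simp]: "q = (i, Suc j)" using pair_Suc by fastforce
  have "x / real (Suc j) \<le> x" if "x \<ge> 0" for x
    using that frac_le[of x x 1 "real (Suc j)"] by simp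
  from this[of "\<bar>pcoeff a (i, j)\<bar> * \<rho> ^ (i + Suc j)"]
  have "\<bar>pcoeff a (i, j)\<bar> * \<rho> ^ (i + Suc j) / real (Suc j) \<le> \<bar>pcoeff a (i, j)\<bar> * \<rho> ^ (i + Suc j)"
    using assms(2) by simp
  then show "\<bar>pcoeff (IV a) q\<bar> * \<rho> ^ (fst q + snd q) \<le>
      \<rho> * (\<bar>pcoeff a (fst q, snd q - 1)\<bar> * \<rho> ^ (fst (fst q, snd q - 1) + snd (fst q, snd q - 1)))"
    by (simp add: pcoeff_IV mult_ac del: of_nat_Suc)
qed (use assms in \<open>auto simp: pcoeff_IV\<close>)

lemma cvg_IU: assumes "cvg \<rho> a" "0 \<le> \<rho>" shows "cvg \<rho> (IU a)"
proof -
  have "IU a = swp (IV (swp a))" by (rule ser2_eqI) (simp add: pcoeff_IU pcoeff_IV)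
  then show ?thesis using cvg_IV[of \<rho> "swp a"] assms by simp
qed

lemma cvg_res0: assumes "cvg \<rho> a" "0 \<le> \<rho>" shows "cvg \<rho> (res0 a)"
  unfolding cvg_def
  by (rule weighted_shift(1)[OF assms(1)[unfolded cvg_def], of "\<lambda>x. x" "{q. snd q = 0}" _ 1])
     (use assms in \<open>auto simp: pcoeff_res0\<close>)

lemma sc_IV: "sc r s (IV a) = cconst s * IV (sc r s a)"
proof (rule ser2_eqI)
  fix p :: "nat \<times> nat"
  show "pcoeff (sc r s (IV a)) p = pcoeff (cconst s * IV (sc r s a)) p"
    by (cases p; cases "snd p") (auto simp: pcoeff_sc pcoeff_IV)
qed

lemma sc_dU: "r \<noteq> 0 \<Longrightarrow> sc r s (dU a) = cconst (1 / r) * dU (sc r s a)"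
  by (rule ser2_eqI) (simp add: pcoeff_sc pcoeff_dU)

section \<open>Series with a positive radius of convergence\<close>

definition conv :: "ser2 \<Rightarrow> bool" where "conv a \<longleftrightarrow> (\<exists>\<rho>>0. cvg \<rho> a)"

lemma conv_common:
  assumes "finite A" "\<And>a. a \<in> A \<Longrightarrow> conv a"
  shows "\<exists>\<rho>>0. \<forall>a\<in>A. cvg \<rho> a"
  using assms
proof (induction A rule: finite_induct)
  case empty
  then show ?case by (intro exI[of _ 1]) simp
next
  case (insert a A)
  then obtain \<rho> where "\<rho> > 0" "\<forall>a\<in>A. cvg \<rho> a" by auto
  moreover have "conv a" using insert by simp
  then obtain \<sigma> where "\<sigma> > 0" "cvg \<sigma> a" by (auto simp: conv_def)
  ultimately show ?case by (intro exI[of _ "min \<rho> \<sigma>"]) (auto intro: cvg_mono)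
qed

lemma conv2: assumes "conv a" "conv b" obtains \<rho> where "\<rho> > 0" "cvg \<rho> a" "cvg \<rho> b"
  using conv_common[of "{a, b}"] assms by auto

lemma conv_add: "conv a \<Longrightarrow> conv b \<Longrightarrow> conv (a + b)"
  and conv_diff: "conv a \<Longrightarrow> conv b \<Longrightarrow> conv (a - b)"
  and conv_mult: "conv a \<Longrightarrow> conv b \<Longrightarrow> conv (a * b)"
  by (metis conv2 conv_def cvg_add cvg_diff cvg_mult less_imp_le)+

lemma conv_cconst: "conv (cconst c)" using cvg_cconst[of 1] unfolding conv_def by (intro exI[of _ 1]) (simp add: cvg_cconst)
lemma conv_1: "conv 1" using conv_cconst[of 1] by (simp add: cconst_simps)
lemma conv_0: "conv 0" using conv_cconst[of 0] by (simp add: cconst_simps)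
lemma conv_IV: "conv a \<Longrightarrow> conv (IV a)" and conv_IU: "conv a \<Longrightarrow> conv (IU a)" and conv_res0: "conv a \<Longrightarrow> conv (res0 a)"
  unfolding conv_def by (meson cvg_IV cvg_IU cvg_res0 less_imp_le)+

lemma conv_dU: "conv a \<Longrightarrow> conv (dU a)" and conv_dV: "conv a \<Longrightarrow> conv (dV a)"
  unfolding conv_def by (meson cvg_dU cvg_dV dense)+

text \<open>A series without constant term has small norm after shrinking the variables.\<close>

lemma bnorm_sc_small:
  assumes "cvg \<rho> a" "pcoeff a 0 = 0" "0 \<le> t" "t \<le> 1" "\<bar>r\<bar> \<le> t * \<rho>" "\<bar>s\<bar> \<le> t * \<rho>" "0 < \<rho>"
  shows "bounded_ser (sc r s a)" "bnorm (sc r s a) \<le> t * (\<Sum>\<^sub>\<infinity>p. \<bar>pcoeff a p\<bar> * \<rho> ^ (fst p + snd p))"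
proof -
  have le: "\<bar>pcoeff (sc r s a) p\<bar> * wgt p \<le> t * (\<bar>pcoeff a p\<bar> * \<rho> ^ (fst p + snd p))" for p
  proof (cases "p = 0")
    case False
    then have n: "fst p + snd p \<ge> 1" by (cases p) (auto simp: zero_prod_def)
    have "\<bar>pcoeff (sc r s a) p\<bar> * wgt p \<le> \<bar>pcoeff (sc r s a) p\<bar> * 1"
      by (intro mult_left_mono wgt_le_1) auto
    also have "\<dots> \<le> \<bar>pcoeff a p\<bar> * (t * \<rho>) ^ (fst p + snd p)"
      using mult_left_mono[OF term_le[OF assms(5,6), of "fst p" "snd p"], of "\<bar>pcoeff a p\<bar>"]
      by (simp add: pcoeff_sc abs_mult mult_ac)
    also have "\<dots> \<le> \<bar>pcoeff a p\<bar> * (t * \<rho> ^ (fst p + snd p))"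
      unfolding power_mult_distrib
      using assms power_decreasing[OF n, of t] by (intro mult_left_mono mult_right_mono) auto
    finally show ?thesis by (simp add: mult_ac)
  qed (use assms in \<open>simp add: pcoeff_sc\<close>)
  have "(\<lambda>p. t * (\<bar>pcoeff a p\<bar> * \<rho> ^ (fst p + snd p))) summable_on UNIV"
    using assms(1) unfolding cvg_def by (rule summable_on_cmult_right)
  from bounded_ser_le[OF le this]
  show "bounded_ser (sc r s a)" "bnorm (sc r s a) \<le> t * (\<Sum>\<^sub>\<infinity>p. \<bar>pcoeff a p\<bar> * \<rho> ^ (fst p + snd p))"
    by (simp_all add: infsum_cmult_right')
qed

section \<open>Quadratic equations in a Banach space\<close>

text \<open>The form of equation to which both the square root and the Cauchy problem are brought.  The bound
\<open>\<delta>\<close> is uniform in the data, which matters because the data \<open>k, y, z\<close> and the operators depend on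
the scale that is chosen only after \<open>\<delta>\<close>.  On a ball of radius \<open>K + 1\<close> the right-hand side is a
contraction.\<close>

lemma quadratic_fixed_point:
  fixes b :: "'y::real_normed_vector \<Rightarrow> 'z::real_normed_vector \<Rightarrow> 'x::banach"
  assumes "bounded_bilinear b" and K: "K > 0"
  shows "\<exists>\<delta>>0. \<forall>k y z A C. norm k \<le> K \<longrightarrow> norm y \<le> \<delta> \<longrightarrow> norm z \<le> K \<longrightarrow> linear A \<longrightarrow> linear C \<longrightarrow>
    (\<forall>x. norm (A x) \<le> \<delta> * norm x) \<longrightarrow> (\<forall>x. norm (C x) \<le> K * norm x) \<longrightarrow>
    (\<exists>x. x = k + b (y + A x) (z + C x))"
proof -
  interpret bounded_bilinear b by fact
  obtain M where M: "M > 0" "\<And>x y. norm (b x y) \<le> norm x * norm y * M"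
    using pos_bounded by blast
  define R where "R = K + 1"
  have R: "R > 1" using K by (simp add: R_def)
  \<comment> \<open>with this value the bilinear term has norm at most 1/4 and Lipschitz constant 1/2 on the ball\<close>
  define \<delta> where "\<delta> = 1 / (4 * M * K * (1 + R)\<^sup>2)"
  have \<delta>: "\<delta> > 0" using M K R by (simp add: \<delta>_def)
  have \<delta>2: "M * \<delta> * K * (1 + R)\<^sup>2 = 1 / 4" using M K R by (simp add: \<delta>_def)
  have "M * \<delta> * K * (1 + R) \<le> M * \<delta> * K * (1 + R)\<^sup>2"
    using M K R \<delta> by (intro mult_left_mono) (auto simp: power2_eq_square)
  then have \<delta>1: "M * \<delta> * K * (1 + R) \<le> 1 / 4" using \<delta>2 by simp
  have "\<exists>x. x = k + b (y + A x) (z + C x)"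
    if h: "norm k \<le> K" "norm y \<le> \<delta>" "norm z \<le> K" "linear A" "linear C"
      "\<forall>x. norm (A x) \<le> \<delta> * norm x" "\<forall>x. norm (C x) \<le> K * norm x" for k y z A C
  proof -
    interpret A: linear A by fact
    interpret C: linear C by fact
    define \<Psi> where "\<Psi> x = k + b (y + A x) (z + C x)" for x
    have yA: "norm (y + A x) \<le> \<delta> * (1 + R)" if "norm x \<le> R" for x
    proof -
      have "norm (y + A x) \<le> \<delta> + \<delta> * norm x" using h by (meson add_mono norm_triangle_le)
      also have "\<dots> \<le> \<delta> * (1 + R)" using mult_left_mono[OF that, of \<delta>] \<delta> by (simp add: algebra_simps)
      finally show ?thesis .
    qed
    have zC: "norm (z + C x) \<le> K * (1 + R)" if "norm x \<le> R" for x
    proof -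
      have "norm (z + C x) \<le> K + K * norm x" using h by (meson add_mono norm_triangle_le)
      also have "\<dots> \<le> K * (1 + R)" using mult_left_mono[OF that, of K] K by (simp add: algebra_simps)
      finally show ?thesis .
    qed
    have self: "norm (\<Psi> x) \<le> R" if x: "norm x \<le> R" for x
    proof -
      have "norm (b (y + A x) (z + C x)) \<le> (\<delta> * (1 + R)) * (K * (1 + R)) * M"
        using M(2)[of "y + A x" "z + C x"] mult_mono[OF yA[OF x] zC[OF x]] \<delta> R K M(1)
        by (smt (verit, best) mult_right_mono norm_ge_zero mult_nonneg_nonneg)
      also have "\<dots> = 1 / 4" using \<delta>2 by (simp add: power2_eq_square mult_ac)
      finally show ?thesis using h(1) norm_triangle_ineq[of k "b (y + A x) (z + C x)"] by (simp add: \<Psi>_def R_def)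
    qed
    have lip: "dist (\<Psi> x) (\<Psi> x') \<le> 1 / 2 * dist x x'" if x: "norm x \<le> R" "norm x' \<le> R" for x x'
    proof -
      have "\<Psi> x - \<Psi> x' = b (A (x - x')) (z + C x) + b (y + A x') (C (x - x'))"
        unfolding \<Psi>_def A.diff C.diff by (simp add: diff_left diff_right add_left add_right)
      also have "norm \<dots> \<le> norm (A (x - x')) * norm (z + C x) * M + norm (y + A x') * norm (C (x - x')) * M"
        by (meson M(2) add_mono norm_triangle_le)
      also have "\<dots> \<le> (\<delta> * norm (x - x')) * (K * (1 + R)) * M + (\<delta> * (1 + R)) * (K * norm (x - x')) * M"
        using h yA zC x \<delta> K M R by (intro add_mono mult_mono) (auto intro!: mult_nonneg_nonneg)
      also have "\<dots> = 2 * (M * \<delta> * K * (1 + R)) * norm (x - x')" by (simp add: algebra_simps)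
      also have "\<dots> \<le> 2 * (1 / 4) * norm (x - x')" using \<delta>1 by (intro mult_right_mono) auto
      finally show ?thesis by (simp add: dist_norm)
    qed
    have "\<exists>!x. x \<in> cball 0 R \<and> \<Psi> x = x"
      by (rule Banach_fix[where c = "1 / 2"]) (use self lip R in \<open>auto intro: compact_imp_complete closed_cball simp: complete_eq_closed\<close>)
    then show ?thesis unfolding \<Psi>_def by metis
  qed
  with \<delta> show ?thesis by blast
qed

section \<open>Evaluation and substitution in the Banach algebra\<close>

definition evb :: "real \<Rightarrow> real \<Rightarrow> bser \<Rightarrow> real" where "evb u v a = ev (Rep_bser a) u v"

lemma bounded_Rep [simp]: "bounded_ser (Rep_bser a)" using Rep_bser by simp

lemma cvg_half: assumes "bounded_ser a" shows "cvg (1 / 2) a"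
  using bounded_imp_cvg[OF assms, of 1 1 1] by (simp add: sc_1_1)

context
  fixes u v :: real assumes uv: "\<bar>u\<bar> \<le> 1 / 2" "\<bar>v\<bar> \<le> 1 / 2"
begin

lemma evb_le: "\<bar>evb u v a\<bar> \<le> norm a"
proof -
  note hs = ev_has_sum[OF cvg_half[OF bounded_Rep] uv, of a]
  have le: "norm (pcoeff (Rep_bser a) p * (u ^ fst p * v ^ snd p)) \<le> \<bar>pcoeff (Rep_bser a) p\<bar> * wgt p" for p
  proof -
    have "\<bar>u ^ fst p * v ^ snd p\<bar> \<le> wgt p"
      using term_le[OF uv, of "fst p" "snd p"] wgt_geometric[of p] by linarith
    from mult_left_mono[OF this, of "\<bar>pcoeff (Rep_bser a) p\<bar>"] show ?thesis by (simp add: abs_mult)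
  qed
  have s: "(\<lambda>p. \<bar>pcoeff (Rep_bser a) p\<bar> * wgt p) summable_on UNIV"
    using bounded_Rep[of a] unfolding bounded_ser_def .
  have "norm (ev (Rep_bser a) u v) \<le> (\<Sum>\<^sub>\<infinity>p. \<bar>pcoeff (Rep_bser a) p\<bar> * wgt p)"
    unfolding ev_def by (rule norm_infsum_le[OF has_sum_infsum[OF has_sum_imp_summable[OF hs]] has_sum_infsum[OF s]]) (use le in auto)
  then show ?thesis by (simp add: evb_def norm_bser.rep_eq bnorm_def)
qed

lemma evb_add: "evb u v (a + b) = evb u v a + evb u v b"
  and evb_mult: "evb u v (a * b) = evb u v a * evb u v b"
  unfolding evb_def plus_bser.rep_eq times_bser.rep_eq
  by (rule ev_add[OF uv] ev_mult[OF uv]; simp add: cvg_half)+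

lemma evb_scaleR: "evb u v (c *\<^sub>R a) = c * evb u v a"
  by (simp add: evb_def scaleR_bser.rep_eq ev_cmult)

lemma evb_power: "evb u v (a ^ n) = evb u v a ^ n"
  by (induction n) (simp_all add: evb_mult, simp add: evb_def one_bser.rep_eq)

lemma bounded_linear_evb: "bounded_linear (evb u v)"
  by (rule bounded_linear_intro[where K = 1]) (use evb_le in \<open>auto simp: evb_add evb_scaleR\<close>)

end

text \<open>Substitution of two elements of the Banach algebra for the variables of a convergent series.
Evaluation is a continuous ring homomorphism, so the result represents the composite function.\<close>

definition subst_ser :: "ser2 \<Rightarrow> bser \<Rightarrow> bser \<Rightarrow> bser" where
  "subst_ser b S T = (\<Sum>\<^sub>\<infinity>p. pcoeff b p *\<^sub>R (S ^ fst p * T ^ snd p))"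

lemma evb_subst_ser:
  assumes b: "cvg \<rho> b" and S: "norm S \<le> \<rho>" and T: "norm T \<le> \<rho>" and uv: "\<bar>u\<bar> \<le> 1 / 2" "\<bar>v\<bar> \<le> 1 / 2"
  shows "evb u v (subst_ser b S T) = ev b (evb u v S) (evb u v T)"
proof -
  have "(\<lambda>p. norm (pcoeff b p *\<^sub>R (S ^ fst p * T ^ snd p))) summable_on UNIV"
  proof (rule cvg_cmp[OF b, where C = 1])
    fix p :: "nat \<times> nat"
    have "norm (S ^ fst p * T ^ snd p) \<le> norm (S ^ fst p) * norm (T ^ snd p)" by (rule norm_mult_ineq)
    also have "\<dots> \<le> norm S ^ fst p * norm T ^ snd p" by (intro mult_mono norm_power_ineq) auto
    also have "\<dots> \<le> \<rho> ^ fst p * \<rho> ^ snd p"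
      using S T order_trans[OF norm_ge_zero S] by (intro mult_mono power_mono) auto
    finally show "norm (pcoeff b p *\<^sub>R (S ^ fst p * T ^ snd p)) \<le> 1 * (\<bar>pcoeff b p\<bar> * \<rho> ^ (fst p + snd p))"
      by (simp add: power_add mult_left_mono)
  qed
  from has_sum_infsum[OF abs_summable_summable[OF this]]
  have "((\<lambda>p. evb u v (pcoeff b p *\<^sub>R (S ^ fst p * T ^ snd p))) has_sum evb u v (subst_ser b S T)) UNIV"
    unfolding subst_ser_def by (rule has_sum_bounded_linear[OF bounded_linear_evb[OF uv]])
  then have "((\<lambda>p. pcoeff b p * (evb u v S ^ fst p * evb u v T ^ snd p)) has_sum evb u v (subst_ser b S T)) UNIV"
    by (simp add: evb_scaleR[OF uv] evb_mult[OF uv] evb_power[OF uv])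
  then show ?thesis unfolding ev_def by (rule infsumI[symmetric])
qed

section \<open>The equations of an isometric embedding\<close>

definition cmap :: "('a \<Rightarrow> 'b) \<Rightarrow> 'a ^ 3 \<Rightarrow> 'b ^ 3" where "cmap f x = (\<chi> i. f (x $ i))"

lemma cmap_nth [simp]: "cmap f x $ i = f (x $ i)" by (simp add: cmap_def)

text \<open>The Lorentzian scalar product in coordinates in which it reads \<open>x\<^sub>1\<^sup>2 + x\<^sub>2x\<^sub>3\<close>; the parameter stands for
one half, so that the definition makes sense in each of the rings of power series.  With these
coordinates the initial data become polynomial in a single square root.\<close>

definition iso :: "'a::comm_ring_1 \<Rightarrow> 'a ^ 3 \<Rightarrow> 'a ^ 3 \<Rightarrow> 'a" where
  "iso h x y = x $ 1 * y $ 1 + h * (x $ 2 * y $ 3 + x $ 3 * y $ 2)"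

abbreviation half :: ser2 where "half \<equiv> cconst (1 / 2)"

lemma half_half: "half + half = 1"
  by (simp flip: cconst_simps)

lemma half_mult: "half * a + half * a = a"
  by (metis half_half distrib_right mult_1)

lemma iso_commute: "iso h x y = iso h y x" by (simp add: iso_def algebra_simps)
lemma iso_add: "iso h (x + y) z = iso h x z + iso h y z" "iso h z (x + y) = iso h z x + iso h z y"
  by (simp_all add: iso_def algebra_simps)

lemma dU_iso: "dU (iso half x y) = iso half (cmap dU x) y + iso half x (cmap dU y)"
  by (simp add: iso_def dU_simps dU_mult algebra_simps)
lemma dV_iso: "dV (iso half x y) = iso half (cmap dV x) y + iso half x (cmap dV y)"
  by (simp add: iso_def dV_simps dV_mult algebra_simps)
lemma res0_iso: "res0 (iso half x y) = iso half (cmap res0 x) (cmap res0 y)"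
  by (simp add: iso_def res0_simps)
lemma cmap_dU_dV: "cmap dV (cmap dU x) = cmap dU (cmap dV x)"
  by (simp add: vec_eq_iff dU_dV)

text \<open>Compatibility of the Cauchy problem with the metric equations.  The second equation makes
\<open>f\<^sub>v\<cdot>f\<^sub>v - G\<close> independent of \<open>v\<close>, hence zero; using this, the first one does the same for \<open>f\<^sub>u\<cdot>f\<^sub>v - F\<close>.
The third one, with the \<open>u\<close>-derivative of the first, kills the second \<open>v\<close>-derivative of
\<open>f\<^sub>u\<cdot>f\<^sub>u - E\<close>; its first \<open>v\<close>-derivative vanishes for \<open>v = 0\<close> by the last hypothesis.\<close>

lemma formal_isometry:
  fixes f :: "ser2 ^ 3" and E F G :: ser2
  defines "P \<equiv> cmap dU f" and "Q \<equiv> cmap dV f"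
  defines "W \<equiv> cmap dV Q"
  assumes 1: "iso half P W = dV F - half * dU G"
    and 2: "iso half Q W = half * dV G"
    and 3: "iso half (cmap dU P) W =
        dU (dV F) - half * dV (dV E) - half * dU (dU G) + iso half (cmap dU Q) (cmap dU Q)"
    and i1: "res0 (iso half P P) = res0 E" and i2: "res0 (iso half P Q) = res0 F"
    and i3: "res0 (iso half Q Q) = res0 G"
    and i4: "res0 (iso half (cmap dU P) Q) = res0 (dU F - half * dV E)"
  shows "iso half P P = E" "iso half P Q = F" "iso half Q Q = G"
proof -
  have PQ: "cmap dV P = cmap dU Q" unfolding P_def Q_def by (rule cmap_dU_dV)
  have zero: "a = b" if "dV a = dV b" "res0 a = res0 b" for a b
    using dV_eq_0D[of "a - b"] that by (simp add: dV_simps res0_simps)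
  have "dV (iso half Q Q) = dV G"
    using 2 half_mult[of "dV G"] unfolding dV_iso W_def[symmetric] by (simp add: iso_commute)
  then show QQ: "iso half Q Q = G" using i3 by (rule zero)
  then have "dU G = iso half (cmap dU Q) Q + iso half (cmap dU Q) Q"
    using dU_iso[of Q Q] by (simp add: iso_commute)
  then have QuQ: "iso half (cmap dU Q) Q = half * dU G"
    by (metis half_mult distrib_left)
  have "dV (iso half P Q) = dV F"
    unfolding dV_iso PQ W_def[symmetric] QuQ 1 by simp
  then show PQF: "iso half P Q = F" using i2 by (rule zero)
  have e1: "iso half (cmap dU Q) P = dU F - iso half (cmap dU P) Q"
    using dU_iso[of P Q] unfolding PQF by (simp add: iso_commute algebra_simps)
  have dP: "dV (iso half P P) = iso half (cmap dU Q) P + iso half (cmap dU Q) P"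
    unfolding dV_iso PQ by (simp add: iso_commute)
  have "dV (iso half (cmap dU Q) P) = half * dV (dV E)"
  proof -
    have "cmap dV (cmap dU Q) = cmap dU W" unfolding W_def by (rule cmap_dU_dV)
    then have A: "dV (iso half (cmap dU Q) P) = iso half (cmap dU W) P + iso half (cmap dU Q) (cmap dU Q)"
      by (simp add: dV_iso PQ)
    have B: "iso half (cmap dU P) W + iso half (cmap dU W) P = dU (dV F) - half * dU (dU G)"
      using arg_cong[OF 1, of dU] unfolding iso_commute[of half "cmap dU W" P] by (simp only: dU_iso dU_simps)
    have lin: "y = e" if "y = x + t" "b + x = a - g" "b = a - e - g + t" for a b e g t x y :: ser2
    proof -
      have "x = a - g - b" using that(2) by (simp only: eq_diff_eq add.commute)
      then show ?thesis using that(1,3) by simp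
    qed
    show ?thesis by (rule lin[OF A B 3])
  qed
  moreover have "res0 (iso half (cmap dU Q) P) = res0 (half * dV E)"
    unfolding e1 using i4 by (simp add: res0_simps)
  ultimately have "iso half (cmap dU Q) P = half * dV E"
    using zero[of "iso half (cmap dU Q) P" "half * dV E"] by (simp add: dV_simps)
  then have "dV (iso half P P) = dV E" unfolding dP by (simp add: half_mult)
  then show "iso half P P = E" using i1 by (rule zero)
qed

section \<open>Square roots of power series\<close>

lemma bounded_bilinear_add_fun:
  assumes "bounded_bilinear f" "bounded_bilinear g"
  shows "bounded_bilinear (\<lambda>x y. f x y + g x y)"
proof -
  interpret f: bounded_bilinear f by fact
  interpret g: bounded_bilinear g by fact
  obtain K L where K: "\<And>x y. norm (f x y) \<le> norm x * norm y * K" and L: "\<And>x y. norm (g x y) \<le> norm x * norm y * L"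
    using f.bounded g.bounded by blast
  show ?thesis
  proof
    show "\<exists>K. \<forall>a b. norm (f a b + g a b) \<le> norm a * norm b * K"
      by (rule exI[of _ "K + L"]) (auto simp: distrib_left intro!: norm_triangle_mono K L)
  qed (simp_all add: f.add_left f.add_right g.add_left g.add_right f.scaleR_left f.scaleR_right
      g.scaleR_left g.scaleR_right scaleR_add_right)
qed

lemma bounded_bilinear_linear_compose:
  assumes "bounded_linear h" "bounded_bilinear f"
  shows "bounded_bilinear (\<lambda>x y. h (f x y))"
proof -
  interpret h: bounded_linear h by fact
  interpret f: bounded_bilinear f by fact
  obtain K where K: "\<And>x y. norm (f x y) \<le> norm x * norm y * K" using f.bounded by blast
  obtain L where L: "L \<ge> 0" "\<And>x. norm (h x) \<le> norm x * L" using h.nonneg_bounded by blast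
  show ?thesis
  proof
    have "norm (h (f a b)) \<le> norm a * norm b * (K * L)" for a b
      using L(2)[of "f a b"] mult_right_mono[OF K L(1)] by (metis mult.assoc order_trans)
    then show "\<exists>K. \<forall>a b. norm (h (f a b)) \<le> norm a * norm b * K" by blast
  qed (simp_all add: f.add_left f.add_right f.scaleR_left f.scaleR_right h.add h.scaleR)
qed

text \<open>Passage between series in \<open>u, v\<close> and elements of the Banach algebra in the variables
\<open>U = u/r\<close>, \<open>V = v/s\<close>.\<close>

definition unsc :: "real \<Rightarrow> real \<Rightarrow> bser \<Rightarrow> ser2" where "unsc r s a = sc (1 / r) (1 / s) (Rep_bser a)"
definition bsc :: "real \<Rightarrow> real \<Rightarrow> ser2 \<Rightarrow> bser" where "bsc r s a = Abs_bser (sc r s a)"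

lemma conv_unsc: "0 < r \<Longrightarrow> 0 < s \<Longrightarrow> conv (unsc r s a)"
  unfolding conv_def unsc_def
  by (rule exI[of _ "min r s / 2"], intro conjI bounded_imp_cvg bounded_Rep) simp_all

lemma sc_unsc: "r \<noteq> 0 \<Longrightarrow> s \<noteq> 0 \<Longrightarrow> sc r s (unsc r s a) = Rep_bser a"
  by (simp add: unsc_def sc_inverse)

lemma Rep_bsc: "bounded_ser (sc r s a) \<Longrightarrow> Rep_bser (bsc r s a) = sc r s a"
  by (simp add: bsc_def Abs_bser_inverse)

lemma norm_bsc: "bounded_ser (sc r s a) \<Longrightarrow> norm (bsc r s a) = bnorm (sc r s a)"
  by (simp add: norm_bser.rep_eq Rep_bsc)

lemma sc_inj: assumes "r \<noteq> 0" "s \<noteq> 0" "sc r s a = sc r s b" shows "a = b"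
  using sc_inverse'[OF assms(1,2)] assms(3) by metis

lemma pcoeff_mult_0: "pcoeff (a * b) 0 = pcoeff a 0 * pcoeff b 0"
  by (simp add: pcoeff_def zero_prod_def)

text \<open>Square root and quotient are found simultaneously.  With \<open>m = 1 + \<delta>w\<close> and \<open>M = 1 + h\<close> the two
equations read \<open>w = h/(2\<delta>) - \<delta>w\<^sup>2/2\<close> and \<open>p = a - \<delta>wp\<close>, a quadratic system whose first factor is small.\<close>

lemma sqrt_division:
  assumes M: "conv M" "pcoeff M 0 = 1" and a: "conv a"
  shows "\<exists>m p. conv m \<and> conv p \<and> m * m = M \<and> m * p = a \<and> pcoeff m 0 = 1"
proof -
  define h where "h = M - 1"
  have h: "conv h" "pcoeff h 0 = 0" using M conv_diff conv_1 by (auto simp: h_def pcoeff_1)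
  obtain \<rho> where \<rho>: "\<rho> > 0" "cvg \<rho> h" "cvg \<rho> a" using conv2[OF h(1) a] .
  define N where "N c = (\<Sum>\<^sub>\<infinity>p. \<bar>pcoeff c p\<bar> * \<rho> ^ (fst p + snd p))" for c
  have N0: "N c \<ge> 0" for c unfolding N_def using \<rho> by (intro infsum_nonneg) auto
  define K where "K = N a + 1"
  have K: "K \<ge> 1" using N0 by (simp add: K_def)
  define b :: "bser \<Rightarrow> bser \<times> bser \<Rightarrow> bser \<times> bser" where
    "b y z = ((- (1 / 2)) *\<^sub>R (y * fst z), 0) + (0, (- 1) *\<^sub>R (y * snd z))" for y z
  have b: "bounded_bilinear b" unfolding b_def[abs_def]
    by (intro bounded_bilinear_add_fun
          bounded_bilinear_linear_compose[of "\<lambda>x. ((- (1 / 2)) *\<^sub>R x, 0)"]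
          bounded_bilinear_linear_compose[of "\<lambda>x. (0, (- 1) *\<^sub>R x)"]
          bounded_bilinear.comp[OF bounded_bilinear_mult bounded_linear_ident]
          bounded_linear_Pair bounded_linear_zero bounded_linear_scaleR_right bounded_linear_fst bounded_linear_snd)
  have "K > 0" using K by simp
  from quadratic_fixed_point[OF b this] obtain \<delta> where \<delta>: "\<delta> > 0"
    and fixed_point: "\<forall>k y z A C. norm k \<le> K \<longrightarrow> norm y \<le> \<delta> \<longrightarrow> norm z \<le> K \<longrightarrow> linear A \<longrightarrow> linear C \<longrightarrow>
      (\<forall>x. norm (A x) \<le> \<delta> * norm x) \<longrightarrow> (\<forall>x. norm (C x) \<le> K * norm x) \<longrightarrow>
      (\<exists>x. x = k + b (y + A x) (z + C x))"
    by (elim exE conjE)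
  define t where "t = min 1 (2 * \<delta> / (N h + 1))"
  have t: "0 < t" "t \<le> 1" using \<delta> N0[of h] by (auto simp: t_def)
  have "t * N h \<le> 2 * \<delta> / (N h + 1) * N h" using N0[of h] by (intro mult_right_mono) (auto simp: t_def)
  also have "\<dots> \<le> 2 * \<delta>" using N0[of h] \<delta> by (simp add: divide_le_eq)
  finally have tN: "t * N h \<le> 2 * \<delta>" .
  define r where "r = t * \<rho>"
  have r: "0 < r" "r \<le> \<rho>" using t \<rho> by (auto simp: r_def mult_left_le_one_le)
  have bh: "bounded_ser (sc r r h)" "bnorm (sc r r h) \<le> t * N h"
    using bnorm_sc_small[OF \<rho>(2) h(2), of t r r] t \<rho> r unfolding N_def by (auto simp: r_def)
  have ba: "bounded_ser (sc r r a)" "bnorm (sc r r a) \<le> N a"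
    using bounded_ser_sc[OF \<rho>(3), of r r] r unfolding N_def by auto
  define h' where "h' = bsc r r h"
  define a' where "a' = bsc r r a"
  have "norm ((1 / (2 * \<delta>)) *\<^sub>R h') \<le> 1"
    using bh tN \<delta> by (simp add: h'_def norm_bsc divide_le_eq)
  moreover have "norm a' \<le> N a" using ba by (simp add: a'_def norm_bsc)
  ultimately have "norm ((1 / (2 * \<delta>)) *\<^sub>R h', a') \<le> K"
    using norm_Pair_le[of "(1 / (2 * \<delta>)) *\<^sub>R h'" a'] by (simp add: K_def)
  moreover have "linear (\<lambda>x::bser \<times> bser. \<delta> *\<^sub>R fst x)"
    by (intro bounded_linear.linear[OF bounded_linear_compose[OF bounded_linear_scaleR_right bounded_linear_fst]])
  moreover have "\<forall>x::bser \<times> bser. norm (\<delta> *\<^sub>R fst x) \<le> \<delta> * norm x"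
    using \<delta> norm_fst_le by (auto intro!: mult_left_mono)
  moreover have "\<forall>x::bser \<times> bser. norm x \<le> K * norm x" using K by (simp add: mult_le_cancel_right1)
  ultimately have "\<exists>x. x = ((1 / (2 * \<delta>)) *\<^sub>R h', a') + b (0 + \<delta> *\<^sub>R fst x) (0 + x)"
    by (intro fixed_point[rule_format]) (use \<delta> K in \<open>auto simp: linear_ident\<close>)
  then obtain x where x: "x = ((1 / (2 * \<delta>)) *\<^sub>R h', a') + b (0 + \<delta> *\<^sub>R fst x) (0 + x)" by blast
  define w where "w = fst x"
  define p where "p = snd x"
  have "w = fst (((1 / (2 * \<delta>)) *\<^sub>R h', a') + b (0 + \<delta> *\<^sub>R fst x) (0 + x))"
    unfolding w_def by (rule arg_cong[OF x])
  also have "\<dots> = (1 / (2 * \<delta>)) *\<^sub>R h' - (\<delta> / 2) *\<^sub>R (w * w)" by (simp add: b_def w_def)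
  finally have w1: "w + (\<delta> / 2) *\<^sub>R (w * w) = (1 / (2 * \<delta>)) *\<^sub>R h'" by (simp only: eq_diff_eq)
  have "p = snd (((1 / (2 * \<delta>)) *\<^sub>R h', a') + b (0 + \<delta> *\<^sub>R fst x) (0 + x))"
    unfolding p_def by (rule arg_cong[OF x])
  also have "\<dots> = a' - \<delta> *\<^sub>R (w * p)" by (simp add: b_def w_def p_def)
  finally have p1: "p + \<delta> *\<^sub>R (w * p) = a'" by (simp only: eq_diff_eq)
  define m where "m = 1 + \<delta> *\<^sub>R w"
  have "m * p = a'" unfolding m_def p1[symmetric] by (simp add: algebra_simps)
  have "m * m = 1 + ((\<delta> + \<delta>) *\<^sub>R w + (\<delta> * \<delta>) *\<^sub>R (w * w))"
    unfolding scaleR_add_left m_def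
    by (simp only: ring_distribs scaleR_add_right mult_scaleR_left mult_scaleR_right scaleR_scaleR
        mult_1_left mult_1_right add.assoc)
  also have "\<dots> = 1 + (2 * \<delta>) *\<^sub>R (w + (\<delta> / 2) *\<^sub>R (w * w))"
    by (simp add: scaleR_add_right)
  also have "\<dots> = 1 + h'" unfolding w1 using \<delta> by simp
  finally have "m * m = 1 + h'" .
  define m1 where "m1 = unsc r r m"
  define q1 where "q1 = unsc r r p"
  have c: "conv m1" "conv q1" using r by (auto simp: m1_def q1_def conv_unsc)
  have e1: "m1 * m1 = M"
  proof (rule sc_inj[of r r])
    show "sc r r (m1 * m1) = sc r r M"
      unfolding sc_mult using arg_cong[OF \<open>m * m = 1 + h'\<close>, of Rep_bser] r bh sc_cconst[of r r 1]
      by (simp add: m1_def sc_unsc times_bser.rep_eq plus_bser.rep_eq one_bser.rep_eq h'_def Rep_bsc h_def sc_diff cconst_simps)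
  qed (use r in auto)
  have e2: "m1 * q1 = a"
  proof (rule sc_inj[of r r])
    show "sc r r (m1 * q1) = sc r r a"
      unfolding sc_mult using arg_cong[OF \<open>m * p = a'\<close>, of Rep_bser] r ba
      by (simp add: m1_def q1_def sc_unsc times_bser.rep_eq a'_def Rep_bsc)
  qed (use r in auto)
  have "pcoeff m1 0 * pcoeff m1 0 = 1"
    unfolding pcoeff_mult_0[symmetric] e1 by (rule M(2))
  \<comment> \<open>the constant term of \<open>m1\<close> is a square root of 1; its sign is corrected if necessary\<close>
  then consider "pcoeff m1 0 = 1" | "pcoeff m1 0 = - 1" by (metis square_eq_1_iff)
  then show ?thesis
  proof cases
    case 1
    show ?thesis by (rule exI[of _ m1], rule exI[of _ q1]) (use c e1 e2 1 in blast)
  next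
    case 2
    have "conv (- m1)" "conv (- q1)" using conv_diff[OF conv_0 c(1)] conv_diff[OF conv_0 c(2)] by simp_all
    with 2 e1 e2 show ?thesis by (intro exI[of _ "- m1"] exI[of _ "- q1"]) simp
  qed
qed

section \<open>The Cauchy problem\<close>

text \<open>\<open>IVb\<close> and \<open>Lb\<close> are the two contractions of the Banach algebra from which all occurring integrals and
derivatives of the unknown are composed.\<close>

lift_definition IVb :: "bser \<Rightarrow> bser" is IV by (simp add: bounded_IV)
lift_definition Lb :: "bser \<Rightarrow> bser" is "\<lambda>a. dU (IV a)" by (simp add: bounded_dU_IV)

lemma linear_IVb: "linear IVb"
  by (rule linearI; transfer; simp add: IV_add IV_cmult)
lemma linear_Lb: "linear Lb"
  by (rule linearI; transfer; simp add: IV_add IV_cmult dU_simps)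
lemma norm_IVb: "norm (IVb a) \<le> norm a" by transfer (simp add: bounded_IV)
lemma norm_Lb: "norm (Lb a) \<le> norm a" by transfer (simp add: bounded_dU_IV)

abbreviation halfb :: bser where "halfb \<equiv> of_real (1 / 2)"

lemma Rep_of_real: "Rep_bser (of_real c) = cconst c"
  by (simp add: of_real_def scaleR_bser.rep_eq one_bser.rep_eq)

lemma Rep_iso: "Rep_bser (iso halfb x y) = iso half (cmap Rep_bser x) (cmap Rep_bser y)"
  by (simp add: iso_def plus_bser.rep_eq times_bser.rep_eq Rep_of_real)

lemma sc_iso: "sc r s (iso half x y) = iso half (cmap (sc r s) x) (cmap (sc r s) y)"
  by (simp add: iso_def sc_add sc_mult sc_cconst)

definition scale_vec :: "real ^ 3 \<Rightarrow> bser \<Rightarrow> bser ^ 3" where "scale_vec \<beta> c = (\<chi> i. (\<beta> $ i) *\<^sub>R c)"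

lemma norm_scale_vec: "norm (scale_vec \<beta> c) = norm \<beta> * norm c"
  by (simp add: norm_vec_def scale_vec_def L2_set_left_distrib)

lemma bounded_linear_scale_vec: "bounded_linear (scale_vec \<beta>)"
  by (rule bounded_linear_intro[where K = "norm \<beta>"])
     (simp_all add: norm_scale_vec mult.commute, simp_all add: scale_vec_def vec_eq_iff scaleR_add_right mult.commute)

lemma norm_cmap_le:
  fixes f :: "'a::real_normed_vector \<Rightarrow> 'b::real_normed_vector"
  assumes "\<And>x. norm (f x) \<le> c * norm x" "c \<ge> 0"
  shows "norm (cmap f v) \<le> c * norm v"
proof -
  have "norm (cmap f v) \<le> L2_set (\<lambda>i. c * norm (v $ i)) UNIV"
    unfolding norm_vec_def by (rule L2_set_mono) (use assms in auto)
  then show ?thesis using assms(2) by (simp add: norm_vec_def L2_set_right_distrib)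
qed

lemma norm_vec3_le: "norm (x :: 'a::real_normed_vector ^ 3) \<le> norm (x $ 1) + norm (x $ 2) + norm (x $ 3)"
  using L2_set_le_sum[of UNIV "\<lambda>i. norm (x $ i)"] by (simp add: norm_vec_def sum_3)

lemma linear_cmap: assumes "linear f" shows "linear (cmap f)"
  by (rule linearI) (simp_all add: vec_eq_iff linear_add[OF assms] linear_scale[OF assms])

lemma bounded_bilinear_iso: "bounded_bilinear (iso halfb)"
proof -
  have m: "bounded_bilinear (\<lambda>x y :: bser ^ 3. x $ i * y $ j)" for i j :: 3
    by (rule bounded_bilinear.comp[OF bounded_bilinear_mult bounded_linear_vec_nth bounded_linear_vec_nth])
  show ?thesis unfolding iso_def[abs_def]
    by (rule bounded_bilinear_add_fun[OF m bounded_bilinear_linear_compose[OF bounded_linear_mult_right bounded_bilinear_add_fun[OF m m]]])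
qed

text \<open>Cramer's rule for the scalar products with \<open>f\<^sub>u\<close>, \<open>f\<^sub>v\<close>, \<open>f\<^sub>u\<^sub>u\<close> at the origin, whose determinant is
proportional to \<open>A = F\<^sub>u - E\<^sub>v/2\<close>.\<close>

lemma solve_constant_system:
  fixes a e A :: real and c1 c2 c3 :: bser
  assumes "A \<noteq> 0" "a + e / 2 = A"
  defines "W \<equiv> scale_vec (vector [a / A - 1, a / A, 2 - a / A]) c1
      + scale_vec (vector [1 - a / A, - (a / A), a / A]) c2 + scale_vec (vector [1 / A, 1 / A, - (1 / A)]) c3"
  shows "iso halfb (vector [0, 1, 1]) W = c1" "iso halfb (vector [1, 1, - 1]) W = c2"
    "iso halfb (vector [of_real a, 0, of_real e]) W = c3"
proof -
  have e: "e = 2 * A - 2 * a" using assms(2) by (simp add: field_simps)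
  have iso_scale_vec: "iso halfb (vector [of_real p, of_real q, of_real r]) (scale_vec \<beta> c)
      = (p * \<beta> $ 1 + 1 / 2 * (q * \<beta> $ 3 + r * \<beta> $ 2)) *\<^sub>R c" for p q r \<beta> c
    unfolding scaleR_conv_of_real of_real_add of_real_mult
    by (simp add: iso_def scale_vec_def scaleR_conv_of_real algebra_simps del: of_real_divide)
  have "iso halfb (vector [of_real 0, of_real 1, of_real 1]) W = c1"
    unfolding W_def iso_add iso_scale_vec using assms(1) by (simp add: divide_simps)
  then show "iso halfb (vector [0, 1, 1]) W = c1" by simp
  have "iso halfb (vector [of_real 1, of_real 1, of_real (- 1)]) W = c2"
    unfolding W_def iso_add iso_scale_vec using assms(1) by (simp add: divide_simps)
  then show "iso halfb (vector [1, 1, - 1]) W = c2" by simp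
  have "a * (a / A - 1) + 1 / 2 * (0 * (2 - a / A) + e * (a / A)) = 0"
    "a * (1 - a / A) + 1 / 2 * (0 * (a / A) + e * (- (a / A))) = 0"
    "a * (1 / A) + 1 / 2 * (0 * - (1 / A) + e * (1 / A)) = 1"
    unfolding e using assms(1) by (simp_all add: field_simps)
  then have "iso halfb (vector [of_real a, of_real 0, of_real e]) W = c3"
    unfolding W_def iso_add iso_scale_vec by (simp only: vector_3 scaleR_zero_left scaleR_one add_0_left)
  then show "iso halfb (vector [of_real a, 0, of_real e]) W = c3" by simp
qed

text \<open>The unknown \<open>W\<close> is \<open>f\<^sub>v\<^sub>v\<close>; the series \<open>P, Q, S, T\<close> are the contributions of the initial data to
\<open>f\<^sub>u, f\<^sub>v, f\<^sub>u\<^sub>u, f\<^sub>u\<^sub>v\<close>.  The constant parts of the coefficients are inverted exactly.  What remains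
on the right-hand side is bilinear in a small and a bounded factor: the coefficients without their
constant terms are small by shrinking \<open>r\<close>, the operators applied to \<open>W\<close> by making \<open>s/r\<close> small.\<close>

lemma cauchy_problem:
  fixes P Q S T :: "ser2 ^ 3" and k1 k2 k3 :: ser2 and a e A :: real
  assumes conv: "\<And>i. conv (P $ i)" "\<And>i. conv (Q $ i)" "\<And>i. conv (S $ i)" "\<And>i. conv (T $ i)"
      "conv k1" "conv k2" "conv k3"
    and P0: "\<And>i. pcoeff (P $ i) 0 = vector [0, 1, 1] $ i"
    and Q0: "\<And>i. pcoeff (Q $ i) 0 = vector [1, 1, - 1] $ i"
    and S0: "\<And>i. pcoeff (S $ i) 0 = vector [a, 0, e] $ i"
    and A: "A \<noteq> 0" "a + e / 2 = A"
  shows "\<exists>W :: ser2 ^ 3. (\<forall>i. conv (W $ i)) \<and>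
     iso half (P + cmap (\<lambda>w. dU (IV (IV w))) W) W = k1 \<and>
     iso half (Q + cmap IV W) W = k2 \<and>
     iso half (S + cmap (\<lambda>w. dU (dU (IV (IV w)))) W) W
       = k3 + iso half (T + cmap (\<lambda>w. dU (IV w)) W) (T + cmap (\<lambda>w. dU (IV w)) W)"
proof -
  define \<beta>1 :: "real ^ 3" where "\<beta>1 = vector [a / A - 1, a / A, 2 - a / A]"
  define \<beta>2 :: "real ^ 3" where "\<beta>2 = vector [1 - a / A, - (a / A), a / A]"
  define \<beta>3 :: "real ^ 3" where "\<beta>3 = vector [1 / A, 1 / A, - (1 / A)]"
  define b :: "(bser^3) \<times> (bser^3) \<times> (bser^3) \<times> (bser^3) \<Rightarrow> (bser^3) \<times> (bser^3) \<Rightarrow> bser^3" where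
    "b y z = scale_vec (- \<beta>1) (iso halfb (fst y) (fst z)) + scale_vec (- \<beta>2) (iso halfb (fst (snd y)) (fst z))
      + scale_vec (- \<beta>3) (iso halfb (fst (snd (snd y))) (fst z)) + scale_vec \<beta>3 (iso halfb (snd (snd (snd y))) (snd z))" for y z
  note bl = bounded_linear_fst bounded_linear_snd
  have b: "bounded_bilinear b" unfolding b_def[abs_def]
    by (intro bounded_bilinear_add_fun bounded_bilinear_linear_compose[OF bounded_linear_scale_vec]
        bounded_bilinear.comp[OF bounded_bilinear_iso] bl bounded_linear_compose[OF bl(1)] bounded_linear_compose[OF bl(2)])
  define c3 where "c3 = k3 + iso half T T"
  define X where "X = {k1, k2, c3} \<union> range (($) P) \<union> range (($) Q) \<union> range (($) S) \<union> range (($) T)"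
  have "conv c3" unfolding c3_def iso_def using conv by (intro conv_add conv_mult conv_cconst)
  then have "\<And>x. x \<in> X \<Longrightarrow> conv x" using conv by (auto simp: X_def)
  moreover have "finite X" by (simp add: X_def)
  ultimately obtain \<rho> where \<rho>: "\<rho> > 0" "\<forall>x\<in>X. cvg \<rho> x" using conv_common by metis
  define N where "N c = (\<Sum>\<^sub>\<infinity>p. \<bar>pcoeff c p\<bar> * \<rho> ^ (fst p + snd p))" for c
  have N0: "N c \<ge> 0" for c unfolding N_def using \<rho> by (intro infsum_nonneg) auto
  define P' where "P' = cmap (\<lambda>c. c - cconst (pcoeff c 0))  P"
  define Q' where "Q' = cmap (\<lambda>c. c - cconst (pcoeff c 0)) Q"
  define S' where "S' = cmap (\<lambda>c. c - cconst (pcoeff c 0)) S"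
  define NN where "NN = (\<Sum>x\<in>UNIV. N (P' $ x)) + (\<Sum>x\<in>UNIV. N (Q' $ x)) + (\<Sum>x\<in>UNIV. N (S' $ x))"
  have NN: "NN \<ge> 0" unfolding NN_def by (intro add_nonneg_nonneg sum_nonneg N0)
  define K where "K = 2 + norm \<beta>1 * N k1 + norm \<beta>2 * N k2 + norm \<beta>3 * N c3 + 2 * (\<Sum>x\<in>UNIV. N (T $ x))"
  have nn: "0 \<le> norm \<beta>1 * N k1" "0 \<le> norm \<beta>2 * N k2" "0 \<le> norm \<beta>3 * N c3" "0 \<le> (\<Sum>x\<in>UNIV. N (T $ x))"
    using N0 by (auto intro: sum_nonneg)
  then have K: "K \<ge> 2" unfolding K_def by linarith
  then have "K > 0" by simp
  from quadratic_fixed_point[OF b this] obtain \<delta> where \<delta>: "\<delta> > 0"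
    and fixed_point: "\<forall>k y z A C. norm k \<le> K \<longrightarrow> norm y \<le> \<delta> \<longrightarrow> norm z \<le> K \<longrightarrow> linear A \<longrightarrow> linear C \<longrightarrow>
      (\<forall>x. norm (A x) \<le> \<delta> * norm x) \<longrightarrow> (\<forall>x. norm (C x) \<le> K * norm x) \<longrightarrow>
      (\<exists>x. x = k + b (y + A x) (z + C x))"
    by (elim exE conjE)
  \<comment> \<open>\<open>r = t\<rho>\<close> makes the nonconstant parts of the coefficients small, then \<open>s = \<epsilon>r\<close> the operators\<close>
  define t where "t = min (min 1 (1 / \<rho>)) (\<delta> / (NN + 1))"
  have t: "0 < t" "t \<le> 1" "t \<le> 1 / \<rho>" "t \<le> \<delta> / (NN + 1)" using \<delta> NN \<rho> by (auto simp: t_def)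
  have "t * NN \<le> \<delta> / (NN + 1) * NN" using NN t by (intro mult_right_mono) auto
  also have "\<dots> \<le> \<delta>" using NN \<delta> by (simp add: divide_le_eq)
  finally have tN: "t * NN \<le> \<delta>" .
  define r where "r = t * \<rho>"
  have r: "0 < r" "r \<le> \<rho>" "r \<le> 1"
    using t \<rho> by (auto simp: r_def mult_left_le_one_le pos_le_divide_eq)
  define \<epsilon> where "\<epsilon> = min 1 (\<delta> / 4)"
  have \<epsilon>: "0 < \<epsilon>" "\<epsilon> \<le> 1" "\<epsilon> \<le> \<delta> / 4" using \<delta> by (auto simp: \<epsilon>_def)
  define s where "s = \<epsilon> * r"
  have s: "0 < s" "s \<le> r" using \<epsilon> r by (auto simp: s_def mult_left_le_one_le)
  have nz: "r \<noteq> 0" "s \<noteq> 0" using r s by auto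
  have bnd: "bounded_ser (sc r s c)" "norm (bsc r s c) \<le> N c" if "c \<in> X" for c
    using bounded_ser_sc[OF \<rho>(2)[rule_format, OF that], of r s] r s norm_bsc[of r s c] unfolding N_def by auto
  have small: "norm (bsc r s (c - cconst (pcoeff c 0))) \<le> t * N (c - cconst (pcoeff c 0))" 
    "bounded_ser (sc r s (c - cconst (pcoeff c 0)))" if "c \<in> X" for c
  proof -
    have "cvg \<rho> (c - cconst (pcoeff c 0))" using \<rho> that by (intro cvg_diff cvg_cconst) auto
    from bnorm_sc_small[OF this, of t r s]
    show *: "bounded_ser (sc r s (c - cconst (pcoeff c 0)))"
      and "norm (bsc r s (c - cconst (pcoeff c 0))) \<le> t * N (c - cconst (pcoeff c 0))"
      using t r s \<rho> norm_bsc[of r s "c - cconst (pcoeff c 0)"] unfolding N_def by (auto simp: r_def pcoeff_cconst)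
  qed
  have small3: "norm (cmap (bsc r s) (cmap (\<lambda>c. c - cconst (pcoeff c 0)) V)) \<le> t * (\<Sum>x\<in>UNIV. N (cmap (\<lambda>c. c - cconst (pcoeff c 0)) V $ x))"
    if "range (($) V) \<subseteq> X" for V
  proof -
    have "V $ i \<in> X" for i using that by auto
    then show ?thesis
      using norm_vec3_le[of "cmap (bsc r s) (cmap (\<lambda>c. c - cconst (pcoeff c 0)) V)"] small(1)[of "V $ 1"] small(1)[of "V $ 2"] small(1)[of "V $ 3"]
      by (simp add: sum_3 distrib_left)
  qed
  define yP where "yP = cmap (bsc r s) P'"
  define yQ where "yQ = cmap (bsc r s) Q'"
  define yS where "yS = cmap (bsc r s) S'"
  define T' where "T' = cmap (bsc r s) T"
  have "norm (yP, yQ, yS, 0 :: bser ^ 3) \<le> norm yP + (norm yQ + (norm yS + 0))"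
    by (intro order_trans[OF norm_Pair_le] add_left_mono order_trans[OF norm_Pair_le]) simp
  also have "\<dots> \<le> t * NN"
  proof -
    have "range (($) P) \<subseteq> X" "range (($) Q) \<subseteq> X" "range (($) S) \<subseteq> X" by (auto simp: X_def)
    from this[THEN small3] show ?thesis
      unfolding NN_def yP_def yQ_def yS_def P'_def Q'_def S'_def distrib_left by linarith
  qed
  finally have y: "norm (yP, yQ, yS, 0 :: bser ^ 3) \<le> \<delta>" using tN by simp
  define opP where "opP w = (s\<^sup>2 / r) *\<^sub>R Lb (IVb w)" for w
  define opQ where "opQ w = s *\<^sub>R IVb w" for w
  define opS where "opS w = (s / r)\<^sup>2 *\<^sub>R Lb (Lb w)" for w
  define opT where "opT w = (s / r) *\<^sub>R Lb w" for w
  have lin: "linear opP" "linear opQ" "linear opS" "linear opT"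
    unfolding opP_def[abs_def] opQ_def[abs_def] opS_def[abs_def] opT_def[abs_def]
    using linear_compose[OF linear_IVb linear_Lb] linear_compose[OF linear_Lb linear_Lb] linear_IVb linear_Lb
    by (auto intro!: linear_compose_scale_right simp: o_def)
  have sr: "s / r = \<epsilon>" "s\<^sup>2 / r = \<epsilon> * (\<epsilon> * r)" using r by (auto simp: s_def power2_eq_square)
  have le1: "\<epsilon> * r \<le> 1" "\<epsilon> * (\<epsilon> * r) \<le> \<epsilon>" "\<epsilon> * \<epsilon> \<le> \<epsilon>" "\<epsilon> * r \<le> \<epsilon>"
    using \<epsilon> r by (auto simp: mult_le_one mult_left_le)
  have opn: "norm (opP w) \<le> \<epsilon> * norm w" "norm (opQ w) \<le> \<epsilon> * norm w" "norm (opS w) \<le> \<epsilon> * norm w"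
      "norm (opT w) \<le> \<epsilon> * norm w" for w
  proof -
    have sl: "norm (c *\<^sub>R x) \<le> \<epsilon> * norm w" if "0 \<le> c" "c \<le> \<epsilon>" "norm x \<le> norm w" for c and x :: bser
      using that by (simp add: mult_mono)
    have n: "norm (Lb (IVb w)) \<le> norm w" "norm (Lb (Lb w)) \<le> norm w"
      using norm_Lb norm_IVb order_trans by blast+
    have c: "0 \<le> s\<^sup>2 / r" "s\<^sup>2 / r \<le> \<epsilon>" "0 \<le> s" "s \<le> \<epsilon>" "0 \<le> (s / r)\<^sup>2" "(s / r)\<^sup>2 \<le> \<epsilon>"
      using \<epsilon> r le1 s unfolding sr by (auto simp: power2_eq_square s_def)
    show "norm (opP w) \<le> \<epsilon> * norm w" unfolding opP_def by (rule sl[OF c(1,2) n(1)])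
    show "norm (opQ w) \<le> \<epsilon> * norm w" unfolding opQ_def by (rule sl[OF c(3,4) norm_IVb])
    show "norm (opS w) \<le> \<epsilon> * norm w" unfolding opS_def by (rule sl[OF c(5,6) n(2)])
    show "norm (opT w) \<le> \<epsilon> * norm w"
      unfolding opT_def sr by (rule sl[OF less_imp_le[OF \<epsilon>(1)] order_refl norm_Lb])
  qed
  define Aop where "Aop W = (cmap opP W, cmap opQ W, cmap opS W, cmap opT W)" for W
  define Cop where "Cop W = (W, cmap opT W)" for W
  have opn3: "norm (cmap opP W) \<le> \<epsilon> * norm W" "norm (cmap opQ W) \<le> \<epsilon> * norm W" "norm (cmap opS W) \<le> \<epsilon> * norm W"
      "norm (cmap opT W) \<le> \<epsilon> * norm W" for W
    using \<epsilon> by (intro norm_cmap_le opn; simp)+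
  have "norm (Aop W) \<le> \<delta> * norm W" for W
  proof -
    have "norm (Aop W) \<le> norm (cmap opP W) + (norm (cmap opQ W) + (norm (cmap opS W) + norm (cmap opT W)))"
      unfolding Aop_def by (intro order_trans[OF norm_Pair_le] add_left_mono order_refl)
    also have "\<dots> \<le> 4 * \<epsilon> * norm W" using opn3[of W] by simp
    also have "\<dots> \<le> \<delta> * norm W" using \<epsilon> by (intro mult_right_mono) auto
    finally show ?thesis .
  qed
  moreover have "norm (Cop W) \<le> K * norm W" for W
  proof -
    have "norm (Cop W) \<le> norm W + norm (cmap opT W)" unfolding Cop_def by (rule norm_Pair_le)
    also have "\<dots> \<le> (1 + \<epsilon>) * norm W" using opn3[of W] by (simp add: distrib_right)
    also have "\<dots> \<le> K * norm W" using \<epsilon> K by (intro mult_right_mono) auto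
    finally show ?thesis .
  qed
  moreover have "linear Aop" "linear Cop"
    unfolding Aop_def[abs_def] Cop_def[abs_def] using lin[THEN linear_cmap]
    by (auto intro!: linearI simp: linear_add linear_scale)
  moreover define k where "k = scale_vec \<beta>1 (bsc r s k1) + scale_vec \<beta>2 (bsc r s k2) + scale_vec \<beta>3 (bsc r s c3)"
  have inX: "k1 \<in> X" "k2 \<in> X" "c3 \<in> X" "P $ i \<in> X" "Q $ i \<in> X" "S $ i \<in> X" "T $ i \<in> X" for i
    by (auto simp: X_def)
  have "norm k \<le> norm \<beta>1 * N k1 + norm \<beta>2 * N k2 + norm \<beta>3 * N c3"
    unfolding k_def
    by (intro order_trans[OF norm_triangle_ineq] add_mono) (auto simp: norm_scale_vec inX intro!: mult_left_mono bnd(2))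
  then have "norm k \<le> K" unfolding K_def using nn by linarith
  moreover have "norm (0 :: bser ^ 3, 2 *\<^sub>R T') \<le> K"
  proof -
    have "norm T' \<le> (\<Sum>x\<in>UNIV. N (T $ x))"
      using norm_vec3_le[of T'] bnd(2)[OF inX(7), of 1] bnd(2)[OF inX(7), of 2] bnd(2)[OF inX(7), of 3]
      by (simp add: T'_def sum_3)
    then show ?thesis using norm_Pair_le[of "0 :: bser ^ 3" "2 *\<^sub>R T'"] nn unfolding K_def by simp
  qed
  ultimately have "\<exists>W. W = k + b ((yP, yQ, yS, 0) + Aop W) ((0, 2 *\<^sub>R T') + Cop W)"
    using y by (intro fixed_point[rule_format]) auto
  then obtain W where W: "W = k + b ((yP, yQ, yS, 0) + Aop W) ((0, 2 *\<^sub>R T') + Cop W)" by blast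
  define x1 where "x1 = bsc r s k1 - iso halfb (yP + cmap opP W) W"
  define x2 where "x2 = bsc r s k2 - iso halfb (yQ + cmap opQ W) W"
  define x3 where "x3 = bsc r s c3 - iso halfb (yS + cmap opS W) W + iso halfb (cmap opT W) (2 *\<^sub>R T' + cmap opT W)"
  have scale_vec_simps: "scale_vec \<beta> (c - d) = scale_vec \<beta> c - scale_vec \<beta> d" "scale_vec (- \<beta>) c = - scale_vec \<beta> c" "scale_vec \<beta> (c + d) = scale_vec \<beta> c + scale_vec \<beta> d" for \<beta> c d
    by (auto simp: scale_vec_def vec_eq_iff scaleR_diff_right scaleR_add_right)
  have W': "W = scale_vec \<beta>1 x1 + scale_vec \<beta>2 x2 + scale_vec \<beta>3 x3"
    by (rule trans[OF W]) (simp add: k_def b_def Aop_def Cop_def x1_def x2_def x3_def scale_vec_simps)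
  note sol = solve_constant_system[OF A, of x1 x2 x3, folded \<beta>1_def \<beta>2_def \<beta>3_def, folded W']
  have bsc_split: "bsc r s c = of_real (pcoeff c 0) + bsc r s (c - cconst (pcoeff c 0))" if "c \<in> X" for c
    by (rule Rep_bser_inject[THEN iffD1])
       (simp only: plus_bser.rep_eq Rep_of_real Rep_bsc[OF bnd(1)[OF that]] Rep_bsc[OF small(2)[OF that]]
          sc_diff sc_cconst, simp)
  have Psplit: "cmap (bsc r s) P = vector [0, 1, 1] + yP"
    and Qsplit: "cmap (bsc r s) Q = vector [1, 1, - 1] + yQ"
    and Ssplit: "cmap (bsc r s) S = vector [of_real a, 0, of_real e] + yS"
    using P0 Q0 S0 unfolding yP_def yQ_def yS_def P'_def Q'_def S'_def
    by (simp_all add: vec_eq_iff forall_3 bsc_split inX)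
  define V where "V = cmap (unsc r s) W"
  have scV: "cmap (sc r s) V = cmap Rep_bser W" by (simp add: V_def vec_eq_iff sc_unsc nz)
  have Rep_scaleR: "Rep_bser (c *\<^sub>R x) = cconst c * Rep_bser x" for c x by (simp add: scaleR_bser.rep_eq)
  have cc: "cconst x * (cconst y * z) = cconst (x * y) * z" for x y z by (simp add: cconst_simps mult.assoc)
  have scV': "sc r s (V $ i) = Rep_bser (W $ i)" for i using scV by (simp add: vec_eq_iff)
  have opeqs: "sc r s (dU (IV (IV (V $ i)))) = Rep_bser (opP (W $ i))" "sc r s (IV (V $ i)) = Rep_bser (opQ (W $ i))"
    "sc r s (dU (dU (IV (IV (V $ i))))) = Rep_bser (opS (W $ i))" "sc r s (dU (IV (V $ i))) = Rep_bser (opT (W $ i))" for i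
    unfolding opP_def opQ_def opS_def opT_def Rep_scaleR IVb.rep_eq Lb.rep_eq
    by (simp_all add: sc_dU sc_IV nz scV' dU_simps IV_cmult cc dU_IV power2_eq_square)
  have repP: "cmap (sc r s) (P + cmap (\<lambda>w. dU (IV (IV w))) V) = cmap Rep_bser (cmap (bsc r s) P + cmap opP W)"
    and repQ: "cmap (sc r s) (Q + cmap IV V) = cmap Rep_bser (cmap (bsc r s) Q + cmap opQ W)"
    and repS: "cmap (sc r s) (S + cmap (\<lambda>w. dU (dU (IV (IV w)))) V) = cmap Rep_bser (cmap (bsc r s) S + cmap opS W)"
    and repT: "cmap (sc r s) (T + cmap (\<lambda>w. dU (IV w)) V) = cmap Rep_bser (T' + cmap opT W)"
    by (simp_all add: vec_eq_iff sc_add plus_bser.rep_eq Rep_bsc bnd inX opeqs T'_def)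
  have "iso half (P + cmap (\<lambda>w. dU (IV (IV w))) V) V = k1"
  proof (rule sc_inj[OF nz])
    have "iso halfb (cmap (bsc r s) P + cmap opP W) W = bsc r s k1"
      unfolding Psplit iso_add sol by (simp add: x1_def iso_add)
    then show "sc r s (iso half (P + cmap (\<lambda>w. dU (IV (IV w))) V) V) = sc r s k1"
      unfolding sc_iso repP scV Rep_iso[symmetric] by (simp add: Rep_bsc bnd inX)
  qed
  moreover have "iso half (Q + cmap IV V) V = k2"
  proof (rule sc_inj[OF nz])
    have "iso halfb (cmap (bsc r s) Q + cmap opQ W) W = bsc r s k2"
      unfolding Qsplit iso_add sol by (simp add: x2_def iso_add)
    then show "sc r s (iso half (Q + cmap IV V) V) = sc r s k2"
      unfolding sc_iso repQ scV Rep_iso[symmetric] by (simp add: Rep_bsc bnd inX)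
  qed
  moreover have "iso half (S + cmap (\<lambda>w. dU (dU (IV (IV w)))) V) V
     = k3 + iso half (T + cmap (\<lambda>w. dU (IV w)) V) (T + cmap (\<lambda>w. dU (IV w)) V)"
  proof (rule sc_inj[OF nz])
    have T2: "iso halfb (cmap opT W) (2 *\<^sub>R T' + cmap opT W)
        = iso halfb (T' + cmap opT W) (T' + cmap opT W) - iso halfb T' T'"
      by (simp only: scaleR_2 iso_add iso_commute[of _ "cmap opT W" T'], simp)
    have "iso halfb (cmap (bsc r s) S + cmap opS W) W = bsc r s c3 + iso halfb (T' + cmap opT W) (T' + cmap opT W) - iso halfb T' T'"
      unfolding Ssplit iso_add(1) sol x3_def T2 by simp
    moreover have "Rep_bser (bsc r s c3) = sc r s k3 + Rep_bser (iso halfb T' T')"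
    proof -
      have "cmap (sc r s) T = cmap Rep_bser T'" by (simp add: T'_def vec_eq_iff Rep_bsc bnd inX)
      then show ?thesis unfolding Rep_bsc[OF bnd(1)[OF inX(3)]] Rep_iso
        unfolding c3_def sc_add sc_iso by simp
    qed
    ultimately show "sc r s (iso half (S + cmap (\<lambda>w. dU (dU (IV (IV w)))) V) V)
        = sc r s (k3 + iso half (T + cmap (\<lambda>w. dU (IV w)) V) (T + cmap (\<lambda>w. dU (IV w)) V))"
      unfolding sc_add sc_iso repS repT scV Rep_iso[symmetric]
      by (simp add: minus_bser.rep_eq plus_bser.rep_eq)
  qed
  moreover have "conv (V $ i)" for i using conv_unsc r s by (simp add: V_def)
  ultimately show ?thesis by blast
qed

section \<open>Initial data and formal realization\<close>

lemma pcoeff_at_0: "pcoeff (res0 a) 0 = pcoeff a 0" "pcoeff (IU a) 0 = 0" "pcoeff (IV a) 0 = 0"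
  "pcoeff (dU (IV a)) 0 = 0" "pcoeff (cconst c) 0 = c" "pcoeff 1 0 = 1" "pcoeff (a * b) 0 = pcoeff a 0 * pcoeff b 0"
  by (simp_all add: pcoeff_res0 pcoeff_IU pcoeff_IV pcoeff_dU pcoeff_cconst pcoeff_1 pcoeff_mult_0)

lemma two_eq_cconst: "(2 :: ser2) = cconst 2"
  by (simp add: cconst_def numeral_fps_const)

lemma two_simps: "conv 2" "res0 2 = 2" "pcoeff 2 0 = 2" "dU 2 = 0"
  unfolding two_eq_cconst by (simp_all add: conv_cconst res0_simps pcoeff_cconst dU_simps)

lemmas conv_intros = two_simps(1) conv_add conv_diff conv_mult conv_cconst conv_0 conv_1 conv_IU conv_IV conv_res0 conv_dU conv_dV

text \<open>Data along \<open>v = 0\<close>, all depending on \<open>u\<close> only.  Take \<open>f\<^sub>u = (q, 1, E - q\<^sup>2)\<close> and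
\<open>f\<^sub>v = (q + m, 1, 2F - q\<^sup>2 - 2qm - E)\<close>; the equations for \<open>E\<close> and \<open>F\<close> then hold identically, the one for
\<open>G\<close> becomes \<open>m\<^sup>2 = G - 2F + E\<close>, and the condition on \<open>f\<^sub>u\<^sub>u\<cdot>f\<^sub>v\<close> becomes
\<open>q\<^sub>u m = F\<^sub>u - E\<^sub>v/2 - E\<^sub>u/2\<close>.  The normalization at the origin makes \<open>G - 2F + E = 1\<close> there.\<close>

lemma initial_data:
  assumes E: "conv E" "pcoeff E 0 = 1" and F: "conv F" "pcoeff F 0 = 0" and G: "conv G" "pcoeff G 0 = 0"
  shows "\<exists>g x :: ser2 ^ 3. (\<forall>i. conv (g $ i)) \<and> (\<forall>i. conv (x $ i)) \<and> cmap res0 g = g \<and> cmap res0 x = x \<and>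
    iso half g g = res0 E \<and> iso half g x = res0 F \<and> iso half x x = res0 G \<and>
    iso half (cmap dU g) x = res0 (dU F - half * dV E) \<and>
    (\<forall>i. pcoeff (g $ i) 0 = vector [0, 1, 1] $ i) \<and> (\<forall>i. pcoeff (x $ i) 0 = vector [1, 1, - 1] $ i) \<and>
    (\<forall>i. pcoeff (dU (g $ i)) 0 = vector
       [pcoeff (dU F) 0 - pcoeff (dV E) 0 / 2 - pcoeff (dU E) 0 / 2, 0, pcoeff (dU E) 0] $ i)"
proof -
  define e where "e = res0 E"
  define f where "f = res0 F"
  define M where "M = res0 G - (f + f) + e"
  define a where "a = res0 (dU F - half * dV E) - half * dU e"
  have c: "conv e" "conv f" "conv M" "conv a"
    using E F G unfolding e_def f_def M_def a_def
    by (simp_all add: conv_intros)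
  have M0: "pcoeff M 0 = 1" using E F G by (simp add: M_def e_def f_def pcoeff_at_0 two_simps)
  obtain m' p' where mp': "conv m'" "conv p'" "m' * m' = M" "m' * p' = a" "pcoeff m' 0 = 1"
    using sqrt_division[OF c(3) M0 c(4)] by blast
  define m where "m = res0 m'"
  define p where "p = res0 p'"
  have r: "res0 e = e" "res0 f = f" "res0 m = m" "res0 p = p" "res0 M = M" "res0 a = a"
    by (simp_all add: e_def f_def m_def p_def M_def a_def res0_simps dU_res0 two_simps)
  have mm: "m * m = M" unfolding m_def using arg_cong[OF mp'(3), of res0] r by (simp add: res0_simps)
  have mp: "m * p = a" unfolding m_def p_def using arg_cong[OF mp'(4), of res0] r by (simp add: res0_simps)
  have c2: "conv m" "conv p" using mp' by (auto simp: m_def p_def intro: conv_res0)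
  define q where "q = IU p"
  have q: "conv q" "res0 q = q" "dU q = p" using c2 r by (auto simp: q_def conv_IU simp flip: IU_res0)
  define g :: "ser2 ^ 3" where "g = vector [q, 1, e - q * q]"
  define x :: "ser2 ^ 3" where "x = vector [q + m, 1, f + f - q * q - (q * m + q * m) - e]"
  have m0: "pcoeff m 0 = 1" by (simp add: m_def pcoeff_at_0 mp')
  have p0: "pcoeff p 0 = pcoeff (dU F) 0 - pcoeff (dV E) 0 / 2 - pcoeff (dU E) 0 / 2"
    using arg_cong[OF mp, of "\<lambda>c. pcoeff c 0"] m0 by (simp add: pcoeff_at_0 a_def e_def dU_res0)
  have q0: "pcoeff q 0 = 0" by (simp add: q_def pcoeff_at_0)
  have h: "half * (y + y) = y" for y unfolding distrib_left by (rule half_mult)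
  have "\<forall>i. conv (g $ i)" "\<forall>i. conv (x $ i)"
    unfolding forall_3 g_def x_def vector_3 using c c2 q
    by (simp_all add: conv_intros)
  moreover have "cmap res0 g = g" "cmap res0 x = x"
    by (simp_all add: vec_eq_iff forall_3 g_def x_def res0_simps two_simps r q)
  moreover have "iso half g g = res0 E"
    unfolding iso_def g_def vector_3 mult_1_left mult_1_right h by (simp add: e_def)
  moreover have "iso half g x = res0 F"
  proof -
    have "iso half g x = q * (q + m) + half * ((f - q * q - q * m) + (f - q * q - q * m))"
      unfolding iso_def g_def x_def vector_3 mult_1_left mult_1_right by (simp add: algebra_simps)
    then show ?thesis unfolding h by (simp add: f_def algebra_simps)
  qed
  moreover have "iso half x x = res0 G"
  proof -
    have "iso half x x = (q + m) * (q + m) + (f + f - q * q - (q * m + q * m) - e)"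
      unfolding iso_def x_def vector_3 mult_1_left mult_1_right h ..
    also have "\<dots> = m * m + (f + f) - e" by (simp add: algebra_simps)
    finally show ?thesis unfolding mm by (simp add: M_def)
  qed
  moreover have "iso half (cmap dU g) x = res0 (dU F - half * dV E)"
  proof -
    have "iso half (cmap dU g) x = p * (q + m) + half * (dU e - (p * q + p * q))"
      unfolding iso_def g_def x_def cmap_nth vector_3 by (simp add: dU_simps dU_mult q mult.commute)
    also have "\<dots> = m * p + half * dU e + (p * q - half * (p * q + p * q))"
      by (simp add: algebra_simps)
    finally show ?thesis unfolding h mp by (simp add: a_def)
  qed
  moreover have "\<forall>i. pcoeff (g $ i) 0 = vector [0, 1, 1] $ i" "\<forall>i. pcoeff (x $ i) 0 = vector [1, 1, - 1] $ i"
    using E F G by (simp_all add: forall_3 g_def x_def pcoeff_at_0 q0 m0 e_def f_def two_simps)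
  moreover have "\<forall>i. pcoeff (dU (g $ i)) 0 = vector
       [pcoeff (dU F) 0 - pcoeff (dV E) 0 / 2 - pcoeff (dU E) 0 / 2, 0, pcoeff (dU E) 0] $ i"
    by (simp add: forall_3 g_def dU_simps dU_mult q pcoeff_at_0 q0 p0 e_def dU_res0)
  ultimately show ?thesis by blast
qed

text \<open>The surface is recovered from its second derivative by integrating twice from the initial line.\<close>

theorem formal_realization:
  assumes E: "conv E" "pcoeff E 0 = 1" and F: "conv F" "pcoeff F 0 = 0" and G: "conv G" "pcoeff G 0 = 0"
    and A: "pcoeff (dU F) 0 - pcoeff (dV E) 0 / 2 \<noteq> 0"
  shows "\<exists>f :: ser2 ^ 3. (\<forall>i. conv (f $ i)) \<and>
    iso half (cmap dU f) (cmap dU f) = E \<and> iso half (cmap dU f) (cmap dV f) = F \<and>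
    iso half (cmap dV f) (cmap dV f) = G \<and>
    (\<forall>i. pcoeff (dU (f $ i)) 0 = vector [0, 1, 1] $ i) \<and>
    (\<forall>i. pcoeff (dV (f $ i)) 0 = vector [1, 1, - 1] $ i)"
proof -
  obtain g x :: "ser2 ^ 3" where gx: "\<And>i. conv (g $ i)" "\<And>i. conv (x $ i)" "cmap res0 g = g" "cmap res0 x = x"
    "iso half g g = res0 E" "iso half g x = res0 F" "iso half x x = res0 G"
    "iso half (cmap dU g) x = res0 (dU F - half * dV E)"
    "\<And>i. pcoeff (g $ i) 0 = vector [0, 1, 1] $ i" "\<And>i. pcoeff (x $ i) 0 = vector [1, 1, - 1] $ i"
    "\<And>i. pcoeff (dU (g $ i)) 0 = vector
       [pcoeff (dU F) 0 - pcoeff (dV E) 0 / 2 - pcoeff (dU E) 0 / 2, 0, pcoeff (dU E) 0] $ i"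
    using initial_data[OF E F G] by (elim exE conjE) blast
  define P where "P = g + cmap (\<lambda>c. dU (IV c)) x"
  define S where "S = cmap dU P"
  define T where "T = cmap dU x"
  have "\<exists>W :: ser2 ^ 3. (\<forall>i. conv (W $ i)) \<and>
     iso half (P + cmap (\<lambda>w. dU (IV (IV w))) W) W = dV F - half * dU G \<and>
     iso half (x + cmap IV W) W = half * dV G \<and>
     iso half (S + cmap (\<lambda>w. dU (dU (IV (IV w)))) W) W
       = dU (dV F) - half * dV (dV E) - half * dU (dU G)
         + iso half (T + cmap (\<lambda>w. dU (IV w)) W) (T + cmap (\<lambda>w. dU (IV w)) W)"
  proof (rule cauchy_problem[where A = "pcoeff (dU F) 0 - pcoeff (dV E) 0 / 2"])
    show "conv (P $ i)" "conv (x $ i)" "conv (S $ i)" "conv (T $ i)" for i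
      using gx(1,2) by (auto simp: P_def S_def T_def intro!: conv_add conv_dU conv_IV)
    show "conv (dV F - half * dU G)" "conv (half * dV G)" "conv (dU (dV F) - half * dV (dV E) - half * dU (dU G))"
      using E F G by (simp_all add: conv_intros)
    show "pcoeff (P $ i) 0 = vector [0, 1, 1] $ i" "pcoeff (x $ i) 0 = vector [1, 1, - 1] $ i" for i
      by (simp_all add: P_def gx pcoeff_at_0)
    show "pcoeff (S $ i) 0 = vector
       [pcoeff (dU F) 0 - pcoeff (dV E) 0 / 2 - pcoeff (dU E) 0 / 2, 0, pcoeff (dU E) 0] $ i" for i
      by (simp add: S_def P_def gx dU_simps dU_IV pcoeff_at_0)
  qed (use A in auto)
  then obtain W :: "ser2 ^ 3" where W: "\<And>i. conv (W $ i)"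
     "iso half (P + cmap (\<lambda>w. dU (IV (IV w))) W) W = dV F - half * dU G"
     "iso half (x + cmap IV W) W = half * dV G"
     "iso half (S + cmap (\<lambda>w. dU (dU (IV (IV w)))) W) W
       = dU (dV F) - half * dV (dV E) - half * dU (dU G)
         + iso half (T + cmap (\<lambda>w. dU (IV w)) W) (T + cmap (\<lambda>w. dU (IV w)) W)"
    by (elim exE conjE) blast
  define f where "f = cmap IU g + cmap IV (x + cmap IV W)"
  have dV_0: "dV (g $ i) = 0" "dV (x $ i) = 0" for i
    using dV_res0[of "g $ i"] dV_res0[of "x $ i"] gx(3,4) by (metis cmap_nth)+
  have IU0: "IU 0 = 0" by (rule ser2_eqI) (simp add: pcoeff_IU)
  have fU: "cmap dU f = P + cmap (\<lambda>w. dU (IV (IV w))) W"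
    by (simp add: f_def P_def vec_eq_iff dU_simps IV_add)
  have fV: "cmap dV f = x + cmap IV W"
    by (simp add: f_def vec_eq_iff dV_simps dV_IU dV_0 IU0)
  have fVV: "cmap dV (cmap dV f) = W"
    by (simp add: fV vec_eq_iff dV_simps dV_0)
  have fUU: "cmap dU (cmap dU f) = S + cmap (\<lambda>w. dU (dU (IV (IV w)))) W"
    by (simp add: fU S_def vec_eq_iff dU_simps)
  have fUV: "cmap dU (cmap dV f) = T + cmap (\<lambda>w. dU (IV w)) W"
    by (simp add: fV T_def vec_eq_iff dU_simps)
  have res_fU: "cmap res0 (cmap dU f) = g"
    using gx(3) by (simp add: fU P_def vec_eq_iff res0_simps flip: dU_res0)
       (simp add: dU_simps)
  have res_fV: "cmap res0 (cmap dV f) = x"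
    using gx(4) by (simp add: fV vec_eq_iff res0_simps)
  have res_fUU: "cmap res0 (cmap dU (cmap dU f)) = cmap dU g"
    using res_fU by (simp add: vec_eq_iff flip: dU_res0)
  have "iso half (cmap dU f) (cmap dU f) = E \<and> iso half (cmap dU f) (cmap dV f) = F \<and>
    iso half (cmap dV f) (cmap dV f) = G"
    by (intro conjI formal_isometry)
       (simp_all only: fVV fUU[symmetric] res0_iso res_fU res_fV res_fUU gx W(2-3)[folded fU fV] W(4)[folded fUU fUV])
  moreover have "conv (f $ i)" for i
    using gx(1,2) W(1) by (auto simp: f_def intro!: conv_add conv_IU conv_IV)
  moreover have "pcoeff (dU (f $ i)) 0 = vector [0, 1, 1] $ i" "pcoeff (dV (f $ i)) 0 = vector [1, 1, - 1] $ i" for i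
    using res_fU res_fV gx(9,10) pcoeff_at_0(1) by (metis cmap_nth)+
  ultimately show ?thesis by blast
qed

section \<open>Real analytic functions\<close>

text \<open>The pointwise form of real analyticity for real-valued functions, on boxes instead of balls, since
these fit the convergence of double series.\<close>

definition expands :: "(real \<times> real \<Rightarrow> real) \<Rightarrow> real \<times> real \<Rightarrow> ser2 \<Rightarrow> real \<Rightarrow> bool" where
  "expands f x a \<rho> \<longleftrightarrow> \<rho> > 0 \<and> cvg \<rho> a \<and> (\<forall>y. y - x \<in> box0 \<rho> \<longrightarrow> f y = evp a (y - x))"

lemma abs_fst_snd_le: "\<bar>fst y\<bar> \<le> norm y" "\<bar>snd y\<bar> \<le> norm y" for y :: "real \<times> real"
  by (metis norm_fst_le norm_snd_le prod.collapse real_norm_def)+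

lemma ball_subset_box0: "y \<in> ball x \<rho> \<Longrightarrow> y - x \<in> box0 \<rho>"
  using abs_fst_snd_le[of "y - x"]
  unfolding in_box0 by (simp add: dist_norm norm_minus_commute[of x y] del: fst_diff snd_diff)

lemma box0_norm: "y \<in> box0 \<rho> \<Longrightarrow> norm y < 2 * \<rho>"
  using norm_Pair_le[of "fst y" "snd y"] by (auto simp: in_box0)

lemma real_analytic_on_real_iff:
  "real_analytic_on f S \<longleftrightarrow> (\<forall>x\<in>S. \<exists>a \<rho>. expands f x a \<rho>)" for f :: "real \<times> real \<Rightarrow> real"
proof (intro iffI ballI)
  fix x assume "real_analytic_on f S" "x \<in> S"
  then obtain c r where r: "r > 0" "\<And>y. y \<in> ball x r \<Longrightarrow>
      ((\<lambda>(i, j). ((fst y - fst x) ^ i * (snd y - snd x) ^ j) *\<^sub>R c i j) has_sum f y) UNIV"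
    unfolding real_analytic_on_def by blast
  define a :: ser2 where "a = Abs_fps (\<lambda>j. Abs_fps (\<lambda>i. c i j))"
  have a: "pcoeff a p = c (fst p) (snd p)" for p by (simp add: a_def pcoeff_def)
  define \<rho> where "\<rho> = r / 3"
  have \<rho>: "\<rho> > 0" using r by (simp add: \<rho>_def)
  have hs: "((\<lambda>p. pcoeff a p * (fst d ^ fst p * snd d ^ snd p)) has_sum f (x + d)) UNIV" if "norm d < r" for d
    using r(2)[of "x + d"] that by (simp add: dist_norm case_prod_unfold a mult.commute)
  have "norm (\<rho>, \<rho>) < r" using norm_Pair_le[of \<rho> \<rho>] \<rho> by (simp add: \<rho>_def)
  from summable_on_iff_abs_summable_on_real[THEN iffD1, OF has_sum_imp_summable[OF hs[OF this]]]
  have "cvg \<rho> a" using \<rho> unfolding cvg_def by (simp add: abs_mult power_add)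
  moreover have "f y = evp a (y - x)" if "y - x \<in> box0 \<rho>" for y
  proof -
    have "norm (y - x) < r" using box0_norm[OF that] r by (simp add: \<rho>_def)
    from infsumI[OF hs[OF this]] show ?thesis by (simp add: evp_def ev_def)
  qed
  ultimately show "\<exists>a \<rho>. expands f x a \<rho>" unfolding expands_def using \<rho> by blast
next
  assume *: "\<forall>x\<in>S. \<exists>a \<rho>. expands f x a \<rho>"
  show "real_analytic_on f S" unfolding real_analytic_on_def
  proof
    fix x assume "x \<in> S"
    with * obtain a \<rho> where a: "\<rho> > 0" "cvg \<rho> a" "\<And>y. y - x \<in> box0 \<rho> \<Longrightarrow> f y = evp a (y - x)"
      unfolding expands_def by blast
    have "((\<lambda>(i, j). ((fst y - fst x) ^ i * (snd y - snd x) ^ j) *\<^sub>R pcoeff a (i, j)) has_sum f y) UNIV"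
      if "y \<in> ball x \<rho>" for y
    proof -
      have y: "y - x \<in> box0 \<rho>" by (rule ball_subset_box0[OF that])
      then have "\<bar>fst (y - x)\<bar> \<le> \<rho>" "\<bar>snd (y - x)\<bar> \<le> \<rho>" by (auto simp: in_box0)
      from ev_has_sum[OF a(2) this] show ?thesis
        unfolding a(3)[OF y] evp_def by (simp add: case_prod_unfold mult_ac)
    qed
    with a(1) show "\<exists>a. \<exists>r>0. \<forall>y\<in>ball x r.
        ((\<lambda>(i, j). ((fst y - fst x) ^ i * (snd y - snd x) ^ j) *\<^sub>R a i j) has_sum f y) UNIV"
      by (intro exI[of _ "\<lambda>i j. pcoeff a (i, j)"]) blast
  qed
qed

lemma expands_conv: "expands f x a \<rho> \<Longrightarrow> conv a"
  unfolding expands_def conv_def by blast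

lemma expands_at: assumes "expands f x a \<rho>" shows "pcoeff a 0 = f x"
proof -
  have "x - x \<in> box0 \<rho>" using assms by (simp add: expands_def in_box0)
  then have "f x = evp a (x - x)" using assms unfolding expands_def by blast
  then show ?thesis by (simp add: evp_def ev_at_0)
qed

lemma box0_shift_open: "open {y. y - x \<in> box0 \<rho>}"
proof -
  have "{y. y - x \<in> box0 \<rho>} = (\<lambda>y. y - x) -` box0 \<rho>" by auto
  then show ?thesis by (auto intro!: continuous_intros open_vimage)
qed

lemma expands_has_derivative:
  assumes "expands f x a \<rho>" "y - x \<in> box0 \<rho>"
  shows "(f has_derivative (\<lambda>h. evp (dU a) (y - x) * fst h + evp (dV a) (y - x) * snd h)) (at y)"
proof -
  have "((\<lambda>z. evp a (z - x)) has_derivative (\<lambda>h. evp (dU a) (y - x) * fst h + evp (dV a) (y - x) * snd h)) (at y)"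
    using assms unfolding expands_def
    by (intro has_derivative_compose[OF _ evp_has_derivative, of "\<lambda>z. z - x", simplified]) (auto intro!: derivative_eq_intros)
  then show ?thesis
    by (rule has_derivative_transform_within_open[OF _ box0_shift_open[of x \<rho>]])
       (use assms in \<open>auto simp: expands_def\<close>)
qed

text \<open>Elements of the Banach algebra are a source of real analytic functions: it is enough to represent
the rescaled function on the square of radius one half.\<close>

lemma bser_expands:
  assumes r: "r > 0" and f: "\<And>u v. \<bar>u\<bar> < 1 / 2 \<Longrightarrow> \<bar>v\<bar> < 1 / 2 \<Longrightarrow> f (x + (r * u, r * v)) = evb u v C"
  shows "expands f x (unsc r r C) (r / 2)"
  unfolding expands_def
proof (intro conjI allI impI)
  show "cvg (r / 2) (unsc r r C)" unfolding unsc_def by (rule bounded_imp_cvg[OF bounded_Rep]) (use r in auto)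
  fix y assume y: "y - x \<in> box0 (r / 2)"
  have "f (x + (r * (fst (y - x) / r), r * (snd (y - x) / r))) = evb (fst (y - x) / r) (snd (y - x) / r) C"
    by (rule f) (use y r in \<open>auto simp: in_box0 abs_divide divide_less_eq\<close>)
  moreover have "x + (r * (fst (y - x) / r), r * (snd (y - x) / r)) = y"
    using r by (simp add: prod_eq_iff)
  ultimately show "f y = evp (unsc r r C) (y - x)"
    by (simp add: evp_def unsc_def ev_sc evb_def)
qed (use r in simp)

text \<open>After subtraction of the constant terms and rescaling, the two inner functions are elements of
small norm and may be substituted into the outer series.\<close>

lemma expands_compose:
  assumes b: "expands f (p, q) b \<rho>" and s: "expands s x a1 \<rho>1" "s x = p" and t: "expands t x a2 \<rho>2" "t x = q"
  shows "\<exists>c \<sigma>. expands (\<lambda>y. f (s y, t y)) x c \<sigma>"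
proof -
  define \<rho>0 where "\<rho>0 = min \<rho>1 \<rho>2"
  have \<rho>0: "\<rho>0 > 0" "expands s x a1 \<rho>0" "expands t x a2 \<rho>0"
    using s(1) t(1) unfolding \<rho>0_def by (auto simp: expands_def in_box0 intro: cvg_mono)
  define b1 where "b1 = a1 - cconst p"
  define b2 where "b2 = a2 - cconst q"
  have c: "cvg \<rho>0 b1" "cvg \<rho>0 b2"
    using \<rho>0 unfolding b1_def b2_def expands_def by (auto intro!: cvg_diff cvg_cconst)
  have z: "pcoeff b1 0 = 0" "pcoeff b2 0 = 0"
    using expands_at[OF s(1)] expands_at[OF t(1)] s t by (auto simp: b1_def b2_def pcoeff_cconst)
  define N where "N c = (\<Sum>\<^sub>\<infinity>p. \<bar>pcoeff c p\<bar> * \<rho>0 ^ (fst p + snd p))" for c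
  have N0: "N c \<ge> 0" for c unfolding N_def using \<rho>0 by (intro infsum_nonneg) auto
  have \<rho>: "\<rho> > 0" "cvg \<rho> b" using b by (auto simp: expands_def)
  define k where "k = min 1 (\<rho> / 2 / (N b1 + N b2 + 1))"
  have pos: "N b1 + N b2 + 1 > 0" using N0[of b1] N0[of b2] by simp
  have k: "0 < k" "k \<le> 1" using pos \<rho> by (auto simp: k_def)
  have "k \<le> \<rho> / 2 / (N b1 + N b2 + 1)" by (simp add: k_def)
  then have kN: "k * (N b1 + N b2 + 1) \<le> \<rho> / 2" unfolding pos_le_divide_eq[OF pos] .
  have "k * N b1 \<le> k * (N b1 + N b2 + 1)" "k * N b2 \<le> k * (N b1 + N b2 + 1)"
    using N0[of b1] N0[of b2] k by (auto intro!: mult_left_mono)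
  with kN have kN1: "k * N b1 \<le> \<rho> / 2" "k * N b2 \<le> \<rho> / 2" by linarith+
  define r where "r = k * \<rho>0"
  have r: "0 < r" "r \<le> \<rho>0" using k \<rho>0 by (auto simp: r_def mult_left_le_one_le)
  define S where "S = bsc r r b1"
  define T where "T = bsc r r b2"
  have bS: "bounded_ser (sc r r b1)" "bounded_ser (sc r r b2)" "bnorm (sc r r b1) \<le> k * N b1" "bnorm (sc r r b2) \<le> k * N b2"
    using bnorm_sc_small[OF c(1) z(1), of k r r] bnorm_sc_small[OF c(2) z(2), of k r r] k r \<rho>0
    unfolding N_def by (auto simp: r_def)
  have nS: "norm S \<le> \<rho> / 2" "norm T \<le> \<rho> / 2"
    using bS kN1 by (auto simp: S_def T_def norm_bsc)
  have val: "g (x + (r * u, r * v)) = g x + evb u v (bsc r r (a - cconst (g x)))"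
    if "expands g x a \<rho>0" "bounded_ser (sc r r (a - cconst (g x)))" "\<bar>u\<bar> < 1 / 2" "\<bar>v\<bar> < 1 / 2" for g a u v
  proof -
    have "\<bar>r * w\<bar> < \<rho>0" if "\<bar>w\<bar> < 1 / 2" for w
    proof -
      have "\<bar>r * w\<bar> = r * \<bar>w\<bar>" using r by (simp add: abs_mult)
      also have "\<dots> < r * 1" using that r by (intro mult_strict_left_mono) auto
      finally show ?thesis using r by simp
    qed
    then have in0: "\<bar>r * u\<bar> < \<rho>0" "\<bar>r * v\<bar> < \<rho>0" using that by auto
    then have "x + (r * u, r * v) - x \<in> box0 \<rho>0" by (simp add: in_box0)
    then have "g (x + (r * u, r * v)) = evp a (x + (r * u, r * v) - x)"
      using that(1) unfolding expands_def by blast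
    also have "\<dots> = ev a (r * u) (r * v)" by (simp add: evp_def)
    also have "\<dots> = g x + ev (a - cconst (g x)) (r * u) (r * v)"
      using ev_diff[of "r * u" \<rho>0 "r * v" a "cconst (g x)"] in0 that(1) cvg_cconst by (simp add: expands_def)
    also have "ev (a - cconst (g x)) (r * u) (r * v) = evb u v (bsc r r (a - cconst (g x)))"
      using that(2) by (simp add: evb_def Rep_bsc ev_sc flip: ev_sc)
    finally show ?thesis .
  qed
  have "f (s (x + (r * u, r * v)), t (x + (r * u, r * v))) = evb u v (subst_ser b S T)"
    if uv: "\<bar>u\<bar> < 1 / 2" "\<bar>v\<bar> < 1 / 2" for u v
  proof -
    have uv': "\<bar>u\<bar> \<le> 1 / 2" "\<bar>v\<bar> \<le> 1 / 2" using uv by auto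
    have "s (x + (r * u, r * v)) = p + evb u v S"
      using val[OF \<rho>0(2) _ uv] bS s(2) unfolding S_def b1_def by simp
    moreover have "t (x + (r * u, r * v)) = q + evb u v T"
      using val[OF \<rho>0(3) _ uv] bS t(2) unfolding T_def b2_def by simp
    moreover have "\<bar>evb u v S\<bar> < \<rho>" "\<bar>evb u v T\<bar> < \<rho>"
      using evb_le[OF uv', of S] evb_le[OF uv', of T] nS \<rho> by linarith+
    then have "(p + evb u v S, q + evb u v T) - (p, q) \<in> box0 \<rho>" by (simp add: in_box0)
    then have "f (p + evb u v S, q + evb u v T) = evp b ((p + evb u v S, q + evb u v T) - (p, q))"
      using b unfolding expands_def by blast
    then have "f (p + evb u v S, q + evb u v T) = ev b (evb u v S) (evb u v T)"
      by (simp add: evp_def)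
    moreover have "norm S \<le> \<rho>" "norm T \<le> \<rho>" using nS \<rho> by auto
    then have "evb u v (subst_ser b S T) = ev b (evb u v S) (evb u v T)"
      by (rule evb_subst_ser[OF \<rho>(2) _ _ uv'])
    ultimately show ?thesis by simp
  qed
  from bser_expands[OF r(1), of "\<lambda>y. f (s y, t y)", OF this] show ?thesis by blast
qed

definition varU :: ser2 where "varU = Abs_fps (\<lambda>j. Abs_fps (\<lambda>i. if i = 1 \<and> j = 0 then 1 else 0))"

lemma pcoeff_varU: "pcoeff varU p = (if p = (1, 0) then 1 else 0)"
  by (cases p) (auto simp: varU_def pcoeff_def)

lemma ev_varU: "ev varU u v = u"
proof -
  have "((\<lambda>p. pcoeff varU p * (u ^ fst p * v ^ snd p)) has_sum u) UNIV"
    by (rule has_sum_finite_neutralI[where B = "{(1, 0)}"]) (auto simp: pcoeff_varU)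
  then show ?thesis unfolding ev_def by (rule infsumI)
qed

lemma cvg_varU: "cvg \<rho> varU"
  unfolding cvg_def
  by (rule has_sum_imp_summable, rule has_sum_finite_neutralI[where B = "{(1, 0)}"]) (auto simp: pcoeff_varU)

lemma expands_affine: "expands (\<lambda>y. c + \<alpha> * fst y + \<beta> * snd y) x
    (cconst (c + \<alpha> * fst x + \<beta> * snd x) + cconst \<alpha> * varU + cconst \<beta> * swp varU) 1"
  unfolding expands_def
proof (intro conjI allI impI)
  let ?A = "cconst (c + \<alpha> * fst x + \<beta> * snd x)"
  have cc: "cvg 1 ?A" "cvg 1 (cconst \<alpha> * varU)" "cvg 1 (cconst \<beta> * swp varU)" "cvg 1 (?A + cconst \<alpha> * varU)"
    by (simp_all add: cvg_add cvg_mult cvg_cconst cvg_varU)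
  show "cvg 1 (?A + cconst \<alpha> * varU + cconst \<beta> * swp varU)" using cc by (simp add: cvg_add)
  fix y assume "y - x \<in> box0 1"
  then have y: "\<bar>fst (y - x)\<bar> \<le> 1" "\<bar>snd (y - x)\<bar> \<le> 1" by (auto simp: in_box0)
  show "c + \<alpha> * fst y + \<beta> * snd y = evp (?A + cconst \<alpha> * varU + cconst \<beta> * swp varU) (y - x)"
    unfolding evp_def ev_add[OF y cc(4,3)] ev_add[OF y cc(1,2)]
    unfolding ev_cmult ev_swp ev_varU by (simp add: algebra_simps)
qed simp

text \<open>A sum of a power series is analytic at every point of its box, not just at the centre: this is the
substitution of \<open>d + rU\<close> for a variable, an element of norm at most \<open>|d| + r\<close>.\<close>

lemma expands_translate:
  assumes a: "expands f x a \<rho>" and x': "x' - x \<in> box0 \<rho>"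
  shows "\<exists>c \<sigma>. expands f x' c \<sigma>"
proof -
  define d where "d = x' - x"
  have d: "\<bar>fst d\<bar> < \<rho>" "\<bar>snd d\<bar> < \<rho>" using x' by (auto simp: d_def in_box0)
  define r where "r = \<rho> - max \<bar>fst d\<bar> \<bar>snd d\<bar>"
  have r: "r > 0" "\<bar>fst d\<bar> + r \<le> \<rho>" "\<bar>snd d\<bar> + r \<le> \<rho>" using d by (auto simp: r_def max_def)
  have bu: "bounded_ser varU" "bnorm varU \<le> 1" "bounded_ser (swp varU)" "bnorm (swp varU) \<le> 1"
  proof -
    have 1: "((\<lambda>p. \<bar>pcoeff varU p\<bar> * wgt p) has_sum 1) UNIV"
      by (rule has_sum_finite_neutralI[where B = "{(1, 0)}"]) (auto simp: pcoeff_varU wgt_def)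
    have 2: "((\<lambda>p. \<bar>pcoeff (swp varU) p\<bar> * wgt p) has_sum 1) UNIV"
      by (rule has_sum_finite_neutralI[where B = "{(0, 1)}"]) (auto simp: pcoeff_varU wgt_def)
    show "bounded_ser varU" "bnorm varU \<le> 1" "bounded_ser (swp varU)" "bnorm (swp varU) \<le> 1"
      unfolding bounded_ser_def bnorm_def using 1 2 by (auto simp: has_sum_imp_summable infsumI)
  qed
  define S where "S = of_real (fst d) + r *\<^sub>R Abs_bser varU"
  define T where "T = of_real (snd d) + r *\<^sub>R Abs_bser (swp varU)"
  have n1: "norm (Abs_bser varU) \<le> 1" "norm (Abs_bser (swp varU)) \<le> 1"
    using bu by (simp_all add: norm_bser.rep_eq Abs_bser_inverse)
  have nS: "norm S \<le> \<rho>" "norm T \<le> \<rho>"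
  proof -
    have "norm S \<le> \<bar>fst d\<bar> + r * 1" unfolding S_def using n1 r
      by (intro order_trans[OF norm_triangle_ineq]) (simp add: mult_left_le)
    then show "norm S \<le> \<rho>" using r by simp
    have "norm T \<le> \<bar>snd d\<bar> + r * 1" unfolding T_def using n1 r
      by (intro order_trans[OF norm_triangle_ineq]) (simp add: mult_left_le)
    then show "norm T \<le> \<rho>" using r by simp
  qed
  have eS: "evb u v S = fst d + r * u" "evb u v T = snd d + r * v" if "\<bar>u\<bar> \<le> 1 / 2" "\<bar>v\<bar> \<le> 1 / 2" for u v
    unfolding S_def T_def evb_add[OF that] evb_scaleR[OF that]
    using bu by (simp_all add: evb_def Rep_of_real Abs_bser_inverse ev_varU ev_swp)
  have "f (x' + (r * u, r * v)) = evb u v (subst_ser a S T)" if uv: "\<bar>u\<bar> < 1 / 2" "\<bar>v\<bar> < 1 / 2" for u v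
  proof -
    have uv': "\<bar>u\<bar> \<le> 1 / 2" "\<bar>v\<bar> \<le> 1 / 2" using uv by auto
    have lt: "\<bar>c + r * w\<bar> < \<rho>" if "\<bar>w\<bar> < 1 / 2" "\<bar>c\<bar> + r \<le> \<rho>" for c w
    proof -
      have "\<bar>r * w\<bar> = r * \<bar>w\<bar>" using r by (simp add: abs_mult)
      also have "\<dots> < r * 1" using that r by (intro mult_strict_left_mono) auto
      finally show ?thesis using that by linarith
    qed
    have eq: "x' + (r * u, r * v) - x = (fst d + r * u, snd d + r * v)" by (simp add: d_def prod_eq_iff)
    have "x' + (r * u, r * v) - x \<in> box0 \<rho>"
      unfolding eq using lt[OF uv(1) r(2)] lt[OF uv(2) r(3)] by (simp add: in_box0)
    then have "f (x' + (r * u, r * v)) = evp a (x' + (r * u, r * v) - x)"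
      using a unfolding expands_def by blast
    then have "f (x' + (r * u, r * v)) = ev a (fst d + r * u) (snd d + r * v)"
      unfolding eq by (simp add: evp_def)
    also have "\<dots> = evb u v (subst_ser a S T)"
      using a evb_subst_ser[OF _ nS uv'] eS[OF uv'] unfolding expands_def by simp
    finally show ?thesis .
  qed
  from bser_expands[OF r(1) this] show ?thesis by blast
qed

lemma expands_analytic_on:
  assumes "expands f x a \<rho>" shows "real_analytic_on f {y. y - x \<in> box0 \<rho>}"
  unfolding real_analytic_on_real_iff using expands_translate[OF assms] by blast

lemma real_analytic_on_bounded_linear:
  assumes "bounded_linear \<phi>" "real_analytic_on f S" shows "real_analytic_on (\<lambda>x. \<phi> (f x)) S"
  unfolding real_analytic_on_def
proof
  interpret bounded_linear \<phi> by fact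
  fix x assume "x \<in> S"
  with assms(2) obtain c r where r: "r > 0" "\<And>y. y \<in> ball x r \<Longrightarrow>
      ((\<lambda>(i, j). ((fst y - fst x) ^ i * (snd y - snd x) ^ j) *\<^sub>R c i j) has_sum f y) UNIV"
    unfolding real_analytic_on_def by blast
  have "((\<lambda>(i, j). ((fst y - fst x) ^ i * (snd y - snd x) ^ j) *\<^sub>R \<phi> (c i j)) has_sum \<phi> (f y)) UNIV"
    if "y \<in> ball x r" for y
    using has_sum_bounded_linear[OF assms(1) r(2)[OF that]] by (simp add: case_prod_unfold scaleR)
  with r(1) show "\<exists>a. \<exists>r>0. \<forall>y\<in>ball x r.
      ((\<lambda>(i, j). ((fst y - fst x) ^ i * (snd y - snd x) ^ j) *\<^sub>R a i j) has_sum \<phi> (f y)) UNIV"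
    by (intro exI[of _ "\<lambda>i j. \<phi> (c i j)"]) blast
qed

lemma real_analytic_on_add:
  assumes "real_analytic_on f S" "real_analytic_on g S" shows "real_analytic_on (\<lambda>x. f x + g x) S"
  unfolding real_analytic_on_def
proof
  fix x assume "x \<in> S"
  obtain c r where r: "r > 0" "\<And>y. y \<in> ball x r \<Longrightarrow>
      ((\<lambda>(i, j). ((fst y - fst x) ^ i * (snd y - snd x) ^ j) *\<^sub>R c i j) has_sum f y) UNIV"
    using assms(1) \<open>x \<in> S\<close> unfolding real_analytic_on_def by blast
  obtain d s where s: "s > 0" "\<And>y. y \<in> ball x s \<Longrightarrow>
      ((\<lambda>(i, j). ((fst y - fst x) ^ i * (snd y - snd x) ^ j) *\<^sub>R d i j) has_sum g y) UNIV"
    using assms(2) \<open>x \<in> S\<close> unfolding real_analytic_on_def by blast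
  have "((\<lambda>(i, j). ((fst y - fst x) ^ i * (snd y - snd x) ^ j) *\<^sub>R (c i j + d i j)) has_sum f y + g y) UNIV"
    if "y \<in> ball x (min r s)" for y
    using has_sum_add[OF r(2) s(2), of y] that by (simp add: case_prod_unfold scaleR_add_right)
  with r(1) s(1) show "\<exists>a. \<exists>r>0. \<forall>y\<in>ball x r.
      ((\<lambda>(i, j). ((fst y - fst x) ^ i * (snd y - snd x) ^ j) *\<^sub>R a i j) has_sum f y + g y) UNIV"
    by (intro exI[of _ "\<lambda>i j. c i j + d i j"] exI[of _ "min r s"]) simp
qed

lemma real_analytic_on_subset: "real_analytic_on f S \<Longrightarrow> T \<subseteq> S \<Longrightarrow> real_analytic_on f T"
  unfolding real_analytic_on_def by blast

lemma real_analytic_on_cong: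
  assumes "real_analytic_on f S" "open S" "\<And>x. x \<in> S \<Longrightarrow> f x = g x" shows "real_analytic_on g S"
  unfolding real_analytic_on_def
proof
  fix x assume x: "x \<in> S"
  with assms obtain c r where r: "r > 0" "\<And>y. y \<in> ball x r \<Longrightarrow>
      ((\<lambda>(i, j). ((fst y - fst x) ^ i * (snd y - snd x) ^ j) *\<^sub>R c i j) has_sum f y) UNIV"
    unfolding real_analytic_on_def by blast
  obtain s where s: "s > 0" "ball x s \<subseteq> S" using assms(2) x open_contains_ball by blast
  show "\<exists>a. \<exists>r>0. \<forall>y\<in>ball x r.
      ((\<lambda>(i, j). ((fst y - fst x) ^ i * (snd y - snd x) ^ j) *\<^sub>R a i j) has_sum g y) UNIV"
  proof (intro exI conjI ballI)
    show "min r s > 0" using r s by simp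
    fix y assume "y \<in> ball x (min r s)"
    then have "y \<in> ball x r" "y \<in> S" using s(2) by auto
    with assms(3) have "y \<in> ball x r" "f y = g y" by blast+
    then show "((\<lambda>(i, j). ((fst y - fst x) ^ i * (snd y - snd x) ^ j) *\<^sub>R c i j) has_sum g y) UNIV"
      using r(2)[of y] by simp
  qed
qed

lemma vec3_axis_sum: "x = x $ 1 *\<^sub>R axis 1 1 + x $ 2 *\<^sub>R axis 2 1 + x $ 3 *\<^sub>R axis 3 1" for x :: "real ^ 3"
  by (simp add: vec_eq_iff forall_3 axis_def)

lemma real_analytic_on_vec3:
  fixes f :: "real \<times> real \<Rightarrow> real ^ 3"
  assumes "\<And>i. real_analytic_on (\<lambda>x. f x $ i) S" shows "real_analytic_on f S"
proof -
  have "real_analytic_on (\<lambda>x. f x $ 1 *\<^sub>R axis 1 1 + f x $ 2 *\<^sub>R axis 2 1 + f x $ 3 *\<^sub>R (axis 3 1 :: real ^ 3)) S"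
    by (intro real_analytic_on_add real_analytic_on_bounded_linear[OF bounded_linear_scaleR_left] assms)
  then show ?thesis by (simp flip: vec3_axis_sum)
qed

lemma real_analytic_on_compose_real:
  fixes f :: "real \<times> real \<Rightarrow> real" and T :: "real \<times> real \<Rightarrow> real \<times> real"
  assumes f: "real_analytic_on f V" and T: "real_analytic_on T S" "T ` S \<subseteq> V"
  shows "real_analytic_on (\<lambda>x. f (T x)) S"
  unfolding real_analytic_on_real_iff
proof
  fix x assume x: "x \<in> S"
  have T1: "real_analytic_on (\<lambda>x. fst (T x)) S" "real_analytic_on (\<lambda>x. snd (T x)) S"
    by (rule real_analytic_on_bounded_linear[OF _ T(1)], rule bounded_linear_fst bounded_linear_snd)+
  have "T x \<in> V" using T x by auto
  then obtain b \<rho> where "expands f (fst (T x), snd (T x)) b \<rho>"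
    using f unfolding real_analytic_on_real_iff by auto
  moreover obtain a1 r1 a2 r2 where "expands (\<lambda>x. fst (T x)) x a1 r1" "expands (\<lambda>x. snd (T x)) x a2 r2"
    using T1 x unfolding real_analytic_on_real_iff by blast
  ultimately show "\<exists>a \<rho>. expands (\<lambda>x. f (T x)) x a \<rho>"
    using expands_compose[of f "fst (T x)" "snd (T x)" b \<rho> "\<lambda>x. fst (T x)" x a1 r1 "\<lambda>x. snd (T x)" a2 r2]
    by simp
qed

lemma real_analytic_on_compose:
  fixes F :: "real \<times> real \<Rightarrow> real ^ 3" and T :: "real \<times> real \<Rightarrow> real \<times> real"
  assumes "real_analytic_on F V" "real_analytic_on T S" "T ` S \<subseteq> V"
  shows "real_analytic_on (\<lambda>x. F (T x)) S"
  by (intro real_analytic_on_vec3 real_analytic_on_compose_real[OF _ assms(2,3)]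
      real_analytic_on_bounded_linear[OF bounded_linear_vec_nth assms(1)])

lemma real_analytic_on_affine_pair:
  "real_analytic_on (\<lambda>y. (c1 + \<alpha>1 * fst y + \<beta>1 * snd y, c2 + \<alpha>2 * fst y + \<beta>2 * snd y)) S"
proof -
  have a: "real_analytic_on (\<lambda>y. c + \<alpha> * fst y + \<beta> * snd y) S" for c \<alpha> \<beta>
    unfolding real_analytic_on_real_iff using expands_affine by blast
  have "real_analytic_on (\<lambda>y. (c1 + \<alpha>1 * fst y + \<beta>1 * snd y) *\<^sub>R (1 :: real, 0 :: real)
      + (c2 + \<alpha>2 * fst y + \<beta>2 * snd y) *\<^sub>R (0 :: real, 1 :: real)) S"
    by (intro real_analytic_on_add real_analytic_on_bounded_linear[OF bounded_linear_scaleR_left a])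
  then show ?thesis by simp
qed

lemma real_analytic_on_imp_differentiable:
  fixes f :: "real \<times> real \<Rightarrow> real"
  assumes "real_analytic_on f S" "x \<in> S" shows "f differentiable (at x)"
proof -
  obtain a \<rho> where a: "expands f x a \<rho>" using assms unfolding real_analytic_on_real_iff by blast
  then have "x - x \<in> box0 \<rho>" by (simp add: expands_def in_box0)
  from expands_has_derivative[OF a this] show ?thesis by (rule differentiableI)
qed

lemma real_analytic_on_prod_differentiable:
  fixes f :: "real \<times> real \<Rightarrow> real \<times> real"
  assumes "real_analytic_on f S" "x \<in> S" shows "f differentiable (at x)"
proof -
  have "(\<lambda>x. fst (f x)) differentiable (at x)" "(\<lambda>x. snd (f x)) differentiable (at x)"
    by (rule real_analytic_on_imp_differentiable[OF real_analytic_on_bounded_linear[OF _ assms(1)] assms(2)],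
        rule bounded_linear_fst bounded_linear_snd)+
  then have "(\<lambda>x. (fst (f x), snd (f x))) differentiable (at x)"
    unfolding differentiable_def using has_derivative_Pair by blast
  then show ?thesis by simp
qed

section \<open>Surfaces over coordinates in normal form\<close>

definition lor :: "'a::comm_ring_1 ^ 3 \<Rightarrow> 'a ^ 3 \<Rightarrow> 'a" where
  "lor x y = x $ 1 * y $ 1 + x $ 2 * y $ 2 - x $ 3 * y $ 3"

text \<open>The linear change of coordinates from \<open>x\<^sub>1\<^sup>2 + x\<^sub>2x\<^sub>3\<close> to the standard form.\<close>

definition from_iso :: "ser2 ^ 3 \<Rightarrow> ser2 ^ 3" where
  "from_iso x = vector [x $ 1, half * (x $ 2 + x $ 3), half * (x $ 2 - x $ 3)]"

lemma lor_from_iso: "lor (from_iso x) (from_iso y) = iso half x y"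
proof -
  have hh: "half * (half * c) + half * (half * c) = half * c" for c
    using half_mult by (metis distrib_left)
  have "lor (from_iso x) (from_iso y) = x $ 1 * y $ 1
      + (half * (half * (x $ 2 * y $ 3 + x $ 3 * y $ 2)) + half * (half * (x $ 2 * y $ 3 + x $ 3 * y $ 2)))"
    by (simp add: lor_def from_iso_def algebra_simps)
  then show ?thesis unfolding hh by (simp add: iso_def)
qed

lemma formal_lorentz_realization:
  assumes E: "conv E" "pcoeff E 0 = 1" and F: "conv F" "pcoeff F 0 = 0" and G: "conv G" "pcoeff G 0 = 0"
    and A: "pcoeff (dU F) 0 - pcoeff (dV E) 0 / 2 \<noteq> 0"
  shows "\<exists>f :: ser2 ^ 3. (\<forall>i. conv (f $ i)) \<and>
    lor (cmap dU f) (cmap dU f) = E \<and> lor (cmap dU f) (cmap dV f) = F \<and>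
    lor (cmap dV f) (cmap dV f) = G \<and>
    (\<forall>i. pcoeff (dU (f $ i)) 0 = vector [0, 1, 0] $ i) \<and>
    (\<forall>i. pcoeff (dV (f $ i)) 0 = vector [1, 0, 1] $ i)"
proof -
  obtain f :: "ser2 ^ 3" where f: "\<forall>i. conv (f $ i)" "iso half (cmap dU f) (cmap dU f) = E"
    "iso half (cmap dU f) (cmap dV f) = F" "iso half (cmap dV f) (cmap dV f) = G"
    "\<forall>i. pcoeff (dU (f $ i)) 0 = vector [0, 1, 1] $ i" "\<forall>i. pcoeff (dV (f $ i)) 0 = vector [1, 1, - 1] $ i"
    using formal_realization[OF E F G A] by (elim exE conjE) blast
  have d: "cmap dU (from_iso f) = from_iso (cmap dU f)" "cmap dV (from_iso f) = from_iso (cmap dV f)"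
    by (simp_all add: from_iso_def vec_eq_iff forall_3 dU_simps dV_simps)
  show ?thesis
  proof (intro exI conjI)
    show "lor (cmap dU (from_iso f)) (cmap dU (from_iso f)) = E"
      "lor (cmap dU (from_iso f)) (cmap dV (from_iso f)) = F"
      "lor (cmap dV (from_iso f)) (cmap dV (from_iso f)) = G"
      unfolding d lor_from_iso by (fact f)+
    show "\<forall>i. conv (from_iso f $ i)" using f(1) by (simp add: forall_3 from_iso_def conv_intros)
    show "\<forall>i. pcoeff (dU (from_iso f $ i)) 0 = vector [0, 1, 0] $ i"
      "\<forall>i. pcoeff (dV (from_iso f $ i)) 0 = vector [1, 0, 1] $ i"
      using f(5,6) by (simp_all add: forall_3 from_iso_def dU_simps dV_simps)
  qed
qed

lemma evp_mult: "cvg \<rho> a \<Longrightarrow> cvg \<rho> b \<Longrightarrow> y \<in> box0 \<rho> \<Longrightarrow> evp (a * b) y = evp a y * evp b y"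
  and evp_add: "cvg \<rho> a \<Longrightarrow> cvg \<rho> b \<Longrightarrow> y \<in> box0 \<rho> \<Longrightarrow> evp (a + b) y = evp a y + evp b y"
  and evp_diff: "cvg \<rho> a \<Longrightarrow> cvg \<rho> b \<Longrightarrow> y \<in> box0 \<rho> \<Longrightarrow> evp (a - b) y = evp a y - evp b y"
  unfolding evp_def by (intro ev_mult ev_add ev_diff; simp add: in_box0)+

lemma evp_lor:
  assumes "\<And>i. cvg \<rho> (x $ i)" "\<And>i. cvg \<rho> (y $ i)" "p \<in> box0 \<rho>"
  shows "evp (lor x y) p = lor (cmap (\<lambda>a. evp a p) x) (cmap (\<lambda>a. evp a p) y)"
proof -
  have "\<rho> \<ge> 0" using assms(3) by (auto simp: in_box0)
  then have "cvg \<rho> (x $ i * y $ i)" for i using assms cvg_mult by blast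
  then have c: "cvg \<rho> (x $ 1 * y $ 1)" "cvg \<rho> (x $ 2 * y $ 2)" "cvg \<rho> (x $ 3 * y $ 3)" "cvg \<rho> (x $ 1 * y $ 1 + x $ 2 * y $ 2)"
    using \<open>\<rho> \<ge> 0\<close> by (auto intro: cvg_add)
  show ?thesis
    unfolding lor_def evp_diff[OF c(4,3) assms(3)] evp_add[OF c(1,2) assms(3)] evp_mult[OF assms(1,2,3)] cmap_nth ..
qed

lemma evp_0: "evp a 0 = pcoeff a 0" by (simp add: evp_def ev_at_0)

lemma ball_subset_box: "ball 0 r \<subseteq> box0 r"
  using ball_subset_box0[of _ 0 r] by auto

text \<open>At the origin the differential is \<open>(u, v) \<mapsto> (v, u, v)\<close>, which has a linear left inverse; the inverse
function theorem gives injectivity nearby.  Immersivity is read off from the first two components: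
it cannot be inferred from the first fundamental form, which may be degenerate.\<close>

lemma normal_form_surface:
  assumes E: "conv E" "pcoeff E 0 = 1" and F: "conv F" "pcoeff F 0 = 0" and G: "conv G" "pcoeff G 0 = 0"
    and A: "pcoeff (dU F) 0 - pcoeff (dV E) 0 / 2 \<noteq> 0"
  shows "\<exists>\<Phi> \<Phi>' r. r > 0 \<and> real_analytic_on (\<Phi> :: real \<times> real \<Rightarrow> real ^ 3) (ball 0 r) \<and> inj_on \<Phi> (ball 0 r) \<and>
    (\<forall>y\<in>ball 0 r. (\<Phi> has_derivative \<Phi>' y) (at y) \<and> inj (\<Phi>' y) \<and>
       (\<forall>a b. lorentz (\<Phi>' y a) (\<Phi>' y b) = fst a * fst b * evp E y
          + (fst a * snd b + snd a * fst b) * evp F y + snd a * snd b * evp G y))"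
proof -
  obtain f :: "ser2 ^ 3" where f: "\<And>i. conv (f $ i)" "lor (cmap dU f) (cmap dU f) = E"
    "lor (cmap dU f) (cmap dV f) = F" "lor (cmap dV f) (cmap dV f) = G"
    "\<And>i. pcoeff (dU (f $ i)) 0 = vector [0, 1, 0] $ i" "\<And>i. pcoeff (dV (f $ i)) 0 = vector [1, 0, 1] $ i"
    using formal_lorentz_realization[OF E F G A] by (elim exE conjE) blast
  have "\<exists>\<rho>>0. \<forall>a\<in>range (($) f) \<union> range (($) (cmap dU f)) \<union> range (($) (cmap dV f)). cvg \<rho> a"
    by (rule conv_common) (use f(1) in \<open>auto intro: conv_dU conv_dV\<close>)
  then obtain \<rho> where \<rho>: "\<rho> > 0" and "\<forall>a\<in>range (($) f) \<union> range (($) (cmap dU f)) \<union> range (($) (cmap dV f)). cvg \<rho> a"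
    by blast
  then have c: "cvg \<rho> (f $ i)" "cvg \<rho> (cmap dU f $ i)" "cvg \<rho> (cmap dV f $ i)" for i by blast+
  define \<Phi> :: "real \<times> real \<Rightarrow> real ^ 3" where "\<Phi> y = cmap (\<lambda>a. evp a y) f" for y
  define U where "U y = cmap (\<lambda>a. evp a y) (cmap dU f)" for y
  define V where "V y = cmap (\<lambda>a. evp a y) (cmap dV f)" for y
  define \<Phi>' where "\<Phi>' y h = fst h *\<^sub>R U y + snd h *\<^sub>R V y" for y and h :: "real \<times> real"
  have der: "(\<Phi> has_derivative \<Phi>' y) (at y)" if "y \<in> box0 \<rho>" for y
  proof (subst has_derivative_componentwise_within, rule ballI)
    fix e :: "real ^ 3" assume "e \<in> Basis"
    then obtain i where e: "e = axis i 1" by (auto simp: Basis_vec_def)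
    show "((\<lambda>x. \<Phi> x \<bullet> e) has_derivative (\<lambda>h. \<Phi>' y h \<bullet> e)) (at y)"
      using evp_has_derivative[OF c(1) that, of i]
      by (simp add: e inner_axis \<Phi>_def \<Phi>'_def U_def V_def mult.commute)
  qed
  have lor: "lor (U y) (U y) = evp E y" "lor (U y) (V y) = evp F y" "lor (V y) (V y) = evp G y" if "y \<in> box0 \<rho>" for y
    unfolding U_def V_def f(2-4)[symmetric] using c that by (intro evp_lor[symmetric]; simp)+
  have cont: "continuous_on (box0 \<rho>) U" "continuous_on (box0 \<rho>) V"
    unfolding U_def[abs_def] V_def[abs_def] cmap_def[of "\<lambda>a. evp a _"]
    using continuous_on_evp[OF c(2)] continuous_on_evp[OF c(3)] by (auto intro!: continuous_on_vec_lambda)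
  have at0: "U 0 = vector [0, 1, 0]" "V 0 = vector [1, 0, 1]"
    by (simp_all add: U_def V_def vec_eq_iff evp_0 f)
  have 0: "(0 :: real \<times> real) \<in> box0 \<rho>" using \<rho> by (simp add: in_box0)
  have "\<exists>r>0. ball 0 r \<subseteq> box0 \<rho> \<and> inj_on \<Phi> (ball 0 r)"
  proof -
    let ?g = "\<lambda>z :: real ^ 3. (z $ 2, z $ 1)"
    have "\<exists>r>0. ball 0 r \<subseteq> box0 \<rho> \<and> inj_on \<Phi> (ball 0 r)"
    proof (rule has_derivative_locally_injective[OF 0 open_box0, of ?g \<Phi>' \<Phi>])
      show "bounded_linear ?g" by (intro bounded_linear_Pair bounded_linear_vec_nth)
      show "?g \<circ> \<Phi>' 0 = id" by (auto simp: fun_eq_iff \<Phi>'_def at0)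
      show "(\<Phi> has_derivative \<Phi>' x) (at x)" if "x \<in> box0 \<rho>" for x by (rule der[OF that])
      fix e :: real assume "e > 0"
      define \<kappa> where "\<kappa> x = norm (U x - U 0) + norm (V x - V 0)" for x
      have "continuous_on (box0 \<rho>) \<kappa>" unfolding \<kappa>_def[abs_def] by (intro continuous_intros cont)
      then have "isCont \<kappa> 0" using 0 by (simp add: continuous_on_eq_continuous_at)
      then have "\<exists>d>0. \<forall>x. dist x 0 < d \<longrightarrow> dist (\<kappa> x) (\<kappa> 0) < e"
        using \<open>e > 0\<close> unfolding continuous_at_eps_delta dist_norm by (simp add: continuous_at dist_norm LIM_def)
      then obtain d where d: "d > 0" "\<And>x. dist x 0 < d \<Longrightarrow> dist (\<kappa> x) (\<kappa> 0) < e" by blast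
      have "onorm (\<lambda>v. \<Phi>' x v - \<Phi>' 0 v) < e" if "dist 0 x < d" for x
      proof -
        have "onorm (\<lambda>v. \<Phi>' x v - \<Phi>' 0 v) \<le> \<kappa> x"
        proof (rule onorm_le)
          fix v :: "real \<times> real"
          have "\<Phi>' x v - \<Phi>' 0 v = fst v *\<^sub>R (U x - U 0) + snd v *\<^sub>R (V x - V 0)"
            by (simp add: \<Phi>'_def algebra_simps)
          also have "norm \<dots> \<le> \<bar>fst v\<bar> * norm (U x - U 0) + \<bar>snd v\<bar> * norm (V x - V 0)"
            by (rule order_trans[OF norm_triangle_ineq]) simp
          also have "\<dots> \<le> norm v * norm (U x - U 0) + norm v * norm (V x - V 0)"
            by (intro add_mono mult_right_mono abs_fst_snd_le) auto
          finally show "norm (\<Phi>' x v - \<Phi>' 0 v) \<le> \<kappa> x * norm v" by (simp add: \<kappa>_def algebra_simps)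
        qed
        also have "\<kappa> x < e" using d(2)[of x] that by (simp add: \<kappa>_def dist_commute dist_real_def)
        finally show ?thesis .
      qed
      with d(1) show "\<exists>d>0. \<forall>x. dist 0 x < d \<longrightarrow> onorm (\<lambda>v. \<Phi>' x v - \<Phi>' 0 v) < e" by blast
    qed blast
    then show ?thesis .
  qed
  then obtain r where r: "r > 0" "ball 0 r \<subseteq> box0 \<rho>" "inj_on \<Phi> (ball 0 r)" by blast
  \<comment> \<open>the Jacobian of the first two components\<close>
  define J where "J y = U y $ 2 * V y $ 1 - U y $ 1 * V y $ 2" for y
  have "continuous_on (box0 \<rho>) J" unfolding J_def[abs_def] by (intro continuous_intros cont)
  then have "isCont J 0" using 0 by (simp add: continuous_on_eq_continuous_at)
  moreover have "J 0 \<noteq> 0" by (simp add: J_def at0)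
  ultimately have "\<forall>\<^sub>F y in at 0. J y \<noteq> 0"
    unfolding isCont_def by (rule tendsto_imp_eventually_ne)
  then obtain s where s: "s > 0" "\<And>y. y \<noteq> 0 \<Longrightarrow> dist y 0 < s \<Longrightarrow> J y \<noteq> 0"
    unfolding eventually_at by blast
  have J: "J y \<noteq> 0" if "y \<in> ball 0 s" for y
    using s(2)[of y] that \<open>J 0 \<noteq> 0\<close> by (cases "y = 0") (auto simp: dist_commute)
  have imm: "inj (\<Phi>' y)" if "y \<in> ball 0 s" for y
  proof (rule injI)
    fix a b assume "\<Phi>' y a = \<Phi>' y b"
    then have "fst (a - b) * U y $ i + snd (a - b) * V y $ i = 0" for i
      by (auto simp: \<Phi>'_def vec_eq_iff algebra_simps dest: spec[of _ i])
    from this[of 1] this[of 2] have "fst (a - b) * J y = 0" "snd (a - b) * J y = 0"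
      unfolding J_def by algebra+
    then show "a = b" using J[OF that] by (auto simp: prod_eq_iff)
  qed
  have an: "real_analytic_on \<Phi> (box0 \<rho>)"
  proof (rule real_analytic_on_vec3)
    fix i
    have "expands (evp (f $ i)) 0 (f $ i) \<rho>" using \<rho> c(1) by (simp add: expands_def)
    from expands_analytic_on[OF this] show "real_analytic_on (\<lambda>x. \<Phi> x $ i) (box0 \<rho>)"
      by (simp add: \<Phi>_def)
  qed
  show ?thesis
  proof (intro exI conjI ballI allI)
    show "min r s > 0" using r s by simp
    show "real_analytic_on \<Phi> (ball 0 (min r s))" by (rule real_analytic_on_subset[OF an]) (use r in auto)
    show "inj_on \<Phi> (ball 0 (min r s))" by (rule inj_on_subset[OF r(3)]) auto
    fix y :: "real \<times> real" assume "y \<in> ball 0 (min r s)"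
    then have y: "y \<in> box0 \<rho>" "y \<in> ball 0 s" using r by auto
    show "(\<Phi> has_derivative \<Phi>' y) (at y)" by (rule der[OF y(1)])
    show "inj (\<Phi>' y)" by (rule imm[OF y(2)])
    fix a b :: "real \<times> real"
    have "lorentz (\<Phi>' y a) (\<Phi>' y b) = fst a * fst b * lor (U y) (U y)
        + (fst a * snd b + snd a * fst b) * lor (U y) (V y) + snd a * snd b * lor (V y) (V y)"
      by (simp add: lorentz_def lor_def \<Phi>'_def algebra_simps)
    then show "lorentz (\<Phi>' y a) (\<Phi>' y b) = fst a * fst b * evp E y
          + (fst a * snd b + snd a * fst b) * evp F y + snd a * snd b * evp G y"
      by (simp add: lor[OF y(1)])
  qed
qed

section \<open>Symmetric bilinear forms in the plane\<close>

definition sym_form :: "form2 \<Rightarrow> bool" where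
  "sym_form b \<longleftrightarrow> bilinear b \<and> (\<forall>w z. b w z = b z w)"

lemma sym_form_expand:
  assumes "sym_form b"
  shows "b w z = fst w * fst z * b (1, 0) (1, 0) + (fst w * snd z + snd w * fst z) * b (1, 0) (0, 1)
    + snd w * snd z * b (0, 1) (0, 1)"
proof -
  have bi: "bilinear b" and sym: "b (0, 1) (1, 0) = b (1, 0) (0, 1)" using assms by (auto simp: sym_form_def)
  have "b w z = b (fst w *\<^sub>R (1, 0) + snd w *\<^sub>R (0, 1)) (fst z *\<^sub>R (1, 0) + snd z *\<^sub>R (0, 1))" by simp
  also have "\<dots> = fst w * fst z * b (1, 0) (1, 0) + (fst w * snd z + snd w * fst z) * b (1, 0) (0, 1)
    + snd w * snd z * b (0, 1) (0, 1)"
    unfolding bilinear_ladd[OF bi] bilinear_radd[OF bi] bilinear_lmul[OF bi] bilinear_rmul[OF bi] sym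
    by (simp add: algebra_simps)
  finally show ?thesis .
qed

lemma sym_form_add_scale:
  assumes "sym_form b"
  shows "b (w + w') z = b w z + b w' z" "b z (w + w') = b z w + b z w'"
    "b (c *\<^sub>R w) z = c * b w z" "b z (c *\<^sub>R w) = c * b z w"
  using assms unfolding sym_form_def
  by (simp_all add: bilinear_ladd bilinear_radd bilinear_lmul bilinear_rmul)

definition gram :: "form2 \<Rightarrow> real" where
  "gram b = b (1, 0) (1, 0) * b (0, 1) (0, 1) - (b (1, 0) (0, 1))\<^sup>2"

lemma discr_gram: "discr h x = gram (h x)"
  by (simp add: discr_def gram_def comp_E_def comp_F_def comp_G_def)

lemma gram_complete_square:
  assumes "sym_form b"
  shows "b (1, 0) (1, 0) * b w w = (fst w * b (1, 0) (1, 0) + snd w * b (1, 0) (0, 1))\<^sup>2 + gram b * (snd w)\<^sup>2"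
  unfolding sym_form_expand[OF assms, of w w] gram_def by (simp add: power2_eq_square algebra_simps)

lemma gram_pos_cases:
  assumes s: "sym_form b" and g: "gram b > 0"
  shows "b (1, 0) (1, 0) > 0 \<and> positive_definite b \<or> b (1, 0) (1, 0) < 0 \<and> negative_definite b"
proof -
  have pos: "b (1, 0) (1, 0) * b w w > 0" if "w \<noteq> 0" "b (1, 0) (1, 0) \<noteq> 0" for w
  proof (cases "snd w = 0")
    case True
    then have "fst w \<noteq> 0" using that by (auto simp: prod_eq_iff)
    then show ?thesis using True that unfolding gram_complete_square[OF s] by simp
  next
    case False
    then show ?thesis using g unfolding gram_complete_square[OF s]
      by (intro add_nonneg_pos) auto
  qed
  have "b (1, 0) (1, 0) \<noteq> 0" using g by (auto simp: gram_def)
  then show ?thesis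
    using pos unfolding positive_definite_def negative_definite_def
    by (smt (verit) zero_less_mult_iff)
qed

lemma degenerate_gram: assumes s: "sym_form b" and d: "degenerate b" shows "gram b = 0"
proof -
  obtain w where w: "w \<noteq> 0" "\<And>z. b w z = 0" using d unfolding degenerate_def null_vector_def by blast
  have "fst w * b (1, 0) (1, 0) + snd w * b (1, 0) (0, 1) = 0" "fst w * b (1, 0) (0, 1) + snd w * b (0, 1) (0, 1) = 0"
    using w(2)[of "(1, 0)"] w(2)[of "(0, 1)"] sym_form_expand[OF s, of w] by simp_all
  then have "fst w * gram b = 0" "snd w * gram b = 0"
    unfolding gram_def power2_eq_square by algebra+
  then show ?thesis using w(1) by (auto simp: prod_eq_iff)
qed

lemma gram_neg_indefinite: assumes s: "sym_form b" and g: "gram b < 0" shows "indefinite b"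
proof -
  let ?E = "b (1, 0) (1, 0)" and ?F = "b (1, 0) (0, 1)" and ?G = "b (0, 1) (0, 1)"
  have nd: "\<not> degenerate b" using degenerate_gram[OF s] g by auto
  have e: "b (- ?F, ?E) (- ?F, ?E) = ?E * gram b"
    using sym_form_expand[OF s, of "(- ?F, ?E)" "(- ?F, ?E)"] by (simp add: gram_def power2_eq_square algebra_simps)
  consider "?E > 0" | "?E < 0" | "?E = 0" by linarith
  then have "(\<exists>w. b w w > 0) \<and> (\<exists>w. b w w < 0)"
  proof cases
    case 1
    then show ?thesis using e g by (metis mult_pos_neg)
  next
    case 2
    then show ?thesis using e g by (metis mult_neg_neg)
  next
    case 3
    then have F: "?F \<noteq> 0" using g by (auto simp: gram_def)
    have "b ((c - ?G) / (2 * ?F), 1) ((c - ?G) / (2 * ?F), 1) = c" for c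
      using F 3 sym_form_expand[OF s, of "((c - ?G) / (2 * ?F), 1)" "((c - ?G) / (2 * ?F), 1)"]
      by (simp add: field_simps)
    from this[of 1] this[of "-1"] show ?thesis
      by (metis neg_less_0_iff_less zero_less_one)
  qed
  with nd show ?thesis by (simp add: indefinite_def)
qed

text \<open>A degenerate form is a multiple of the square of the linear form annihilating its null vector.\<close>

lemma rank_one_form:
  assumes s: "sym_form b" and n: "null_vector b n"
  shows "\<exists>c. b (1, 0) (1, 0) = c * (snd n)\<^sup>2 \<and> b (1, 0) (0, 1) = - c * fst n * snd n \<and> b (0, 1) (0, 1) = c * (fst n)\<^sup>2"
proof -
  let ?E = "b (1, 0) (1, 0)" and ?F = "b (1, 0) (0, 1)" and ?G = "b (0, 1) (0, 1)"
  have w: "n \<noteq> 0" "\<And>z. b n z = 0" using n unfolding null_vector_def by blast+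
  have 1: "fst n * ?E + snd n * ?F = 0" "fst n * ?F + snd n * ?G = 0"
    using w(2)[of "(1, 0)"] w(2)[of "(0, 1)"] sym_form_expand[OF s, of n] by simp_all
  define q where "q = (fst n)\<^sup>2 + (snd n)\<^sup>2"
  have q: "q \<noteq> 0" using w(1) by (auto simp: q_def prod_eq_iff sum_power2_eq_zero_iff)
  have "q * ?E = (?E + ?G) * (snd n)\<^sup>2" "q * ?F = - (?E + ?G) * fst n * snd n" "q * ?G = (?E + ?G) * (fst n)\<^sup>2"
    using 1 unfolding q_def power2_eq_square by algebra+
  then show ?thesis
    using q by (intro exI[of _ "(?E + ?G) / q"]) (simp add: field_simps)
qed

section \<open>Realization in a coordinate plane\<close>

text \<open>Applied to the discriminant at a semidefinite point; it shows that both signs occur nearby.\<close>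

lemma derivative_sign_change:
  fixes f :: "'a::real_normed_vector \<Rightarrow> real"
  assumes f: "(f has_derivative L) (at x)" "f x = 0" and L: "L v \<noteq> 0" and N: "open N" "x \<in> N"
  shows "\<exists>y\<in>N. f y > 0" "\<exists>y\<in>N. f y < 0"
proof -
  have pos: "\<exists>y\<in>N. 0 < g y" if g: "(g has_derivative K) (at x)" "g x = 0" "K v > 0" for g :: "'a \<Rightarrow> real" and K v
  proof -
    interpret K: bounded_linear K using g(1) by (rule has_derivative_bounded_linear)
    have "((\<lambda>t. g (x + t *\<^sub>R v)) has_derivative (\<lambda>t. K (t *\<^sub>R v))) (at 0)"
      by (rule has_derivative_compose[where g = g, of "\<lambda>t. x + t *\<^sub>R v"])
         (use g in \<open>auto intro!: derivative_eq_intros\<close>)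
    then have "((\<lambda>t. g (x + t *\<^sub>R v)) has_real_derivative K v) (at 0)"
      by (simp add: has_field_derivative_def K.scaleR mult.commute[of _ "K v"])
    from DERIV_pos_inc_right[OF this g(3)] obtain d where d: "d > 0" "\<And>t. 0 < t \<Longrightarrow> t < d \<Longrightarrow> 0 < g (x + t *\<^sub>R v)"
      using g(2) by auto
    have "isCont (\<lambda>t. x + t *\<^sub>R v) 0" by (intro continuous_intros)
    then have "\<forall>\<^sub>F t in at 0. x + t *\<^sub>R v \<in> N"
      unfolding isCont_def using topological_tendstoD[of _ "x" "at 0" N] N by simp
    then obtain e where e: "e > 0" "\<And>t. t \<noteq> 0 \<Longrightarrow> dist t 0 < e \<Longrightarrow> x + t *\<^sub>R v \<in> N"
      unfolding eventually_at by blast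
    have "min d e / 2 > 0" "min d e / 2 < d" "min d e / 2 < e" using d(1) e(1) by auto
    then show ?thesis using d(2)[of "min d e / 2"] e(2)[of "min d e / 2"] by (intro bexI[of _ "x + (min d e / 2) *\<^sub>R v"]) auto
  qed
  interpret L: bounded_linear L using f(1) by (rule has_derivative_bounded_linear)
  obtain v1 where v1: "L v1 > 0"
    using L linear_neg[OF L.linear, of v] by (metis linorder_neqE_linordered_idom neg_0_less_iff_less)
  show "\<exists>y\<in>N. f y > 0" using pos[OF f v1] .
  have "- L (- v1) > 0" using v1 by (simp add: linear_neg[OF L.linear])
  from pos[OF has_derivative_minus[OF f(1)], of "- v1"] this f(2) show "\<exists>y\<in>N. f y < 0" by auto
qed

lemma expands_eval: "expands f x a \<rho> \<Longrightarrow> y - x \<in> box0 \<rho> \<Longrightarrow> f y = evp a (y - x)"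
  unfolding expands_def by blast

text \<open>The choice of coordinates at a semidefinite point.  The bilinear-form valued differential \<open>H\<close> of the
metric expresses the quantity \<open>F\<^sub>u - E\<^sub>v/2\<close> of the coordinates \<open>x\<^sub>0 + uw + vn\<close> as \<open>A w\<close>, and the
polynomial \<open>A (w\<^sub>0 + \<tau>n)\<close> is not identically zero.\<close>

lemma plane_realization:
  fixes h :: local_metric
  assumes D: "open D" "x0 \<in> D" and sym: "\<And>x. x \<in> D \<Longrightarrow> sym_form (h x)"
    and an: "\<And>w z. real_analytic_on (\<lambda>x. h x w z) D"
    and deg: "degenerate (h x0)" and adm: "admissible_at h x0"
    and nn: "\<And>x. x \<in> D \<Longrightarrow> \<not> negative_definite (h x)"
  shows "\<exists>f f' V. open V \<and> x0 \<in> V \<and> V \<subseteq> D \<and> real_analytic_on (f :: real \<times> real \<Rightarrow> real ^ 3) V \<and> inj_on f V \<and>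
    (\<forall>x\<in>V. (f has_derivative f' x) (at x) \<and> inj (f' x) \<and> (\<forall>a b. lorentz (f' x a) (f' x b) = h x a b))"
proof -
  obtain n where n: "null_vector (h x0) n" using deg unfolding degenerate_def by blast
  note s0 = sym[OF D(2)]
  obtain c where c: "h x0 (1, 0) (1, 0) = c * (snd n)\<^sup>2" "h x0 (1, 0) (0, 1) = - c * fst n * snd n"
    "h x0 (0, 1) (0, 1) = c * (fst n)\<^sup>2" using rank_one_form[OF s0 n] by blast
  \<comment> \<open>a vector transversal to the null direction\<close>
  define m where "m = (snd n, - fst n)"
  define q where "q = (fst n)\<^sup>2 + (snd n)\<^sup>2"
  have q: "q > 0" using n by (auto simp: q_def null_vector_def prod_eq_iff sum_power2_gt_zero_iff)
  have hmm: "h x0 m m = c * q\<^sup>2"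
    unfolding sym_form_expand[OF s0, of m m] c by (simp add: m_def q_def power2_eq_square algebra_simps)
  have diffb: "(\<lambda>x. h x a b) differentiable (at x0)" for a b
    by (rule real_analytic_on_imp_differentiable[OF an D(2)])
  then obtain dE dF dG where
    dE: "((\<lambda>x. h x (1, 0) (1, 0)) has_derivative dE) (at x0)" and
    dF: "((\<lambda>x. h x (1, 0) (0, 1)) has_derivative dF) (at x0)" and
    dG: "((\<lambda>x. h x (0, 1) (0, 1)) has_derivative dG) (at x0)"
    unfolding differentiable_def by meson
  define H where "H a b k = fst a * fst b * dE k + (fst a * snd b + snd a * fst b) * dF k + snd a * snd b * dG k" for a b k
  have H: "((\<lambda>x. h x a b) has_derivative H a b) (at x0)" for a b
  proof -
    have "((\<lambda>x. fst a * fst b * h x (1, 0) (1, 0) + (fst a * snd b + snd a * fst b) * h x (1, 0) (0, 1)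
        + snd a * snd b * h x (0, 1) (0, 1)) has_derivative H a b) (at x0)"
      unfolding H_def[abs_def] by (intro has_derivative_add has_derivative_mult_right dE dF dG)
    then show ?thesis
      by (rule has_derivative_transform_within_open[OF _ D]) (rule sym_form_expand[OF sym, symmetric])
  qed
  have linH: "H a b (k + l) = H a b k + H a b l" "H a b (t *\<^sub>R k) = t * H a b k" for a b k l t
    using has_derivative_bounded_linear[OF H[of a b]]
    by (simp_all add: bounded_linear.linear linear_add linear_scale)
  have biH: "H (a + t *\<^sub>R a') b k = H a b k + t * H a' b k" "H b (a + t *\<^sub>R a') k = H b a k + t * H b a' k"
    "H a b k = H b a k" for a a' b t k
    by (simp_all add: H_def algebra_simps)
  have dL: "(discr h has_derivative (\<lambda>k. c * H n n k)) (at x0)"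
  proof -
    have "(discr h has_derivative (\<lambda>k. (h x0 (1, 0) (1, 0) * dG k + dE k * h x0 (0, 1) (0, 1)) - 2 * h x0 (1, 0) (0, 1) * dF k)) (at x0)"
      unfolding discr_def[abs_def] comp_E_def comp_F_def comp_G_def power2_eq_square
      by (rule derivative_eq_intros dE dF dG refl | simp add: fun_eq_iff)+
    then show ?thesis by (rule has_derivative_eq_rhs) (simp add: fun_eq_iff c H_def power2_eq_square algebra_simps)
  qed
  have "frechet_derivative (discr h) (at x0) = (\<lambda>k. c * H n n k)"
    by (rule frechet_derivative_at[OF dL, symmetric])
  then obtain k0 where k0: "c * H n n k0 \<noteq> 0" using adm unfolding admissible_at_def by metis
  have L0: "discr h x0 = 0" unfolding discr_gram by (rule degenerate_gram[OF s0 deg])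
  have "c > 0"
  proof (rule ccontr)
    assume "\<not> c > 0"
    then have "c < 0" using k0 by (metis linorder_neqE_linordered_idom mult_zero_left)
    then have neg: "h x0 m m < 0" unfolding hmm using q by (simp add: mult_neg_pos)
    have "continuous_on D (\<lambda>x. h x m m)"
      by (intro continuous_at_imp_continuous_on ballI differentiable_imp_continuous_within
          real_analytic_on_imp_differentiable[OF an])
    then have "open (D \<inter> (\<lambda>x. h x m m) -` {..<0})"
      using D(1) by (intro continuous_open_preimage) auto
    from derivative_sign_change(1)[OF dL L0 k0 this] neg D(2)
    obtain y where y: "y \<in> D" "h y m m < 0" "discr h y > 0" by auto
    then have "negative_definite (h y) \<or> positive_definite (h y)"
      using gram_pos_cases[OF sym] unfolding discr_gram by blast
    moreover have "m \<noteq> 0" using q by (auto simp: m_def q_def zero_prod_def)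
    ultimately show False using nn[OF y(1)] y(2) unfolding positive_definite_def by (metis order_less_asym)
  qed
  define w0 where "w0 = (1 / (sqrt c * q)) *\<^sub>R m"
  have w00: "h x0 w0 w0 = 1"
  proof -
    have "h x0 w0 w0 = (1 / (sqrt c * q)) * ((1 / (sqrt c * q)) * (c * q\<^sup>2))"
      unfolding w0_def sym_form_add_scale[OF s0] hmm ..
    also have "\<dots> = (c / (sqrt c * sqrt c)) * (q\<^sup>2 / (q * q))" by (simp add: power2_eq_square)
    also have "\<dots> = 1" using \<open>c > 0\<close> q by (simp add: power2_eq_square)
    finally show ?thesis .
  qed
  have nul: "h x0 n z = 0" "h x0 z n = 0" for z
    using n s0 unfolding null_vector_def sym_form_def by metis+
  define A where "A w = H w n w - H w w n / 2" for w
  have Dt: "fst w0 * snd n - snd w0 * fst n \<noteq> 0"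
  proof -
    have "fst w0 * snd n - snd w0 * fst n = q / (sqrt c * q)"
      by (simp add: w0_def m_def q_def power2_eq_square add_divide_distrib)
    then show ?thesis using \<open>c > 0\<close> q by simp
  qed
  have Aeq: "A (w0 + \<tau> *\<^sub>R n) = A w0 + \<tau> * H n n w0 + \<tau>\<^sup>2 / 2 * H n n n" for \<tau>
    unfolding A_def biH(1,2) linH biH(3)[of n w0] by (simp add: power2_eq_square field_simps)
  \<comment> \<open>a quadratic polynomial vanishing at 0, 1 and -1 is zero, so \<open>H n n\<close> would vanish on the basis \<open>w0, n\<close>\<close>
  have "\<exists>\<tau>. A (w0 + \<tau> *\<^sub>R n) \<noteq> 0"
  proof (rule ccontr)
    assume "\<not> (\<exists>\<tau>. A (w0 + \<tau> *\<^sub>R n) \<noteq> 0)"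
    then have "A (w0 + \<tau> *\<^sub>R n) = 0" for \<tau> by blast
    from this[of 0] this[of 1] this[of "- 1"] have z: "H n n w0 = 0" "H n n n = 0" unfolding Aeq by simp_all
    define \<Delta> where "\<Delta> = fst w0 * snd n - snd w0 * fst n"
    have "\<Delta> *\<^sub>R k0 = (fst k0 * snd n - snd k0 * fst n) *\<^sub>R w0 + (fst w0 * snd k0 - snd w0 * fst k0) *\<^sub>R n"
      by (simp add: prod_eq_iff \<Delta>_def algebra_simps)
    then have "\<Delta> * H n n k0 = 0" using linH z by (metis add_0 mult_zero_right)
    then show False using Dt k0 by (simp add: \<Delta>_def)
  qed
  then obtain \<tau> where \<tau>: "A (w0 + \<tau> *\<^sub>R n) \<noteq> 0" by blast
  define w where "w = w0 + \<tau> *\<^sub>R n"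
  have w: "h x0 w w = 1" "h x0 w n = 0" "h x0 n n = 0" "A w \<noteq> 0"
    unfolding w_def sym_form_add_scale[OF s0] nul w00 using \<tau> by simp_all
  define \<Delta> where "\<Delta> = fst w * snd n - snd w * fst n"
  have \<Delta>: "\<Delta> \<noteq> 0" using Dt by (simp add: \<Delta>_def w_def algebra_simps)
  define M where "M y = x0 + fst y *\<^sub>R w + snd y *\<^sub>R n" for y :: "real \<times> real"
  define l where "l z = ((snd n * fst z - fst n * snd z) / \<Delta>, (fst w * snd z - snd w * fst z) / \<Delta>)" for z :: "real \<times> real"
  define N where "N x = l (x - x0)" for x
  have l_decomp: "z = fst (l z) *\<^sub>R w + snd (l z) *\<^sub>R n" for z
  proof -
    have "(snd n * fst z - fst n * snd z) * fst w + (fst w * snd z - snd w * fst z) * fst n = \<Delta> * fst z"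
      "(snd n * fst z - fst n * snd z) * snd w + (fst w * snd z - snd w * fst z) * snd n = \<Delta> * snd z"
      by (simp_all add: \<Delta>_def algebra_simps)
    then show ?thesis
      using \<Delta> by (simp add: l_def prod_eq_iff flip: add_divide_distrib)
  qed
  have MN: "M (N x) = x" for x using l_decomp[of "x - x0"] by (simp add: M_def N_def algebra_simps)
  have l_inj: "inj l" by (rule injI) (metis l_decomp)
  have lin_l: "bounded_linear l"
  proof -
    have "linear l" by (rule linearI) (auto simp: l_def add_divide_distrib diff_divide_distrib algebra_simps)
    then show ?thesis by (simp add: linear_conv_bounded_linear)
  qed
  have N_der: "(N has_derivative l) (at x)" for x
    unfolding N_def[abs_def]
    by (rule bounded_linear.has_derivative[OF lin_l, of "\<lambda>x. x - x0" "\<lambda>x. x", simplified])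
       (rule derivative_eq_intros refl | simp)+
  have M_der: "(M has_derivative (\<lambda>k. fst k *\<^sub>R w + snd k *\<^sub>R n)) (at y)" for y
    unfolding M_def[abs_def] by (rule derivative_eq_intros refl | simp)+
  have M_an: "real_analytic_on M S" for S
    using real_analytic_on_affine_pair[of "fst x0" "fst w" "fst n" "snd x0" "snd w" "snd n" S]
    by (rule back_subst[where P = "\<lambda>f. real_analytic_on f S"]) (auto simp: M_def fun_eq_iff prod_eq_iff mult.commute)
  have N_an: "real_analytic_on N S" for S
    using real_analytic_on_affine_pair[of "- (snd n * fst x0 - fst n * snd x0) / \<Delta>" "snd n / \<Delta>" "- fst n / \<Delta>"
        "- (fst w * snd x0 - snd w * fst x0) / \<Delta>" "- snd w / \<Delta>" "fst w / \<Delta>" S]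
    by (rule back_subst[where P = "\<lambda>f. real_analytic_on f S"])
       (use \<Delta> in \<open>auto simp: N_def l_def fun_eq_iff field_simps\<close>)
  have M0: "M 0 = x0" by (simp add: M_def)
  have N0: "N x0 = 0" by (simp add: N_def l_def zero_prod_def)
  have ex: "\<exists>a \<rho>. expands (\<lambda>y. h (M y) a' b') 0 a \<rho>" for a' b'
  proof -
    have "real_analytic_on (\<lambda>y. h (M y) a' b') (M -` D)"
      by (rule real_analytic_on_compose_real[OF an M_an]) auto
    moreover have "0 \<in> M -` D" using D M0 by simp
    ultimately show ?thesis unfolding real_analytic_on_real_iff by blast
  qed
  obtain e r1 where e: "expands (\<lambda>y. h (M y) w w) 0 e r1" using ex by blast
  obtain f r2 where f: "expands (\<lambda>y. h (M y) w n) 0 f r2" using ex by blast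
  obtain g r3 where g: "expands (\<lambda>y. h (M y) n n) 0 g r3" using ex by blast
  have der0: "pcoeff (dU a) 0 = H a' b' w" "pcoeff (dV a) 0 = H a' b' n"
    if a: "expands (\<lambda>y. h (M y) a' b') 0 a \<rho>" for a a' b' \<rho>
  proof -
    have "((\<lambda>y. h (M y) a' b') has_derivative (\<lambda>k. H a' b' (fst k *\<^sub>R w + snd k *\<^sub>R n))) (at 0)"
      using has_derivative_compose[OF M_der[of 0], of "\<lambda>x. h x a' b'"] H[of a' b'] M0 by simp
    moreover have "(0 :: real \<times> real) - 0 \<in> box0 \<rho>" using a by (simp add: expands_def in_box0)
    from expands_has_derivative[OF a this]
    have "((\<lambda>y. h (M y) a' b') has_derivative (\<lambda>k. pcoeff (dU a) 0 * fst k + pcoeff (dV a) 0 * snd k)) (at 0)"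
      by (simp add: evp_0)
    ultimately have "(\<lambda>k. H a' b' (fst k *\<^sub>R w + snd k *\<^sub>R n)) = (\<lambda>k. pcoeff (dU a) 0 * fst k + pcoeff (dV a) 0 * snd k)"
      by (rule has_derivative_unique)
    from fun_cong[OF this, of "(1, 0)"] fun_cong[OF this, of "(0, 1)"]
    show "pcoeff (dU a) 0 = H a' b' w" "pcoeff (dV a) 0 = H a' b' n" by simp_all
  qed
  have "\<exists>\<Phi> \<Phi>' r. r > 0 \<and> real_analytic_on (\<Phi> :: real \<times> real \<Rightarrow> real ^ 3) (ball 0 r) \<and> inj_on \<Phi> (ball 0 r) \<and>
    (\<forall>y\<in>ball 0 r. (\<Phi> has_derivative \<Phi>' y) (at y) \<and> inj (\<Phi>' y) \<and>
       (\<forall>a b. lorentz (\<Phi>' y a) (\<Phi>' y b) = fst a * fst b * evp e y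
          + (fst a * snd b + snd a * fst b) * evp f y + snd a * snd b * evp g y))"
  proof (rule normal_form_surface)
    show "conv e" "conv f" "conv g" using e f g by (auto intro: expands_conv)
    show "pcoeff e 0 = 1" "pcoeff f 0 = 0" "pcoeff g 0 = 0"
      using expands_at[OF e] expands_at[OF f] expands_at[OF g] w M0 by simp_all
    show "pcoeff (dU f) 0 - pcoeff (dV e) 0 / 2 \<noteq> 0"
      using w(4) by (simp add: der0[OF f] der0[OF e] A_def)
  qed
  then obtain \<Phi> \<Phi>' r where r: "r > 0" and \<Phi>: "real_analytic_on (\<Phi> :: real \<times> real \<Rightarrow> real ^ 3) (ball 0 r)" "inj_on \<Phi> (ball 0 r)"
    "\<And>y. y \<in> ball 0 r \<Longrightarrow> (\<Phi> has_derivative \<Phi>' y) (at y)" "\<And>y. y \<in> ball 0 r \<Longrightarrow> inj (\<Phi>' y)"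
    "\<And>y a b. y \<in> ball 0 r \<Longrightarrow> lorentz (\<Phi>' y a) (\<Phi>' y b) = fst a * fst b * evp e y
          + (fst a * snd b + snd a * fst b) * evp f y + snd a * snd b * evp g y"
    by (elim exE conjE) blast
  define R where "R = min r (min r1 (min r2 r3))"
  have R: "R > 0" using r e f g by (auto simp: R_def expands_def)
  define V where "V = D \<inter> N -` ball 0 R"
  have Nc: "continuous_on S N" for S
    using N_der by (auto intro!: continuous_at_imp_continuous_on has_derivative_continuous)
  have "open V" unfolding V_def by (rule continuous_open_preimage[OF Nc D(1)]) simp
  moreover have "x0 \<in> V" using D(2) R by (simp add: V_def N0)
  moreover have "V \<subseteq> D" by (auto simp: V_def)
  moreover have "N ` V \<subseteq> ball 0 r" by (auto simp: V_def R_def)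
  then have "real_analytic_on (\<lambda>x. \<Phi> (N x)) V"
    by (rule real_analytic_on_compose[OF \<Phi>(1) N_an])
  moreover have "inj_on (\<lambda>x. \<Phi> (N x)) V"
  proof (rule inj_onI)
    fix x y assume "x \<in> V" "y \<in> V" "\<Phi> (N x) = \<Phi> (N y)"
    then have "N x = N y" using \<Phi>(2) \<open>N ` V \<subseteq> ball 0 r\<close> unfolding inj_on_def by blast
    then show "x = y" using MN by metis
  qed
  moreover have "((\<lambda>x. \<Phi> (N x)) has_derivative (\<lambda>k. \<Phi>' (N x) (l k))) (at x) \<and> inj (\<lambda>k. \<Phi>' (N x) (l k)) \<and>
      (\<forall>a b. lorentz (\<Phi>' (N x) (l a)) (\<Phi>' (N x) (l b)) = h x a b)" if x: "x \<in> V" for x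
  proof (intro conjI allI)
    have Nx: "N x \<in> ball 0 r" "x \<in> D" using x by (auto simp: V_def R_def)
    have Nb: "N x \<in> box0 r1" "N x \<in> box0 r2" "N x \<in> box0 r3"
      using x ball_subset_box[of r1] ball_subset_box[of r2] ball_subset_box[of r3] by (auto simp: V_def R_def)
    show "((\<lambda>x. \<Phi> (N x)) has_derivative (\<lambda>k. \<Phi>' (N x) (l k))) (at x)"
      by (rule has_derivative_compose[OF N_der \<Phi>(3)[OF Nx(1)]])
    show "inj (\<lambda>k. \<Phi>' (N x) (l k))" using inj_compose[OF \<Phi>(4)[OF Nx(1)] l_inj] by (simp add: o_def)
    fix a b
    have v: "evp e (N x) = h x w w" "evp f (N x) = h x w n" "evp g (N x) = h x n n"
      using expands_eval[OF e, of "N x"] expands_eval[OF f, of "N x"] expands_eval[OF g, of "N x"] Nb MN[of x] by simp_all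
    note sx = sym[OF Nx(2)]
    have "h x a b = h x (fst (l a) *\<^sub>R w + snd (l a) *\<^sub>R n) (fst (l b) *\<^sub>R w + snd (l b) *\<^sub>R n)"
      by (simp flip: l_decomp)
    also have "\<dots> = fst (l a) * fst (l b) * h x w w + (fst (l a) * snd (l b) + snd (l a) * fst (l b)) * h x w n
        + snd (l a) * snd (l b) * h x n n"
    proof -
      have "h x n w = h x w n" using sx unfolding sym_form_def by blast
      then show ?thesis unfolding sym_form_add_scale[OF sx] by (simp add: algebra_simps)
    qed
    finally show "lorentz (\<Phi>' (N x) (l a)) (\<Phi>' (N x) (l b)) = h x a b"
      unfolding \<Phi>(5)[OF Nx(1)] v by simp
  qed
  ultimately show ?thesis
    by (intro exI[of _ "\<lambda>x. \<Phi> (N x)"] exI[of _ "\<lambda>x k. \<Phi>' (N x) (l k)"] exI[of _ V] conjI ballI; blast)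
qed

section \<open>Transfer to the manifold\<close>

lemma chart_homeomorphic:
  assumes "is_chart X c"
  shows "homeomorphic_map (subtopology X (fst c)) (top_of_set (coords c)) (snd c)"
    "topspace (subtopology X (fst c)) = fst c" "inj_on (snd c) (fst c)" "openin X (fst c)" "open (coords c)"
proof -
  show o: "openin X (fst c)" and "open (coords c)" using assms by (auto simp: is_chart_def)
  then show t: "topspace (subtopology X (fst c)) = fst c" using openin_subset by fastforce
  show h: "homeomorphic_map (subtopology X (fst c)) (top_of_set (coords c)) (snd c)"
    using assms t unfolding is_chart_def embedding_map_def coords_def by simp
  show "inj_on (snd c) (fst c)" using homeomorphic_imp_injective_map[OF h] t by simp
qed

lemma chart_inv_snd: "is_chart X c \<Longrightarrow> q \<in> fst c \<Longrightarrow> chart_inv c (snd c q) = q"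
  unfolding chart_inv_def by (simp add: chart_homeomorphic(3))

lemma chart_preimage_open:
  assumes c: "is_chart X c" and V: "open V"
  shows "openin X {q \<in> fst c. snd c q \<in> V}"
proof -
  have "continuous_map (subtopology X (fst c)) (top_of_set (coords c)) (snd c)"
    by (rule homeomorphic_imp_continuous_map[OF chart_homeomorphic(1)[OF c]])
  then have "continuous_map (subtopology X (fst c)) euclidean (snd c)"
    by (simp add: continuous_map_in_subtopology)
  from openin_continuous_map_preimage[OF this, of V, unfolded chart_homeomorphic(2)[OF c]] V
  have "openin (subtopology X (fst c)) {q \<in> fst c. snd c q \<in> V}" by simp
  then show ?thesis using chart_homeomorphic(4)[OF c] openin_trans_full by blast
qed

lemma chart_image_open:
  assumes c: "is_chart X c" and W: "openin X W" "W \<subseteq> fst c"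
  shows "open (snd c ` W)"
proof -
  have "openin (subtopology X (fst c)) W" using W by (simp add: openin_open_subtopology chart_homeomorphic(4)[OF c])
  then have "openin (top_of_set (coords c)) (snd c ` W)"
    using homeomorphic_map_openness[OF chart_homeomorphic(1)[OF c], of W, unfolded chart_homeomorphic(2)[OF c]] W by simp
  then show ?thesis using chart_homeomorphic(5)[OF c] openin_open_eq by blast
qed

context
  fixes X :: "'a topology" and A :: "'a chart set"
  assumes man: "real_analytic_2manifold X A"
begin

lemma is_chart: "c \<in> A \<Longrightarrow> is_chart X c"
  using man by (simp add: real_analytic_2manifold_def)

lemma overlap_open: "c \<in> A \<Longrightarrow> d \<in> A \<Longrightarrow> openin X (fst c \<inter> fst d) \<and> open (snd c ` (fst c \<inter> fst d))"
  using chart_image_open[OF is_chart, of c "fst c \<inter> fst d"]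
    openin_Int[OF chart_homeomorphic(4)[OF is_chart, of c] chart_homeomorphic(4)[OF is_chart, of d]] by blast

lemma transition_analytic: "c \<in> A \<Longrightarrow> d \<in> A \<Longrightarrow> real_analytic_on (transition c d) (snd c ` (fst c \<inter> fst d))"
  using man by (simp add: real_analytic_2manifold_def compatible_def)

lemma transition_snd: "c \<in> A \<Longrightarrow> q \<in> fst c \<Longrightarrow> transition c d (snd c q) = snd d q"
  by (simp add: transition_def chart_inv_snd[OF is_chart])

lemma transition_has_derivative:
  assumes "c \<in> A" "d \<in> A" "q \<in> fst c \<inter> fst d"
  shows "(transition c d has_derivative frechet_derivative (transition c d) (at (snd c q))) (at (snd c q))"
  using real_analytic_on_prod_differentiable[OF transition_analytic[OF assms(1,2)], of "snd c q"] assms(3)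
  by (simp add: frechet_derivative_works)

lemma transition_derivative_inverse:
  assumes "c \<in> A" "d \<in> A" "q \<in> fst c \<inter> fst d"
  shows "frechet_derivative (transition d c) (at (snd d q)) (frechet_derivative (transition c d) (at (snd c q)) w) = w"
proof -
  let ?D1 = "frechet_derivative (transition c d) (at (snd c q))" and ?D2 = "frechet_derivative (transition d c) (at (snd d q))"
  have "(transition c d has_derivative ?D1) (at (snd c q))"
    by (rule transition_has_derivative[OF assms])
  moreover have "(transition d c has_derivative ?D2) (at (transition c d (snd c q)))"
    using transition_has_derivative[OF assms(2,1), of q] assms by (simp add: transition_snd Int_commute)
  ultimately have "((\<lambda>x. transition d c (transition c d x)) has_derivative (\<lambda>w. ?D2 (?D1 w))) (at (snd c q))"
    by (rule has_derivative_compose)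
  then have "((\<lambda>x. x) has_derivative (\<lambda>w. ?D2 (?D1 w))) (at (snd c q))"
    by (rule has_derivative_transform_within_open[of _ _ _ _ "snd c ` (fst c \<inter> fst d)"])
       (use assms overlap_open[OF assms(1,2)] in \<open>auto simp: transition_snd\<close>)
  then have "(\<lambda>w. ?D2 (?D1 w)) = (\<lambda>w. w)"
    using has_derivative_unique has_derivative_ident by blast
  then show ?thesis by (rule fun_cong)
qed

context
  fixes g :: "'a metric_field"
  assumes metric: "real_analytic_metric A g"
begin

lemma metric_transform:
  assumes "c \<in> A" "d \<in> A" "q \<in> fst c \<inter> fst d"
  shows "g c (snd c q) w z = g d (snd d q) (frechet_derivative (transition c d) (at (snd c q)) w)
                      (frechet_derivative (transition c d) (at (snd c q)) z)"
  using metric assms unfolding real_analytic_metric_def by blast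

text \<open>Needed because degeneracy and admissibility of a point may be witnessed by different charts.\<close>

lemma degenerate_chart_change:
  assumes "c \<in> A" "d \<in> A" "q \<in> fst c \<inter> fst d" "degenerate (g d (snd d q))"
  shows "degenerate (g c (snd c q))"
proof -
  let ?D1 = "frechet_derivative (transition c d) (at (snd c q))" and ?D2 = "frechet_derivative (transition d c) (at (snd d q))"
  obtain w where w: "w \<noteq> 0" "\<And>z. g d (snd d q) w z = 0"
    using assms(4) unfolding degenerate_def null_vector_def by blast
  have inv: "?D1 (?D2 w) = w" using transition_derivative_inverse[OF assms(2,1), of q w] assms(3) by (simp add: Int_commute)
  have lin: "linear ?D1" using transition_has_derivative[OF assms(1-3)] by (rule has_derivative_linear)
  have "?D2 w \<noteq> 0"
  proof
    assume "?D2 w = 0"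
    then have "w = 0" using inv linear_0[OF lin] by simp
    with w(1) show False ..
  qed
  moreover have "g c (snd c q) (?D2 w) z = 0" for z
    using metric_transform[OF assms(1-3), of "?D2 w" z] unfolding inv w(2) .
  ultimately show ?thesis unfolding degenerate_def null_vector_def by blast
qed

lemma metric_sym_form: "c \<in> A \<Longrightarrow> x \<in> coords c \<Longrightarrow> sym_form (g c x)"
  using metric unfolding real_analytic_metric_def sym_form_def by blast

lemma metric_analytic: "c \<in> A \<Longrightarrow> real_analytic_on (\<lambda>x. g c x w z) (coords c)"
  using metric unfolding real_analytic_metric_def by blast

end

end

text \<open>The source of the positive definite and of the indefinite points of the surface.\<close>

lemma discr_changes_sign:
  fixes h :: local_metric
  assumes x0: "x0 \<in> D" and sym: "sym_form (h x0)"
    and an: "\<And>w z. real_analytic_on (\<lambda>x. h x w z) D"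
    and deg: "degenerate (h x0)" and adm: "admissible_at h x0" and N: "open N" "x0 \<in> N"
  shows "\<exists>y\<in>N. discr h y > 0" "\<exists>y\<in>N. discr h y < 0"
proof -
  have "(\<lambda>x. h x a b) differentiable (at x0)" for a b
    by (rule real_analytic_on_imp_differentiable[OF an x0])
  then have "discr h differentiable (at x0)"
    unfolding discr_def[abs_def] comp_E_def comp_F_def comp_G_def power2_eq_square
    by (intro differentiable_diff differentiable_mult)
  then have d: "(discr h has_derivative frechet_derivative (discr h) (at x0)) (at x0)"
    by (simp add: frechet_derivative_works)
  obtain k where "frechet_derivative (discr h) (at x0) k \<noteq> 0"
    using adm unfolding admissible_at_def by blast
  from derivative_sign_change[OF d _ this N] degenerate_gram[OF sym deg]
  show "\<exists>y\<in>N. discr h y > 0" "\<exists>y\<in>N. discr h y < 0" by (auto simp: discr_gram)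
qed

text \<open>The surface is the local realization in the coordinate plane composed with a chart, restricted to
a ball whose closure still lies in the domain of the realization: on the compact closure an
injective continuous map is an embedding.  Other charts are dealt with by composing with the
transition maps.\<close>

theorem corollary6p2:
  fixes X :: "'a topology" and A :: "'a chart set" and g :: "'a metric_field"
  assumes "real_analytic_2manifold X A" and "connected_space X"
    and "real_analytic_metric A g" and "generic_mixed_type_metric X A g"
  shows "\<forall>p \<in> semidefinite_points X A g. \<exists>U f.
           openin X U \<and> p \<in> U \<and>
           real_analytic_mixed_type_surface X A U f \<and>
           metrics_coincide_on A U g (first_fundamental_form f)"
proof
  fix p assume p: "p \<in> semidefinite_points X A g"
  note man = assms(1) and met = assms(3)
  have adm: "admissible_metric X A g" using assms(4) by (simp add: generic_mixed_type_metric_def)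
  obtain c where c: "c \<in> A" "p \<in> fst c" "admissible_at (g c) (snd c p)"
    using adm p unfolding admissible_metric_def in_some_chart_def by blast
  obtain d where d: "d \<in> A" "p \<in> fst d" "degenerate (g d (snd d p))"
    using p unfolding semidefinite_points_def form_at_def in_some_chart_def by blast
  note ch = is_chart[OF man c(1)]
  have deg: "degenerate (g c (snd c p))"
    by (rule degenerate_chart_change[OF man met c(1) d(1) _ d(3)]) (use c d in simp)
  have x0: "snd c p \<in> coords c" using c by (simp add: coords_def)
  have nn: "\<not> negative_definite (g c x)" if x: "x \<in> coords c" for x
  proof
    assume "negative_definite (g c x)"
    moreover obtain q where q: "q \<in> fst c" "x = snd c q" using x unfolding coords_def by blast
    ultimately have "form_at A g q negative_definite"
      unfolding form_at_def in_some_chart_def using c(1) by blast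
    moreover have "q \<in> topspace X" using q(1) chart_homeomorphic(4)[OF ch] openin_subset by blast
    ultimately show False using adm unfolding admissible_metric_def by blast
  qed
  note sf = metric_sym_form[OF man met c(1)] and an = metric_analytic[OF man met c(1)]
  have "\<exists>F F' V. open V \<and> snd c p \<in> V \<and> V \<subseteq> coords c \<and>
      real_analytic_on (F :: real \<times> real \<Rightarrow> real ^ 3) V \<and> inj_on F V \<and>
      (\<forall>x\<in>V. (F has_derivative F' x) (at x) \<and> inj (F' x) \<and> (\<forall>a b. lorentz (F' x a) (F' x b) = g c x a b))"
    by (rule plane_realization[OF chart_homeomorphic(5)[OF ch] x0 sf an deg c(3) nn])
  then obtain F :: "real \<times> real \<Rightarrow> real ^ 3" and F' V where V: "open V" "snd c p \<in> V" "V \<subseteq> coords c"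
    and F: "real_analytic_on F V" "inj_on F V"
    "\<And>x. x \<in> V \<Longrightarrow> (F has_derivative F' x) (at x)" "\<And>x. x \<in> V \<Longrightarrow> inj (F' x)"
    "\<And>x a b. x \<in> V \<Longrightarrow> lorentz (F' x a) (F' x b) = g c x a b"
    by (elim exE conjE) blast
  obtain r where r: "r > 0" "cball (snd c p) r \<subseteq> V" using V(1,2) open_contains_cball by blast
  define B where "B = ball (snd c p) r"
  have B: "open B" "snd c p \<in> B" "B \<subseteq> V" "connected B" using r by (auto simp: B_def)
  define U where "U = {q \<in> fst c. snd c q \<in> B}"
  define f where "f = F \<circ> snd c"
  have U: "openin X U" "p \<in> U" "U \<subseteq> fst c" "snd c ` U = B"
  proof -
    show "openin X U" unfolding U_def by (rule chart_preimage_open[OF ch B(1)])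
    show "p \<in> U" "U \<subseteq> fst c" using c B by (auto simp: U_def)
    show "snd c ` U = B" using B V by (force simp: U_def coords_def)
  qed
  have hom: "homeomorphic_map (subtopology X U) (top_of_set B) (snd c)"
  proof -
    have "homeomorphic_map (subtopology (subtopology X (fst c)) U) (subtopology (top_of_set (coords c)) B) (snd c)"
      by (rule homeomorphic_map_subtopologies_alt[OF chart_homeomorphic(1)[OF ch]])
         (simp add: U_def chart_homeomorphic(2)[OF ch])
    moreover have "fst c \<inter> U = U" "coords c \<inter> B = B" using U B V by auto
    ultimately show ?thesis by (simp add: subtopology_subtopology)
  qed
  have conn: "connectedin X U"
  proof -
    have "connectedin (subtopology X (fst c)) U \<longleftrightarrow> connectedin (top_of_set (coords c)) (snd c ` U)"
      using homeomorphic_map_connectedness[OF chart_homeomorphic(1)[OF ch], of U, unfolded chart_homeomorphic(2)[OF ch]] U by simp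
    then show ?thesis using B V U by (simp add: connectedin_subtopology)
  qed
  have emb: "embedding_map (subtopology X U) euclidean f"
  proof -
    let ?K = "cball (snd c p) r"
    have "continuous_on ?K F"
      using F(3) r(2) by (intro continuous_at_imp_continuous_on) (auto intro: has_derivative_continuous)
    then have cont: "continuous_map (top_of_set ?K) euclidean F" by simp
    moreover have "closed_map (top_of_set ?K) euclidean F"
      by (rule continuous_imp_closed_map[OF cont]) (simp_all add: compact_space_subtopology)
    moreover have "inj_on F (topspace (top_of_set ?K))" using F(2) r(2) inj_on_subset by auto
    ultimately have "embedding_map (top_of_set ?K) euclidean F" by (rule injective_closed_imp_embedding_map)
    moreover have "embedding_map (subtopology X U) (top_of_set ?K) (snd c)"
    proof -
      have "topspace (subtopology X U) = U" using U(1) openin_subset by fastforce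
      then have "embedding_map (subtopology X U) euclidean (snd c) \<and> snd c ` topspace (subtopology X U) \<subseteq> ?K"
        using hom U(4) by (simp add: embedding_map_def B_def ball_subset_cball)
      then show ?thesis by (simp add: embedding_map_in_subtopology)
    qed
    ultimately show ?thesis unfolding f_def by (rule embedding_map_compose[rotated])
  qed
  have loc: "open (snd e ` (fst e \<inter> U))"
    "\<And>x. x \<in> snd e ` (fst e \<inter> U) \<Longrightarrow> F (transition e c x) = (f \<circ> chart_inv e) x"
    "snd e ` (fst e \<inter> U) \<subseteq> snd e ` (fst e \<inter> fst c)" "transition e c ` snd e ` (fst e \<inter> U) \<subseteq> V" if e: "e \<in> A" for e
  proof -
    show "open (snd e ` (fst e \<inter> U))"
      using chart_image_open[OF is_chart[OF man e]] chart_homeomorphic(4)[OF is_chart[OF man e]] U(1) by blast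
    show "F (transition e c x) = (f \<circ> chart_inv e) x" for x by (simp add: f_def transition_def)
    show "snd e ` (fst e \<inter> U) \<subseteq> snd e ` (fst e \<inter> fst c)" using U(3) by auto
    show "transition e c ` snd e ` (fst e \<inter> U) \<subseteq> V"
      using transition_snd[OF man e, where d = c] B(3) by (auto simp: U_def)
  qed
  have diff: "differential_in e f (snd e q) = (\<lambda>w. F' (snd c q) (frechet_derivative (transition e c) (at (snd e q)) w))"
    if e: "e \<in> A" and q: "q \<in> fst e \<inter> U" for e q
  proof -
    have qc: "q \<in> fst e \<inter> fst c" "snd c q \<in> V" using q U(3) B(3) by (auto simp: U_def)
    have "(F has_derivative F' (snd c q)) (at (transition e c (snd e q)))"
      using F(3)[OF qc(2)] transition_snd[OF man e] qc by simp
    from has_derivative_compose[OF transition_has_derivative[OF man e c(1) qc(1)] this]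
    have "((f \<circ> chart_inv e) has_derivative (\<lambda>w. F' (snd c q) (frechet_derivative (transition e c) (at (snd e q)) w))) (at (snd e q))"
      by (rule has_derivative_transform_within_open[OF _ loc(1)[OF e]]) (use q loc(2)[OF e] in auto)
    then show ?thesis unfolding differential_in_def by (rule frechet_derivative_at[symmetric])
  qed
  have coincide: "g e (snd e q) w z = first_fundamental_form f e (snd e q) w z"
    if e: "e \<in> A" and q: "q \<in> fst e \<inter> U" for e q w z
  proof -
    have qc: "q \<in> fst e \<inter> fst c" "snd c q \<in> V" using q U(3) B(3) by (auto simp: U_def)
    show ?thesis
      unfolding first_fundamental_form_def diff[OF e q] F(5)[OF qc(2)] by (rule metric_transform[OF man met e c(1) qc(1)])
  qed
  have surface: "real_analytic_surface X A U f"
    unfolding real_analytic_surface_def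
  proof (intro conjI ballI U conn emb)
    fix e assume e: "e \<in> A"
    have "real_analytic_on (\<lambda>x. F (transition e c x)) (snd e ` (fst e \<inter> U))"
      by (rule real_analytic_on_compose[OF F(1) real_analytic_on_subset[OF transition_analytic[OF man e c(1)] loc(3)[OF e]] loc(4)[OF e]])
    then show "real_analytic_on (f \<circ> chart_inv e) (snd e ` (fst e \<inter> U))"
      by (rule real_analytic_on_cong[OF _ loc(1)[OF e] loc(2)[OF e]])
    fix x assume "x \<in> snd e ` (fst e \<inter> U)"
    then obtain q where q: "q \<in> fst e \<inter> U" "x = snd e q" by blast
    have qc: "q \<in> fst e \<inter> fst c" "snd c q \<in> V" using q U(3) B(3) by (auto simp: U_def)
    have "inj (frechet_derivative (transition e c) (at (snd e q)))"
      by (rule inj_on_inverseI, rule transition_derivative_inverse[OF man e c(1) qc(1)])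
    from inj_compose[OF F(4)[OF qc(2)] this] show "inj (differential_in e f x)"
      unfolding q(2) diff[OF e q(1)] by (simp add: o_def)
  qed
  have form: "form_at A (first_fundamental_form f) q Q" if "q \<in> U" "Q (g c (snd c q))" for q Q
  proof -
    have q: "q \<in> fst c \<inter> U" using that U by auto
    have "first_fundamental_form f c (snd c q) = g c (snd c q)"
      by (intro ext) (simp add: coincide[OF c(1) q])
    then show ?thesis unfolding form_at_def in_some_chart_def using c(1) q that(2) by auto
  qed
  have sign: "\<exists>y\<in>B. discr (g c) y > 0" "\<exists>y\<in>B. discr (g c) y < 0"
    by (rule discr_changes_sign[OF x0 sf[OF x0] an deg c(3) B(1,2)])+
  have "\<exists>q\<in>U. form_at A (first_fundamental_form f) q positive_definite"
  proof -
    obtain y where y: "y \<in> B" "discr (g c) y > 0" using sign by blast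
    then have "y \<in> coords c" using B V by blast
    then have "positive_definite (g c y)" using gram_pos_cases[OF sf] y nn by (auto simp: discr_gram)
    moreover obtain q where "q \<in> U" "y = snd c q" using y U(4) by blast
    ultimately show ?thesis using form by blast
  qed
  moreover have "\<exists>q\<in>U. form_at A (first_fundamental_form f) q indefinite"
  proof -
    obtain y where y: "y \<in> B" "discr (g c) y < 0" using sign by blast
    then have "y \<in> coords c" using B V by blast
    then have "indefinite (g c y)" using gram_neg_indefinite[OF sf] y by (auto simp: discr_gram)
    moreover obtain q where "q \<in> U" "y = snd c q" using y U(4) by blast
    ultimately show ?thesis using form by blast
  qed
  moreover have "\<exists>q\<in>U. form_at A (first_fundamental_form f) q degenerate"
    using form[OF U(2), of degenerate] deg U(2) by blast
  ultimately have "real_analytic_mixed_type_surface X A U f"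
    using surface by (simp add: real_analytic_mixed_type_surface_def)
  moreover have "metrics_coincide_on A U g (first_fundamental_form f)"
    unfolding metrics_coincide_on_def using coincide by blast
  ultimately show "\<exists>U f. openin X U \<and> p \<in> U \<and> real_analytic_mixed_type_surface X A U f \<and>
      metrics_coincide_on A U g (first_fundamental_form f)"
    using U(1,2) by blast
qed

end
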